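(* Let $a,b,c$ be real numbers with $2\le a\le b\le c$ and $ab\ge 2c$. Let $B$ be a $3\times 3$ skew-symmetrizable integer matrix with skew-symmetrizer $D=\operatorname{diag}\{d_1,d_2,d_3\}$ whose diagram $\Gamma(B)=\Gamma_0$ is the oriented $3$-cycle with edges $2\to 1$ of weight $b$, $1\to 3$ of weight $c$, and $3\to 2$ of weight $a$ (so $\Gamma_0$ is mutation-cyclic). Let $\mathcal{A}$ be the cluster algebra of rank $3$ with trivial coefficients whose initial exchange matrix is $B$. Then the cluster automorphism group $\operatorname{Aut}(\mathcal{A})$ is given, up to isomorphism, as follows. (1) Case $a=2$: - if $a=b=c$ and $d_1=d_2=d_3$, then $\operatorname{Aut}(\mathcal{A})\cong N\rtimes_\varphi S_3$; - if $a=b=c$ and exactly two of $d_1,d_2,d_3$ are equal, then $\operatorname{Aut}(\mathcal{A})\cong N\rtimes_\tau\mathbb{Z}_2$; - if $a=b=c$ and $d_1,d_2,d_3$ are pairwise distinct, then $\operatorname{Aut}(\mathcal{A})\cong N$; - if $a<b=c$, then $\operatorname{Aut}(\mathcal{A})\cong D_\infty$. (2) Case $a>2$ and $ab=2c$: - if $a=b<c$ and $d_1=d_3$, then $\operatorname{Aut}(\mathcal{A})\cong\mathbb{Z}_2\oplus\mathbb{Z}_2$; - if $a=b<c$ and $d_1\ne d_3$, then $\operatorname{Aut}(\mathcal{A})\cong\mathbb{Z}_2$; - if $a<b<c$, then $\operatorname{Aut}(\mathcal{A})\cong\mathbb{Z}_2$. (3) Case $a>2$ and $ab>2c$: - if $a=b=c$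 and $d_1=d_2=d_3$, then $\operatorname{Aut}(\mathcal{A})\cong S_3$; - if $a=b=c$ and exactly two of $d_1,d_2,d_3$ are equal, then $\operatorname{Aut}(\mathcal{A})\cong\mathbb{Z}_2$; - if $a=b=c$ and $d_1,d_2,d_3$ are pairwise distinct, then $\operatorname{Aut}(\mathcal{A})$ is trivial; - if $a<b=c$, then $\operatorname{Aut}(\mathcal{A})\cong\mathbb{Z}_2$ when $d_2=d_3$, and $\operatorname{Aut}(\mathcal{A})$ is trivial when $d_2\neq d_3$; - if $a=b<c$, then $\operatorname{Aut}(\mathcal{A})\cong\mathbb{Z}_2$ when $d_1=d_3$, and $\operatorname{Aut}(\mathcal{A})$ is trivial when $d_1\neq d_3$; - if $a<b<c$, then $\operatorname{Aut}(\mathcal{A})$ is trivial. (The constraints $2\le a\le b\le c$, $ab\ge 2c$ make this list exhaustive.)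
   Context: Cluster algebras. Write $[x]_+=\max\{x,0\}$. An $n\times n$ integer matrix $B=(b_{ij})$ is skew-symmetrizable with skew-symmetrizer $D=\operatorname{diag}\{d_1,\dots,d_n\}$ ($d_i$ positive integers) if $DB$ is skew-symmetric. Let $\mathcal{F}$ be a field isomorphic to the field of rational functions over $\mathbb{Q}$ in $n$ variables. A labeled seed is a pair $\Sigma=(\mathbf{x},B)$ with $\mathbf{x}=(x_1,\dots,x_n)$ (the cluster) a free generating set of $\mathcal{F}$ and $B$ skew-symmetrizable (the exchange matrix). The mutation $\mu_k(\Sigma)=(\mathbf{x}',B')$ is given by $b'_{ij}=-b_{ij}$ if $i=k$ or $j=k$, $b'_{ij}=b_{ij}+b_{ik}[b_{kj}]_++[-b_{ik}]_+b_{kj}$ otherwise; $x'_i=x_i$ for $i\ne k$ and $x_k'=x_k^{-1}\big(\prod_j x_j^{[b_{jk}]_+}+\prod_j x_j^{[-b_{jk}]_+}\big)$. $\mathbb{T}_n$ is the $n$-regular tree with edges labeled by $1,\dots,n$, the $n$ edges at each vertex having distinct labels. A cluster pattern is a family $\mathbf{\Sigma}=\{\Sigma_t=(\mathbf{x}_t,B_t)\}_{t\in\mathbb{T}_n}$ of labeled seeds such that $\Sigma_{t'}=\mu_k(\Sigma_t)$ whenever $t,t'$ are joined by an edge labeled $k$; it is determined by the initial seed $\Sigma_{t_0}$ at a root vertex $t_0$. The cluster algebra $\mathcal{A}$ is the $\mathbb{Z}$-subalgebra of $\mathcal{F}$ generated by all cluster variables (entries of all $\mathbf{x}_t$). Diagram.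 $\Gamma(B)$ is the weighted directed graph on $\{1,\dots,n\}$ with an edge $i\to j$ iff $b_{ij}>0$, of weight $\sqrt{|b_{ij}b_{ji}|}$. It is mutation-cyclic if no matrix obtained from $B$ by a finite sequence of mutations has an acyclic diagram. (Up to relabeling vertices, every mutation-cyclic class of $3$-vertex diagrams contains one of the form $\Gamma_0$ in the statement, with minimal sum of weights.) Cluster automorphisms. $\sigma\in S_n$ acts on $n$-tuples by $(\sigma\mathbf{x})_i=x_{\sigma^{-1}(i)}$. A $\mathbb{Z}$-algebra automorphism $f:\mathcal{A}\to\mathcal{A}$ is a cluster automorphism if there exist labeled seeds $(\mathbf{x},B),(\mathbf{x}',B')$ in $\mathbf{\Sigma}$ and $\sigma\in S_n$ such that $\sigma f(\mathbf{x})=\mathbf{x}'$ and $\sigma f(\mu_k(\mathbf{x}))=\mu_{\sigma(k)}(\mathbf{x}')$ for all $k$ (where $\mu_k(\mathbf{x})$ is the cluster of $\mu_k(\mathbf{x},B)$, and similarly for $\mathbf{x}'$). $\operatorname{Aut}(\mathcal{A})$ is the group of all cluster automorphisms under composition. Groups. $D_\infty=\langle r,s\mid r^2=s^2=1\rangle$ is the infinite dihedral group. $N=\langle f_1,f_2,f_3\mid f_1^2=f_2^2=f_3^2=1\rangle$. $N\rtimes_\tau\mathbb{Z}_2$: the generator of $\mathbb{Z}_2$ acts on $N$ by fixing $f_1$ and exchanging $f_2$ and $f_3$. $N\rtimes_\varphi S_3$: $\sigma\in S_3$ acts on $N$ by $f_i\mapsto f_{\sigma(i)}$. *)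

theory Defs
  imports
    "HOL-Analysis.Analysis"
    "HOL-Algebra.Bij"
    "HOL-Algebra.Elementary_Groups"
    "HOL-Algebra.Sym_Groups"
begin

section \<open>Skew-symmetrizable matrices and their diagrams\<close>

definition pos_part :: "int \<Rightarrow> int" where
  "pos_part x = max x 0"

definition skew_symmetrizer :: "int ^ 'n \<Rightarrow> int ^ 'n ^ 'n \<Rightarrow> bool" where
  "skew_symmetrizer d B \<longleftrightarrow>
     (\<forall>i. d $ i > 0) \<and> (\<forall>i j. d $ i * B $ i $ j = - (d $ j * B $ j $ i))"

definition skew_symmetrizable :: "int ^ 'n ^ 'n \<Rightarrow> bool" where
  "skew_symmetrizable B \<longleftrightarrow> (\<exists>d. skew_symmetrizer d B)"

definition mutate_matrix :: "'n \<Rightarrow> int ^ 'n ^ 'n \<Rightarrow> int ^ 'n ^ 'n" where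
  "mutate_matrix k B = (\<chi> i j.
     if i = k \<or> j = k then - (B $ i $ j)
     else B $ i $ j + B $ i $ k * pos_part (B $ k $ j) + pos_part (- (B $ i $ k)) * B $ k $ j)"

text \<open>A weighted directed graph is the set of its triples (source, target, weight).\<close>

definition diagram :: "int ^ 'n ^ 'n \<Rightarrow> ('n \<times> 'n \<times> real) set" where
  "diagram B = {(i, j, w). B $ i $ j > 0 \<and> w = sqrt (real_of_int \<bar>B $ i $ j * B $ j $ i\<bar>)}"

definition acyclic_diagram :: "('n \<times> 'n \<times> real) set \<Rightarrow> bool" where
  "acyclic_diagram \<Gamma> \<longleftrightarrow> acyclic {(i, j). \<exists>w. (i, j, w) \<in> \<Gamma>}"

definition mutation_cyclic :: "int ^ 'n ^ 'n \<Rightarrow> bool" where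
  "mutation_cyclic B \<longleftrightarrow> (\<forall>ks. \<not> acyclic_diagram (diagram (foldr mutate_matrix ks B)))"


section \<open>Seeds and cluster patterns\<close>

text \<open>
  The ambient field is a type of class \<^class>\<open>field_char_0\<close>. The existence of a free generating
  tuple is what makes it a field of rational functions over the rationals: such a tuple is
  algebraically independent over the rationals and generates the field.
\<close>

definition algebraically_independent :: "('f::field_char_0) ^ 'n \<Rightarrow> bool" where
  "algebraically_independent x \<longleftrightarrow>
     (\<forall>(M :: ('n::finite \<Rightarrow> nat) set) (c :: ('n \<Rightarrow> nat) \<Rightarrow> rat).
        finite M \<and> (\<Sum>m\<in>M. of_rat (c m) * (\<Prod>i\<in>UNIV. x $ i ^ m i)) = 0 \<longrightarrow> (\<forall>m\<in>M. c m = 0))"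

definition is_subfield :: "('f::field) set \<Rightarrow> bool" where
  "is_subfield K \<longleftrightarrow> 1 \<in> K \<and>
     (\<forall>x\<in>K. \<forall>y\<in>K. x - y \<in> K \<and> x * y \<in> K) \<and> (\<forall>x\<in>K. inverse x \<in> K)"

definition free_generating :: "('f::field_char_0) ^ ('n::finite) \<Rightarrow> bool" where
  "free_generating x \<longleftrightarrow>
     algebraically_independent x \<and> is_subfield hull (range (\<lambda>i. x $ i)) = UNIV"

type_synonym ('f, 'n) seed = "('f ^ 'n) \<times> (int ^ 'n ^ 'n)"

definition labeled_seed :: "('f::field_char_0, 'n::finite) seed \<Rightarrow> bool" where
  "labeled_seed s \<longleftrightarrow> free_generating (fst s) \<and> skew_symmetrizable (snd s)"

definition mutate_cluster :: "'n \<Rightarrow> ('f::field, 'n::finite) seed \<Rightarrow> 'f ^ 'n" where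
  "mutate_cluster k s = (case s of (x, B) \<Rightarrow> \<chi> i.
     if i = k then inverse (x $ k) *
       ((\<Prod>j\<in>UNIV. x $ j ^ nat (pos_part (B $ j $ k))) +
        (\<Prod>j\<in>UNIV. x $ j ^ nat (pos_part (- (B $ j $ k)))))
     else x $ i)"

definition mutate_seed :: "'n \<Rightarrow> ('f::field, 'n::finite) seed \<Rightarrow> ('f, 'n) seed" where
  "mutate_seed k s = (mutate_cluster k s, mutate_matrix k (snd s))"

text \<open>
  The \<open>n\<close>-regular tree with edges labeled by \<open>'n\<close>: a vertex is the word of labels read along the
  path joining it to the base vertex \<open>[]\<close>, the last step coming first. Such words have no two
  equal adjacent letters.
\<close>

definition tree_vertices :: "'n list set" where
  "tree_vertices = {w. distinct_adj w}"

definition tree_edge :: "'n \<Rightarrow> 'n list \<Rightarrow> 'n list \<Rightarrow> bool" where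
  "tree_edge k t t' \<longleftrightarrow>
     t \<in> tree_vertices \<and> t' \<in> tree_vertices \<and> (t' = k # t \<or> t = k # t')"

definition cluster_pattern :: "('n list \<Rightarrow> ('f::field_char_0, 'n::finite) seed) \<Rightarrow> bool" where
  "cluster_pattern \<Sigma> \<longleftrightarrow>
     (\<forall>t\<in>tree_vertices. labeled_seed (\<Sigma> t)) \<and>
     (\<forall>k t t'. tree_edge k t t' \<longrightarrow> \<Sigma> t' = mutate_seed k (\<Sigma> t))"

definition pattern_seeds :: "('n list \<Rightarrow> ('f, 'n::finite) seed) \<Rightarrow> ('f, 'n) seed set" where
  "pattern_seeds \<Sigma> = \<Sigma> ` tree_vertices"

definition is_subring :: "('f::comm_ring_1) set \<Rightarrow> bool" where
  "is_subring R \<longleftrightarrow> 1 \<in> R \<and> (\<forall>x\<in>R. \<forall>y\<in>R. x - y \<in> R \<and> x * y \<in> R)"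

definition cluster_algebra :: "('n list \<Rightarrow> ('f::field, 'n::finite) seed) \<Rightarrow> 'f set" where
  "cluster_algebra \<Sigma> = is_subring hull (\<Union>s\<in>pattern_seeds \<Sigma>. range (\<lambda>i. fst s $ i))"


section \<open>Cluster automorphisms\<close>

definition permute_tuple :: "('n \<Rightarrow> 'n) \<Rightarrow> 'a ^ 'n \<Rightarrow> 'a ^ 'n" where
  "permute_tuple \<sigma> x = (\<chi> i. x $ (inv_into UNIV \<sigma> i))"

text \<open>
  Maps on a subring \<open>A\<close> are taken to be extensional, as in \<^const>\<open>Bij\<close>, so that each map on \<open>A\<close> has
  exactly one representative.
\<close>

definition subring_automorphism :: "('f::comm_ring_1) set \<Rightarrow> ('f \<Rightarrow> 'f) \<Rightarrow> bool" where
  "subring_automorphism A f \<longleftrightarrow> f \<in> Bij A \<and> f 1 = 1 \<and>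
     (\<forall>x\<in>A. \<forall>y\<in>A. f (x + y) = f x + f y \<and> f (x * y) = f x * f y)"

definition cluster_automorphism ::
  "('n list \<Rightarrow> ('f::field, 'n::finite) seed) \<Rightarrow> ('f \<Rightarrow> 'f) \<Rightarrow> bool" where
  "cluster_automorphism \<Sigma> f \<longleftrightarrow> subring_automorphism (cluster_algebra \<Sigma>) f \<and>
     (\<exists>s\<in>pattern_seeds \<Sigma>. \<exists>s'\<in>pattern_seeds \<Sigma>. \<exists>\<sigma>. bij \<sigma> \<and>
        permute_tuple \<sigma> (\<chi> i. f (fst s $ i)) = fst s' \<and>
        (\<forall>k. permute_tuple \<sigma> (\<chi> i. f (mutate_cluster k s $ i)) = mutate_cluster (\<sigma> k) s'))"

definition cluster_Aut :: "('n list \<Rightarrow> ('f::field, 'n::finite) seed) \<Rightarrow> ('f \<Rightarrow> 'f) monoid" where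
  "cluster_Aut \<Sigma> =
     BijGroup (cluster_algebra \<Sigma>) \<lparr>carrier := {f. cluster_automorphism \<Sigma> f}\<rparr>"


section \<open>Presented groups and semidirect products\<close>

text \<open>
  The letter \<open>(True, x)\<close> stands for the generator \<open>x\<close> and \<open>(False, x)\<close> for its inverse. The group
  presented by generators \<open>X\<close> and relators \<open>R\<close> consists of the words modulo the least congruence
  that cancels inverse letters and the words in \<open>R\<close>.
\<close>

type_synonym 'a group_word = "(bool \<times> 'a) list"

definition group_words :: "'a set \<Rightarrow> 'a group_word set" where
  "group_words X = lists (UNIV \<times> X)"

inductive_set word_congruence :: "'a set \<Rightarrow> 'a group_word set \<Rightarrow> ('a group_word \<times> 'a group_word) set"
  for X :: "'a set" and R :: "'a group_word set" where
  wc_refl: "w \<in> group_words X \<Longrightarrow> (w, w) \<in> word_congruence X R"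
| wc_sym: "(v, w) \<in> word_congruence X R \<Longrightarrow> (w, v) \<in> word_congruence X R"
| wc_trans: "\<lbrakk>(u, v) \<in> word_congruence X R; (v, w) \<in> word_congruence X R\<rbrakk>
    \<Longrightarrow> (u, w) \<in> word_congruence X R"
| wc_cancel: "\<lbrakk>u \<in> group_words X; v \<in> group_words X; x \<in> X\<rbrakk>
    \<Longrightarrow> (u @ [(e, x), (\<not> e, x)] @ v, u @ v) \<in> word_congruence X R"
| wc_relator: "\<lbrakk>u \<in> group_words X; v \<in> group_words X; r \<in> R\<rbrakk>
    \<Longrightarrow> (u @ r @ v, u @ v) \<in> word_congruence X R"

definition presented_group :: "'a set \<Rightarrow> 'a group_word set \<Rightarrow> 'a group_word set monoid" where
  "presented_group X R =
     \<lparr>carrier = group_words X // word_congruence X R,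
      mult = \<lambda>U V. \<Union>u\<in>U. \<Union>v\<in>V. word_congruence X R `` {u @ v},
      one = word_congruence X R `` {[]}\<rparr>"

definition involution_group :: "'a set \<Rightarrow> 'a group_word set monoid" where
  "involution_group X = presented_group X {[(True, x), (True, x)] | x. x \<in> X}"

text \<open>
  A permutation \<open>\<pi>\<close> of the generators that preserves the relators induces an automorphism of the
  presented group; on congruence classes it is the image under relabeling of letters.
\<close>

definition relabel_generators :: "('a \<Rightarrow> 'a) \<Rightarrow> 'a group_word set \<Rightarrow> 'a group_word set" where
  "relabel_generators \<pi> W = map (map_prod id \<pi>) ` W"

definition semidirect_product ::
  "('a, 'c) monoid_scheme \<Rightarrow> ('b, 'd) monoid_scheme \<Rightarrow> ('b \<Rightarrow> 'a \<Rightarrow> 'a) \<Rightarrow> ('a \<times> 'b) monoid" where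
  "semidirect_product G H \<phi> =
     \<lparr>carrier = carrier G \<times> carrier H,
      mult = \<lambda>(g, h) (g', h'). (g \<otimes>\<^bsub>G\<^esub> \<phi> h g', h \<otimes>\<^bsub>H\<^esub> h'),
      one = (\<one>\<^bsub>G\<^esub>, \<one>\<^bsub>H\<^esub>)\<rparr>"

definition D_infinity :: "nat group_word set monoid" where
  "D_infinity = involution_group {1, 2}"

definition N_group :: "nat group_word set monoid" where
  "N_group = involution_group {1, 2, 3}"

definition N_tau_Z2 :: "(nat group_word set \<times> int) monoid" where
  "N_tau_Z2 = semidirect_product N_group (integer_mod_group 2)
     (\<lambda>z. relabel_generators (if z = 0 then id else Transposition.transpose 2 3))"

definition N_phi_S3 :: "(nat group_word set \<times> (nat \<Rightarrow> nat)) monoid" where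
  "N_phi_S3 = semidirect_product N_group (sym_group 3) relabel_generators"

end

theory Submission
  imports Defs
begin

text \<open>
  Index the weights \<open>W\<close> of a 3-cycle by the vertex opposite to each edge. Mutation at \<open>k\<close> reverses the
  cycle and replaces \<open>W k\<close> by \<open>W i * W j - W k\<close>. Starting from the weights of the theorem, along a
  reduced word of mutations the last mutated weight is the largest and no weight ever decreases.
  Hence a seed has the initial weights up to a permutation only if every mutation on the way fixes
  the weights, that is, only uses labels \<open>k\<close> with \<open>W i * W j = 2 * W k\<close> (the stable labels).

  The exchange relations determine the exchange matrix up to sign, so a cluster automorphism is the
  same as a pair of a reduced word \<open>w\<close> in the stable labels and a permutation \<open>\<sigma>\<close> preserving the
  weights and the skew-symmetrizer: it sends the \<open>i\<close>-th initial variable to the \<open>\<sigma> i\<close>-th variable of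
  the seed at \<open>w\<close>. Different pairs give different automorphisms: if all initial variables are set to
  1, the values of the cluster variables grow strictly along reduced words. So the group is the
  free product of copies of the cyclic group of order 2, one for each stable label, extended by the
  group of these permutations.
\<close>


section \<open>Specialization of rational functions\<close>

text \<open>Conjugating \<open>B\<close> by the square root of the diagonal matrix \<open>D\<close>
  gives a skew-symmetric real matrix whose entries are the weights up to sign. This is where the
  factors \<open>sqrt (d $ i)\<close> come from, both in the matrices and in the growth estimate.
  The orientation drops out because the two off-diagonal entries in a column of a cyclic matrix have
  opposite signs: each exchange binomial is a sum of powers of two single variables, and reversing
  all arrows only swaps the summands. Conversely, the exponents \<open>|b_ij|\<close> give the
  weights through \<open>|b_ij b_ji|\<close>, and they give the ratios of the entries of
  \<open>d\<close>. These ratios suffice, since a permutation of the entries of \<open>d\<close>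
  that rescales them all must preserve them. The ambient field is abstract and has no evaluation
  map. Specialization is therefore a relation between elements of two fields. The same relation
  yields the field automorphism matching two free generating tuples, separates monomials, and gives
  the values at the all-ones point.\<close>

datatype 'n poly_expr =
    Const rat
  | Var 'n
  | Add "'n poly_expr" "'n poly_expr"
  | Mul "'n poly_expr" "'n poly_expr"

text \<open>Expressions are kept as syntax so that one polynomial can be evaluated at tuples over
  different fields, in particular over the abstract field and over the reals.\<close>

primrec eval_poly :: "('a::field_char_0) ^ ('n::finite) \<Rightarrow> 'n poly_expr \<Rightarrow> 'a" where
  "eval_poly x (Const c) = of_rat c"
| "eval_poly x (Var i) = x $ i"
| "eval_poly x (Add p q) = eval_poly x p + eval_poly x q"
| "eval_poly x (Mul p q) = eval_poly x p * eval_poly x q"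

primrec monomials :: "'n poly_expr \<Rightarrow> (rat \<times> ('n \<Rightarrow> nat)) list" where
  "monomials (Const c) = [(c, \<lambda>_. 0)]"
| "monomials (Var i) = [(1, \<lambda>j. if j = i then 1 else 0)]"
| "monomials (Add p q) = monomials p @ monomials q"
| "monomials (Mul p q) = concat (map (\<lambda>(c, m). map (\<lambda>(c', m'). (c * c', \<lambda>i. m i + m' i)) (monomials q)) (monomials p))"

definition eval_monomials :: "('a::field_char_0) ^ ('n::finite) \<Rightarrow> (rat \<times> ('n \<Rightarrow> nat)) list \<Rightarrow> 'a" where
  "eval_monomials x L = (\<Sum>(c, m)\<leftarrow>L. of_rat c * (\<Prod>i\<in>UNIV. x $ i ^ m i))"

lemma eval_monomials_simps [simp]:
  "eval_monomials x [] = 0"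
  "eval_monomials x ((c, m) # L) = of_rat c * (\<Prod>i\<in>UNIV. x $ i ^ m i) + eval_monomials x L"
  "eval_monomials x (L @ L') = eval_monomials x L + eval_monomials x L'"
  by (simp_all add: eval_monomials_def)

lemma eval_monomials_scale:
  "eval_monomials x (map (\<lambda>(c', m'). (c * c', \<lambda>i. m i + m' i)) L)
   = of_rat c * (\<Prod>i\<in>UNIV. x $ i ^ m i) * eval_monomials x L"
  by (induction L) (auto simp: of_rat_mult power_add prod.distrib algebra_simps)

lemma eval_monomials_product:
  "eval_monomials x (concat (map (\<lambda>(c, m). map (\<lambda>(c', m'). (c * c', \<lambda>i. m i + m' i)) L') L))
   = eval_monomials x L * eval_monomials x L'"
  by (induction L) (auto simp: eval_monomials_scale algebra_simps)

lemma eval_poly_monomials: "eval_poly x p = eval_monomials x (monomials p)"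
proof (induction p)
  case (Var i)
  have "(\<Prod>j\<in>UNIV. x $ j ^ (if j = i then 1 else 0)) = (\<Prod>j\<in>UNIV. if j = i then x $ j else 1)"
    by (intro prod.cong) auto
  then show ?case by simp
qed (simp_all add: eval_monomials_product)

text \<open>The list may repeat an exponent vector, so like terms are collected before algebraic
  independence, which speaks of a set of exponents, can be applied.\<close>

definition monomial_coeff :: "(rat \<times> ('n \<Rightarrow> nat)) list \<Rightarrow> ('n \<Rightarrow> nat) \<Rightarrow> rat" where
  "monomial_coeff L m = (\<Sum>(c, m')\<leftarrow>L. if m' = m then c else 0)"

lemma eval_monomials_coeff:
  assumes "finite M" "snd ` set L \<subseteq> M"
  shows "eval_monomials x L = (\<Sum>m\<in>M. of_rat (monomial_coeff L m) * (\<Prod>i\<in>UNIV. x $ i ^ m i))"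
  using assms(2)
proof (induction L)
  case Nil
  then show ?case by (simp add: monomial_coeff_def)
next
  case (Cons p L)
  obtain c m' where p: "p = (c, m')" by force
  let ?X = "\<lambda>m. \<Prod>i\<in>UNIV. x $ i ^ m i"
  have "m' \<in> M" using Cons p by simp
  have "(\<Sum>m\<in>M. of_rat (monomial_coeff (p # L) m) * ?X m)
     = (\<Sum>m\<in>M. (if m' = m then of_rat c * ?X m else 0) + of_rat (monomial_coeff L m) * ?X m)"
    by (intro sum.cong) (auto simp: p monomial_coeff_def of_rat_add algebra_simps)
  also have "\<dots> = of_rat c * ?X m' + (\<Sum>m\<in>M. of_rat (monomial_coeff L m) * ?X m)"
    using assms(1) \<open>m' \<in> M\<close> by (simp add: sum.distrib)
  finally show ?case using Cons p by simp
qed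

text \<open>Independence makes all collected coefficients of \<open>p\<close> zero, and then
  \<open>p\<close> vanishes at every tuple over every field of characteristic 0.\<close>

lemma algebraically_independent_eval_zero:
  assumes "algebraically_independent x" "eval_poly x p = 0"
  shows "eval_poly y p = 0"
proof -
  let ?L = "monomials p" let ?M = "snd ` set (monomials p)"
  have eq: "\<And>z. eval_poly z p = (\<Sum>m\<in>?M. of_rat (monomial_coeff ?L m) * (\<Prod>i\<in>UNIV. z $ i ^ m i))"
    unfolding eval_poly_monomials by (intro eval_monomials_coeff) auto
  have "\<forall>m\<in>?M. monomial_coeff ?L m = 0"
    using assms unfolding algebraically_independent_def eq by blast
  then show ?thesis unfolding eq by (intro sum.neutral) simp
qed

text \<open>The rational function expressing \<open>u\<close> in terms of \<open>x\<close> takes the value \<open>v\<close> at \<open>y\<close>.\<close>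

definition specializes ::
  "('a::field_char_0) ^ ('n::finite) \<Rightarrow> ('b::field_char_0) ^ 'n \<Rightarrow> 'a \<Rightarrow> 'b \<Rightarrow> bool" where
  "specializes x y u v \<longleftrightarrow> (\<exists>p q. eval_poly x q \<noteq> 0 \<and> eval_poly y q \<noteq> 0 \<and>
     u = eval_poly x p / eval_poly x q \<and> v = eval_poly y p / eval_poly y q)"

section \<open>Arithmetic of specialization\<close>

lemma specializes_swap: "specializes x y u v \<longleftrightarrow> specializes y x v u"
  unfolding specializes_def by blast

lemma specializes_poly: "specializes x y (eval_poly x p) (eval_poly y p)"
  unfolding specializes_def by (intro exI[of _ p] exI[of _ "Const 1"]) auto

lemma specializes_var: "specializes x y (x $ i) (y $ i)"
  using specializes_poly[of x y "Var i"] by simp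

lemma specializes_one: "specializes x y 1 1"
  using specializes_poly[of x y "Const 1"] by simp

lemma specializes_zero: "specializes x y 0 0"
  using specializes_poly[of x y "Const 0"] by simp

lemma specializes_mult:
  assumes "specializes x y u v" "specializes x y u' v'"
  shows "specializes x y (u * u') (v * v')"
proof -
  from assms obtain p q p' q' where *: "eval_poly x q \<noteq> 0" "eval_poly y q \<noteq> 0"
    "u = eval_poly x p / eval_poly x q" "v = eval_poly y p / eval_poly y q"
    "eval_poly x q' \<noteq> 0" "eval_poly y q' \<noteq> 0"
    "u' = eval_poly x p' / eval_poly x q'" "v' = eval_poly y p' / eval_poly y q'"
    unfolding specializes_def by blast
  show ?thesis unfolding specializes_def
    by (rule exI[of _ "Mul p p'"], rule exI[of _ "Mul q q'"]) (use * in simp)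
qed

lemma specializes_add:
  assumes "specializes x y u v" "specializes x y u' v'"
  shows "specializes x y (u + u') (v + v')"
proof -
  from assms obtain p q p' q' where *: "eval_poly x q \<noteq> 0" "eval_poly y q \<noteq> 0"
    "u = eval_poly x p / eval_poly x q" "v = eval_poly y p / eval_poly y q"
    "eval_poly x q' \<noteq> 0" "eval_poly y q' \<noteq> 0"
    "u' = eval_poly x p' / eval_poly x q'" "v' = eval_poly y p' / eval_poly y q'"
    unfolding specializes_def by blast
  show ?thesis unfolding specializes_def
    by (rule exI[of _ "Add (Mul p q') (Mul p' q)"], rule exI[of _ "Mul q q'"])
      (use * in \<open>simp add: add_frac_eq\<close>)
qed

lemma specializes_minus: "specializes x y u v \<Longrightarrow> specializes x y (- u) (- v)"
  using specializes_mult[OF specializes_poly[of x y "Const (-1)"]] by (simp add: of_rat_minus)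

lemma specializes_diff:
  "specializes x y u v \<Longrightarrow> specializes x y u' v' \<Longrightarrow> specializes x y (u - u') (v - v')"
  using specializes_add[OF _ specializes_minus] by (simp only: diff_conv_add_uminus)

lemma specializes_power: "specializes x y u v \<Longrightarrow> specializes x y (u ^ n) (v ^ n)"
  by (induction n) (auto intro: specializes_mult specializes_one)

lemma specializes_prod:
  "(\<And>i. i \<in> I \<Longrightarrow> specializes x y (u i) (v i)) \<Longrightarrow> specializes x y (prod u I) (prod v I)"
  by (induction I rule: infinite_finite_induct) (auto intro: specializes_mult specializes_one)

text \<open>Cross-multiplying two representations of \<open>u\<close> gives the polynomial
  \<open>p q' - p' q\<close>, which vanishes at \<open>x\<close> and hence at
  \<open>y\<close>.\<close>

lemma specializes_unique:
  assumes x: "algebraically_independent x" and "specializes x y u v" "specializes x y u v'"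
  shows "v = v'"
proof -
  from assms obtain p q p' q' where *: "eval_poly x q \<noteq> 0" "eval_poly y q \<noteq> 0"
    "u = eval_poly x p / eval_poly x q" "v = eval_poly y p / eval_poly y q"
    "eval_poly x q' \<noteq> 0" "eval_poly y q' \<noteq> 0"
    "u = eval_poly x p' / eval_poly x q'" "v' = eval_poly y p' / eval_poly y q'"
    unfolding specializes_def by blast
  let ?r = "Add (Mul p q') (Mul (Const (-1)) (Mul p' q))"
  have "eval_poly x ?r = 0" using * by (simp add: frac_eq_eq of_rat_minus)
  then have "eval_poly y ?r = 0" by (rule algebraically_independent_eval_zero[OF x])
  then show ?thesis using * by (simp add: frac_eq_eq of_rat_minus)
qed

text \<open>A numerator that is nonzero at \<open>y\<close> is nonzero at \<open>x\<close>, so the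
  fraction can be inverted on both sides.\<close>

lemma specializes_inverse:
  assumes x: "algebraically_independent x" and "specializes x y u v" "v \<noteq> 0"
  shows "specializes x y (inverse u) (inverse v)"
proof -
  from assms obtain p q where *: "eval_poly x q \<noteq> 0" "eval_poly y q \<noteq> 0"
    "u = eval_poly x p / eval_poly x q" "v = eval_poly y p / eval_poly y q"
    unfolding specializes_def by blast
  then have "eval_poly y p \<noteq> 0" using assms(3) by auto
  then have "eval_poly x p \<noteq> 0" using algebraically_independent_eval_zero[OF x] by blast
  show ?thesis unfolding specializes_def
    by (rule exI[of _ q], rule exI[of _ p])
      (use * \<open>eval_poly y p \<noteq> 0\<close> \<open>eval_poly x p \<noteq> 0\<close> in simp)
qed

text \<open>The specializable elements form a subfield containing the generators. Closure under
  inverses is the delicate point: independence of \<open>y\<close> guarantees that only 0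
  specializes to 0.\<close>

lemma specializes_total:
  assumes x: "free_generating x" and y: "algebraically_independent y"
  shows "\<exists>v. specializes x y u v"
proof -
  let ?K = "{u. \<exists>v. specializes x y u v}"
  have xi: "algebraically_independent x" using x free_generating_def by blast
  have inv: "\<exists>w. specializes x y (inverse u) w" if "specializes x y u v" for u v
  proof (cases "v = 0")
    case True
    then have "specializes y x 0 u" "specializes y x 0 0"
      using that specializes_zero by (auto simp: specializes_swap[of y x])
    then have "u = 0" by (rule specializes_unique[OF y])
    then show ?thesis using specializes_zero by auto
  qed (use that specializes_inverse[OF xi] in blast)
  have "is_subfield ?K" unfolding is_subfield_def
    using specializes_one[of x y] specializes_diff specializes_mult inv by blast
  moreover have "range (\<lambda>i. x $ i) \<subseteq> ?K" using specializes_var by blast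
  ultimately have "is_subfield hull (range (\<lambda>i. x $ i)) \<subseteq> ?K" by (rule hull_minimal[rotated])
  then show ?thesis using x unfolding free_generating_def by auto
qed

text \<open>Specialization from \<open>x\<close> to \<open>y\<close> is total and single-valued.
  Exchanging \<open>x\<close> and \<open>y\<close> gives the converse relation, which has the same
  properties, so the relation is the graph of a bijection.\<close>

lemma free_generating_automorphism:
  fixes x y :: "('f::field_char_0) ^ ('n::finite)"
  assumes x: "free_generating x" and y: "free_generating y"
  obtains \<phi> :: "'f \<Rightarrow> 'f" where "bij \<phi>" "\<phi> 1 = 1" "\<And>u v. \<phi> (u + v) = \<phi> u + \<phi> v"
    "\<And>u v. \<phi> (u * v) = \<phi> u * \<phi> v" "\<And>i. \<phi> (x $ i) = y $ i"
proof -
  have xi: "algebraically_independent x" and yi: "algebraically_independent y"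
    using x y free_generating_def by blast+
  define \<phi> where "\<phi> u = (THE v. specializes x y u v)" for u
  have \<phi>I: "\<phi> u = v" if "specializes x y u v" for u v
    unfolding \<phi>_def using that specializes_unique[OF xi] by blast
  have \<phi>: "specializes x y u (\<phi> u)" for u
    using specializes_total[OF x yi] \<phi>I by metis
  show ?thesis
  proof
    show "bij \<phi>"
    proof (rule bijI)
      show "inj \<phi>"
      proof (rule injI)
        fix u v assume "\<phi> u = \<phi> v"
        then have "specializes y x (\<phi> u) u" "specializes y x (\<phi> u) v"
          using \<phi>[of u] \<phi>[of v] by (simp_all add: specializes_swap[of y x])
        then show "u = v" by (rule specializes_unique[OF yi])
      qed
      show "surj \<phi>"
      proof (rule surjI)
        show "\<phi> (SOME u. specializes x y u v) = v" for v
        proof (rule \<phi>I, rule someI_ex)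
          show "\<exists>u. specializes x y u v"
            using specializes_total[OF y xi, of v] by (subst specializes_swap)
        qed
      qed
    qed
    show "\<phi> 1 = 1" using \<phi>I specializes_one by blast
    show "\<phi> (u + v) = \<phi> u + \<phi> v" for u v using \<phi>I specializes_add \<phi> by blast
    show "\<phi> (u * v) = \<phi> u * \<phi> v" for u v using \<phi>I specializes_mult \<phi> by blast
    show "\<phi> (x $ i) = y $ i" for i using \<phi>I specializes_var by blast
  qed
qed

lemma algebraically_independent_inj:
  fixes x :: "('f::field_char_0) ^ ('n::finite)"
  assumes "algebraically_independent x" "x $ i = x $ j"
  shows "i = j"
proof (rule ccontr)
  assume ij: "i \<noteq> j"
  \<comment> \<open>At this point the two coordinates take the values 1 and 0, so they cannot be
    equal.\<close>
  define y :: "real ^ 'n" where "y = (\<chi> k. if k = i then 1 else 0)"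
  have "specializes x y (x $ i) 1" and "specializes x y (x $ j) 0"
    using specializes_var[of x y i] specializes_var[of x y j] ij by (simp_all add: y_def)
  then show False using specializes_unique assms by fastforce
qed

text \<open>Permuting the generators changes exponent vectors by composition with the inverse of
  \<sigma>, an injective operation, so a relation for the permuted tuple is a relation for
  \<open>x\<close> with the same coefficients.\<close>

lemma free_generating_permute:
  fixes x :: "('f::field_char_0) ^ ('n::finite)" and \<sigma> :: "'n \<Rightarrow> 'n"
  assumes "free_generating x" "bij \<sigma>"
  shows "free_generating (\<chi> i. x $ \<sigma> i)"
proof -
  have "range (\<lambda>i. (\<chi> i. x $ \<sigma> i) $ i) = ($) x ` range \<sigma>"
    by auto
  then have "range (\<lambda>i. (\<chi> i. x $ \<sigma> i) $ i) = range (\<lambda>i. x $ i)"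
    using assms(2) by (simp add: bij_is_surj)
  moreover have "algebraically_independent (\<chi> i. x $ \<sigma> i)"
    unfolding algebraically_independent_def
  proof (intro allI impI)
    fix M :: "('n \<Rightarrow> nat) set" and c :: "('n \<Rightarrow> nat) \<Rightarrow> rat"
    assume *: "finite M \<and> (\<Sum>m\<in>M. of_rat (c m) * (\<Prod>i\<in>UNIV. (\<chi> i. x $ \<sigma> i) $ i ^ m i)) = 0"
    let ?h = "\<lambda>m :: 'n \<Rightarrow> nat. m \<circ> inv_into UNIV \<sigma>"
    have inv: "(m \<circ> inv_into UNIV \<sigma>) \<circ> \<sigma> = m" for m :: "'n \<Rightarrow> nat" using assms(2)
      by (simp add: comp_assoc bij_is_inj)
    have inj: "inj_on ?h M" 
    proof (rule inj_onI)
      fix m m' :: "'n \<Rightarrow> nat" assume "?h m = ?h m'"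
      then have "?h m \<circ> \<sigma> = ?h m' \<circ> \<sigma>" by simp
      then show "m = m'" unfolding inv .
    qed
    have r: "(\<Prod>i\<in>UNIV. x $ i ^ ?h m i) = (\<Prod>i\<in>UNIV. (\<chi> i. x $ \<sigma> i) $ i ^ m i)" for m
      using prod.reindex_bij_betw[OF assms(2), of "\<lambda>i. x $ i ^ ?h m i"]
      by (simp only: o_apply inv_f_f[OF bij_is_inj[OF assms(2)]] vec_lambda_beta)
    have "(\<Sum>m\<in>?h ` M. of_rat (c (m \<circ> \<sigma>)) * (\<Prod>i\<in>UNIV. x $ i ^ m i))
        = (\<Sum>m\<in>M. of_rat (c (?h m \<circ> \<sigma>)) * (\<Prod>i\<in>UNIV. x $ i ^ ?h m i))"
      by (rule sum.reindex[OF inj, unfolded comp_def[of _ ?h]])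
    then have "(\<Sum>m\<in>?h ` M. of_rat (c (m \<circ> \<sigma>)) * (\<Prod>i\<in>UNIV. x $ i ^ m i)) = 0"
      using * unfolding inv r by simp
    moreover have "algebraically_independent x" "finite (?h ` M)"
      using assms(1) * by (auto simp: free_generating_def)
    ultimately have "\<forall>m\<in>?h ` M. c (m \<circ> \<sigma>) = 0"
      unfolding algebraically_independent_def
      by (elim allE[of _ "?h ` M"] allE[of _ "\<lambda>m. c (m \<circ> \<sigma>)"]) (rule mp, assumption, rule conjI)
    then show "\<forall>m\<in>M. c m = 0" unfolding ball_simps inv by simp
  qed
  ultimately show ?thesis using assms(1) by (simp add: free_generating_def)
qed


section \<open>Cyclic diagrams on three vertices\<close>

definition orient :: "3 \<Rightarrow> 3 \<Rightarrow> real" where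
  "orient i j = (if (i, j) \<in> {(2, 1), (1, 3), (3, 2)} then 1
     else if (j, i) \<in> {(2, 1), (1, 3), (3, 2)} then -1 else 0)"

definition third :: "3 \<Rightarrow> 3 \<Rightarrow> 3" where
  "third i j = (if {i, j} = {1, 2} then 3 else if {i, j} = {1, 3} then 2 else 1)"

text \<open>
  The weight of the edge between \<open>i\<close> and \<open>j\<close> is indexed by the vertex opposite to it, and \<open>e\<close> is
  the sign of the orientation. The weights and the skew-symmetrizer determine the entries.
\<close>

definition cyclic_matrix :: "int ^ 3 \<Rightarrow> real \<Rightarrow> (3 \<Rightarrow> real) \<Rightarrow> int ^ 3 ^ 3 \<Rightarrow> bool" where
  "cyclic_matrix d e W M \<longleftrightarrow> (e = 1 \<or> e = -1) \<and> (\<forall>k. W k > 0) \<and>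
     (\<forall>i j. of_int (M $ i $ j) =
        e * orient i j * W (third i j) * sqrt (of_int (d $ j)) / sqrt (of_int (d $ i)))"

definition mutate_weights :: "3 \<Rightarrow> (3 \<Rightarrow> real) \<Rightarrow> 3 \<Rightarrow> real" where
  "mutate_weights k W = W(k := (\<Prod>i\<in>UNIV - {k}. W i) - W k)"

lemma orient_props:
  assumes "i \<noteq> j"
  shows "orient i j = 1 \<or> orient i j = -1" "orient j i = - orient i j"
    "third i j \<noteq> i" "third i j \<noteq> j" "third j i = third i j"
  using assms exhaust_3[of i] exhaust_3[of j] by (auto simp: orient_def third_def doubleton_eq_iff)

lemma orient_refl [simp]: "orient i i = 0"
  using exhaust_3[of i] by (auto simp: orient_def)

lemma third_eq:
  assumes "i \<noteq> j" "i \<noteq> k" "j \<noteq> k"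
  shows "third i j = k"
  using assms exhaust_3[of i] exhaust_3[of j] exhaust_3[of k]
  by (auto simp: third_def doubleton_eq_iff)

text \<open>On a 3-cycle, an arrow from \<open>i\<close> to \<open>j\<close> forces arrows from
  \<open>j\<close> to \<open>k\<close> and from \<open>k\<close> to \<open>i\<close>.\<close>

lemma orient_path:
  assumes "i \<noteq> j" "i \<noteq> k" "j \<noteq> k"
  shows "orient i k = - orient i j" "orient k j = - orient i j"
  using assms exhaust_3[of i] exhaust_3[of j] exhaust_3[of k]
  by (auto simp: orient_def)

lemma UNIV_3_diff:
  fixes i j k :: 3
  assumes "i \<noteq> j" "i \<noteq> k" "j \<noteq> k"
  shows "UNIV - {k} = {i, j}"
  using assms exhaust_3[of i] exhaust_3[of j] exhaust_3[of k]
  by (auto simp: UNIV_3)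

lemma obtain_other_two:
  fixes k :: 3
  obtains i j where "i \<noteq> j" "i \<noteq> k" "j \<noteq> k"
  using exhaust_3[of k] that[of 1 2] that[of 1 3] that[of 2 3] by force

lemma mutate_weights_eq:
  assumes "i \<noteq> j" "i \<noteq> k" "j \<noteq> k"
  shows "mutate_weights k W = W(k := W i * W j - W k)"
  using assms by (simp add: mutate_weights_def UNIV_3_diff[OF assms])

lemma of_int_pos_part: "real_of_int (pos_part x) = max (real_of_int x) 0"
  by (simp add: pos_part_def)

text \<open>For distinct \<open>i\<close>, \<open>j\<close> other than \<open>k\<close>, the arrows
  through \<open>k\<close> form a directed path between them, so the correction term carries the
  weight \<open>W i * W j\<close> and the sign opposite to the old entry. The hypothesis
  \<open>pos\<close> says that the correction wins: the cycle is reversed instead of being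
  opened.\<close>

lemma mutate_cyclic_matrix:
  assumes d: "\<And>i. d $ i > 0" and M: "cyclic_matrix d e W M" and pos: "mutate_weights k W k > 0"
  shows "cyclic_matrix d (- e) (mutate_weights k W) (mutate_matrix k M)"
proof -
  let ?r = "\<lambda>i. sqrt (real_of_int (d $ i))"
  have r: "?r i > 0" for i using d by simp
  have e: "e = 1 \<or> e = -1" and W: "\<And>k. W k > 0"
    and M: "\<And>i j. real_of_int (M $ i $ j) = e * orient i j * W (third i j) * ?r j / ?r i"
    using M unfolding cyclic_matrix_def by auto
  have entry: "real_of_int (mutate_matrix k M $ i $ j)
     = - e * orient i j * mutate_weights k W (third i j) * ?r j / ?r i" for i j
  proof (cases "i = k \<or> j = k")
    case True
    \<comment> \<open>\<open>third i j\<close> differs from both ends, so the weight of an edge at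
      \<open>k\<close> is untouched; diagonal entries are 0.\<close>
    then have "mutate_weights k W (third i j) = W (third i j) \<or> i = j"
      using orient_props(3,4)[of i j] by (auto simp: mutate_weights_def)
    then show ?thesis using True M by (auto simp: mutate_matrix_def)
  next
    case False
    let ?s = "e * orient i k"
    have new: "real_of_int (mutate_matrix k M $ i $ j) = real_of_int (M $ i $ j)
      + real_of_int (M $ i $ k) * max (real_of_int (M $ k $ j)) 0
      + max (- real_of_int (M $ i $ k)) 0 * real_of_int (M $ k $ j)"
      using False by (simp add: mutate_matrix_def of_int_pos_part)
    have ik: "real_of_int (M $ i $ k) = ?s * (W (third i k) * ?r k / ?r i)"
      by (simp add: M)
    have s: "?s = 1 \<or> ?s = -1" using e orient_props(1)[of i k] False by auto
    have x: "W (third i k) * ?r k / ?r i > 0" (is "?x > 0") using r W by simp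
    have y: "W (third k j) * ?r j / ?r k > 0" (is "?y > 0") using r W by simp
    show ?thesis
    proof (cases "i = j")
      case True
      \<comment> \<open>The entries at \<open>(i, k)\<close> and \<open>(k, i)\<close> have opposite
        signs, so the two correction terms either both vanish or cancel.\<close>
      have "real_of_int (M $ k $ i) = - ?s * (W (third k j) * ?r j / ?r k)"
        using orient_props(2)[of i k] False True by (simp add: M)
      then show ?thesis unfolding new ik using True s x y
        by (auto simp: M max_def)
    next
      case ij: False
      have kj: "real_of_int (M $ k $ j) = ?s * ?y"
        using orient_path[of i j k] ij False by (simp add: M)
      have "real_of_int (mutate_matrix k M $ i $ j) = real_of_int (M $ i $ j) + ?s * (?x * ?y)"
        unfolding new ik kj using s x y by (auto simp: max_def mult_less_0_iff zero_less_mult_iff)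
      also have "?x * ?y = W (third i k) * W (third k j) * (?r j / ?r i)"
        using r[of k] by simp
      also have "third i k = j" using ij False by (intro third_eq) auto
      also have "third k j = i" using ij False by (intro third_eq) auto
      also have "real_of_int (M $ i $ j) = - ?s * W k * (?r j / ?r i)"
        using orient_path[of i j k] third_eq[of i j k] ij False by (simp add: M)
      finally show ?thesis
        using orient_path[of i j k] third_eq[of i j k] ij False
        by (simp add: mutate_weights_eq[of i j k] algebra_simps diff_divide_distrib)
    qed
  qed
  show ?thesis unfolding cyclic_matrix_def
    using e entry W pos by (auto simp: mutate_weights_def)
qed

text \<open>For an edge from \<open>i\<close> to \<open>j\<close> the symmetrizer gives
  \<open>b_ji = - b_ij d_i / d_j\<close>, so the weight is \<open>b_ij sqrt (d_i / d_j)\<close>;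
  solving for the entries gives the form required by \<open>cyclic_matrix\<close>.\<close>

lemma cyclic_matrix_of_diagram:
  assumes d: "skew_symmetrizer d B" and dia: "diagram B = {(2, 1, b), (1, 3, c), (3, 2, a)}"
  shows "cyclic_matrix d 1 (\<lambda>k. if k = 1 then a else if k = 2 then c else b) B"
proof -
  let ?r = "\<lambda>i. sqrt (real_of_int (d $ i))"
  let ?W = "\<lambda>k::3. if k = 1 then a else if k = 2 then c else b"
  have d0: "d $ i > 0" and ds: "d $ i * B $ i $ j = - (d $ j * B $ j $ i)" for i j
    using d unfolding skew_symmetrizer_def by blast+
  have edge: "B $ i $ j > 0" "w = sqrt (real_of_int \<bar>B $ i $ j * B $ j $ i\<bar>)"
    if "(i, j, w) \<in> {(2, 1, b), (1, 3, c), (3, 2, a)}" for i j w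
    using that unfolding dia[symmetric] diagram_def by auto
  have pos: "real_of_int (B $ i $ j) = w * ?r j / ?r i" "real_of_int (B $ j $ i) = - (w * ?r i / ?r j)"
    "w > 0" if "(i, j, w) \<in> {(2, 1, b), (1, 3, c), (3, 2, a)}" for i j w
  proof -
    have dr: "real_of_int (d $ i) > 0" "real_of_int (d $ j) > 0" using d0 by simp_all
    let ?p = "real_of_int (B $ i $ j)" and ?q = "real_of_int (B $ j $ i)"
    have p: "?p > 0" using edge(1)[OF that] by simp
    have "real_of_int (d $ i * B $ i $ j) = real_of_int (- (d $ j * B $ j $ i))" using ds by metis
    then have q: "?q = - (?p * d $ i / d $ j)" using dr by (simp add: field_simps)
    have "w = sqrt (?p\<^sup>2 * (d $ i / d $ j))"
      using edge(2)[OF that] p dr by (simp add: q abs_mult power2_eq_square)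
    also have "\<dots> = ?p * (?r i / ?r j)" using p by (simp add: real_sqrt_mult real_sqrt_divide)
    finally have w: "w = ?p * (?r i / ?r j)" .
    show "?p = w * ?r j / ?r i" using dr w by simp
    have "?q = - (?p * (?r i * ?r i) / (?r j * ?r j))" using q dr by simp
    also have "\<dots> = - (?p * (?r i / ?r j) * ?r i / ?r j)" by (simp only: times_divide_eq_right times_divide_eq_left mult.assoc divide_divide_eq_left)
    finally show "?q = - (w * ?r i / ?r j)" unfolding w .
    show "w > 0" using w p dr by simp
  qed
  have diag: "B $ i $ i = 0" for i
  proof -
    have "d $ i * B $ i $ i = 0" using ds[of i i] by linarith
    then show ?thesis using d0[of i] by simp
  qed
  show ?thesis unfolding cyclic_matrix_def
    using pos[of 2 1 b] pos[of 1 3 c] pos[of 3 2 a]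
    by (auto simp: forall_3 orient_def third_def diag doubleton_eq_iff)
qed

section \<open>Weights and symmetrizer read off from absolute values\<close>

lemma cyclic_matrix_abs:
  assumes d: "\<And>i. d $ i > 0" and M: "cyclic_matrix d e W M" and "i \<noteq> j"
  shows "\<bar>real_of_int (M $ i $ j)\<bar> = W (third i j) * sqrt (of_int (d $ j)) / sqrt (of_int (d $ i))"
proof -
  have "d $ i > 0" "d $ j > 0" using d by auto
  moreover have "\<bar>e\<bar> = 1" "\<bar>orient i j\<bar> = 1" "W (third i j) > 0"
    using M orient_props(1)[OF \<open>i \<noteq> j\<close>] unfolding cyclic_matrix_def by auto
  ultimately show ?thesis using M unfolding cyclic_matrix_def
    by (simp only: abs_mult abs_divide) (simp add: abs_of_pos)
qed

lemma cyclic_matrix_abs_mult: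
  assumes d: "\<And>i. d $ i > 0" and M: "cyclic_matrix d e W M" and "i \<noteq> j"
  shows "\<bar>real_of_int (M $ i $ j)\<bar> * \<bar>real_of_int (M $ j $ i)\<bar> = (W (third i j))\<^sup>2"
proof -
  have "d $ i > 0" "d $ j > 0" using d by auto
  then show ?thesis
    using cyclic_matrix_abs[OF d M, of i j] cyclic_matrix_abs[OF d M, of j i] assms(3)
      orient_props(5)[of i j]
    by (simp add: power2_eq_square)
qed

lemma cyclic_matrix_symmetrizer:
  assumes d: "\<And>i. d $ i > 0" and M: "cyclic_matrix d e W M" and "i \<noteq> j"
  shows "d $ i * \<bar>M $ i $ j\<bar> = d $ j * \<bar>M $ j $ i\<bar>"
proof -
  have dp: "real_of_int (d $ i) > 0" "real_of_int (d $ j) > 0" using d by auto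
  have "real_of_int (d $ i) * \<bar>real_of_int (M $ i $ j)\<bar>
     = (sqrt (d $ i) * sqrt (d $ i)) * \<bar>real_of_int (M $ i $ j)\<bar>" using dp by simp
  also have "\<dots> = (sqrt (d $ j) * sqrt (d $ j)) * \<bar>real_of_int (M $ j $ i)\<bar>"
    using cyclic_matrix_abs[OF d M, of i j] cyclic_matrix_abs[OF d M, of j i] assms(3)
      orient_props(5)[of i j] dp
    by (simp del: real_sqrt_mult_self )
  also have "\<dots> = real_of_int (d $ j) * \<bar>real_of_int (M $ j $ i)\<bar>" using dp by simp
  finally show ?thesis
    by (metis (mono_tags, lifting) of_int_abs of_int_eq_iff of_int_mult)
qed

lemma cyclic_matrix_nonzero:
  assumes "\<And>i. d $ i > 0" "cyclic_matrix d e W M" "i \<noteq> j"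
  shows "M $ i $ j \<noteq> 0"
proof -
  have "W (third i j) > 0" using assms(2) by (auto simp: cyclic_matrix_def)
  then show ?thesis using cyclic_matrix_abs_mult[OF assms] by auto
qed

lemma cyclic_matrix_sign:
  assumes "\<And>i. d $ i > 0" "cyclic_matrix d e W M"
  shows "M $ i $ j > 0 \<longleftrightarrow> e * orient i j > 0"
proof -
  have "d $ i > 0" "d $ j > 0" "W (third i j) > 0"
    using assms by (auto simp: cyclic_matrix_def)
  then have *: "W (third i j) * sqrt (of_int (d $ j)) / sqrt (of_int (d $ i)) > 0" (is "?x > 0") by simp
  have "real_of_int (M $ i $ j) = e * orient i j * ?x" using assms(2) by (simp add: cyclic_matrix_def)
  then have "real_of_int (M $ i $ j) > 0 \<longleftrightarrow> e * orient i j > 0"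
    using * by (simp only: zero_less_mult_iff) auto
  then show ?thesis by simp
qed

lemma cyclic_matrix_not_acyclic:
  assumes "\<And>i. d $ i > 0" "cyclic_matrix d e W M"
  shows "\<not> acyclic_diagram (diagram M)"
proof
  assume "acyclic_diagram (diagram M)"
  then have ac: "acyclic {(i, j). \<exists>w. (i, j, w) \<in> diagram M}" (is "acyclic ?E")
    by (simp add: acyclic_diagram_def)
  have E: "(i, j) \<in> ?E" if "e * orient i j > 0" for i j
    using that cyclic_matrix_sign[OF assms] by (auto simp: diagram_def)
  have "e = 1 \<or> e = -1" using assms(2) by (simp add: cyclic_matrix_def)
  then have "(1, 1) \<in> ?E\<^sup>+"
  proof
    assume "e = 1"
    then have "(1, 3) \<in> ?E" "(3, 2) \<in> ?E" "(2, 1) \<in> ?E" by (intro E; simp add: orient_def)+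
    then show ?thesis by (meson trancl.simps)
  next
    assume "e = -1"
    then have "(1, 2) \<in> ?E" "(2, 3) \<in> ?E" "(3, 1) \<in> ?E" by (intro E; simp add: orient_def)+
    then show ?thesis by (meson trancl.simps)
  qed
  then show False using ac by (auto simp: acyclic_def)
qed

section \<open>Growth of the weights\<close>

definition dominant :: "3 \<Rightarrow> (3 \<Rightarrow> real) \<Rightarrow> bool" where
  "dominant k W \<longleftrightarrow> (\<forall>i. 2 \<le> W i \<and> W i \<le> W k)"

text \<open>The second inequality says that mutation at \<open>i\<close> does not decrease
  \<open>W i\<close>: such a triple is a local minimum, the root from which growth is
  measured.\<close>

definition minimal_weights :: "(3 \<Rightarrow> real) \<Rightarrow> bool" where
  "minimal_weights W \<longleftrightarrow> (\<forall>i. 2 \<le> W i \<and> 2 * W i \<le> (\<Prod>j\<in>UNIV - {i}. W j))"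

text \<open>With \<open>W k\<close> maximal and \<open>W j\<close> at least 2, the new weight
  \<open>W j * W k - W i\<close> is at least \<open>2 * W k - W k\<close>, the old maximum.\<close>

lemma dominant_mutate_weights:
  assumes "dominant k W" "i \<noteq> k"
  shows "dominant i (mutate_weights i W)" "W i \<le> mutate_weights i W i"
proof -
  obtain j where j: "j \<noteq> i" "j \<noteq> k" using obtain_other_two[of i] by metis
  have W: "2 \<le> W l" "W l \<le> W k" for l using assms by (auto simp: dominant_def)
  have "2 * W k \<le> W j * W k" using W[of j] W[of k] by (intro mult_right_mono) auto
  then have *: "W k \<le> W j * W k - W i" using W[of i] by linarith
  have l: "l = i \<or> l = j \<or> l = k" for l :: 3
    using UNIV_3_diff[of j k i] j assms(2) by auto
  show "dominant i (mutate_weights i W)"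
    unfolding dominant_def mutate_weights_eq[OF j(2) j(1) assms(2)[symmetric]]
    using * W[of j] W[of k] W by (smt (verit) fun_upd_apply)
  show "W i \<le> mutate_weights i W i"
    unfolding mutate_weights_eq[OF j(2) j(1) assms(2)[symmetric]] using * W[of i] by simp
qed

text \<open>The first mutation has no previous maximum to rely on. Instead \<open>W j * W k\<close>
  is at least \<open>2 * W i\<close> and at least \<open>2 * W k\<close>, hence at least their mean
  \<open>W i + W k\<close>.\<close>

lemma minimal_mutate_weights:
  assumes "minimal_weights W"
  shows "dominant i (mutate_weights i W)" "W i \<le> mutate_weights i W i"
proof -
  obtain j k where jk: "j \<noteq> k" "j \<noteq> i" "k \<noteq> i" using obtain_other_two[of i] by metis
  have W: "2 \<le> W l" for l using assms by (auto simp: minimal_weights_def)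
  have *: "2 * W i \<le> W j * W k"
    using spec[OF assms[unfolded minimal_weights_def], of i] jk(1) UNIV_3_diff[OF jk] by simp
  have "2 * W k \<le> W j * W k" "W j * 2 \<le> W j * W k"
    using W[of j] W[of k] by (auto intro!: mult_right_mono mult_left_mono)
  then have **: "W k \<le> W j * W k - W i" "W j \<le> W j * W k - W i" using * by linarith+
  have l: "l = i \<or> l = j \<or> l = k" for l :: 3
    using UNIV_3_diff[of j k i] jk by auto
  show "dominant i (mutate_weights i W)"
    unfolding dominant_def mutate_weights_eq[OF jk]
    using l ** W[of j] W[of k] by (smt (verit) fun_upd_apply)
  show "W i \<le> mutate_weights i W i"
    unfolding mutate_weights_eq[OF jk] using * by simp
qed

abbreviation weights_at :: "(3 \<Rightarrow> real) \<Rightarrow> 3 list \<Rightarrow> 3 \<Rightarrow> real" where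
  "weights_at W w \<equiv> foldr mutate_weights w W"

lemma weights_at_dominant:
  assumes "minimal_weights W" "distinct_adj (k # w)"
  shows "dominant k (weights_at W (k # w))"
  using assms(2)
proof (induction w arbitrary: k)
  case Nil
  then show ?case using minimal_mutate_weights[OF assms(1)] by simp
next
  case (Cons l w)
  then have "dominant l (weights_at W (l # w))" by simp
  then show ?case using dominant_mutate_weights(1)[of l "weights_at W (l # w)" k] Cons.prems by auto
qed

lemma weights_at_step:
  assumes "minimal_weights W" "distinct_adj (k # w)"
  shows "weights_at W w i \<le> weights_at W (k # w) i"
proof -
  have "weights_at W w k \<le> weights_at W (k # w) k"
  proof (cases w)
    case Nil
    then show ?thesis using minimal_mutate_weights[OF assms(1)] by simp
  next
    case (Cons l v)
    then have "dominant l (weights_at W w)"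
      using weights_at_dominant[OF assms(1)] assms(2) by simp
    then show ?thesis using dominant_mutate_weights(2) assms(2) Cons by simp
  qed
  then show ?thesis by (simp add: mutate_weights_def)
qed

lemma weights_at_ge_two:
  assumes "minimal_weights W" "distinct_adj w"
  shows "2 \<le> weights_at W w i"
  using weights_at_dominant[OF assms(1)] assms
  by (cases w) (auto simp: dominant_def minimal_weights_def)

lemma weights_at_sum_mono:
  assumes "minimal_weights W" "distinct_adj w"
  shows "sum W UNIV \<le> sum (weights_at W w) UNIV"
  using assms(2)
proof (induction w)
  case (Cons k w)
  have "sum (weights_at W w) UNIV \<le> sum (weights_at W (k # w)) UNIV"
    using weights_at_step[OF assms(1) Cons.prems] by (intro sum_mono)
  then show ?case using Cons by (force simp: distinct_adj_ConsD)
qed simp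

text \<open>The sum is the right measure because permuting the weights leaves it unchanged. As no
  weight ever decreases, an unchanged total forces every single step to fix all weights.\<close>

lemma weights_at_sum_eq:
  assumes "minimal_weights W" "distinct_adj w" "sum (weights_at W w) UNIV = sum W UNIV"
  shows "weights_at W w = W \<and> (\<forall>k\<in>set w. mutate_weights k W = W)"
  using assms(2,3)
proof (induction w)
  case (Cons k w)
  have dw: "distinct_adj w" using Cons.prems(1) by (simp add: distinct_adj_ConsD)
  have step: "weights_at W w i \<le> weights_at W (k # w) i" for i
    using weights_at_step[OF assms(1) Cons.prems(1)] .
  have le: "sum (weights_at W w) UNIV \<le> sum (weights_at W (k # w)) UNIV"
    using step by (intro sum_mono)
  then have eq: "sum (weights_at W w) UNIV = sum W UNIV"
    using weights_at_sum_mono[OF assms(1) dw] Cons.prems(2) by linarith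
  then have IH: "weights_at W w = W" "\<forall>k\<in>set w. mutate_weights k W = W"
    using Cons.IH[OF dw] by auto
  have "weights_at W (k # w) i = weights_at W w i" for i
  proof (rule ccontr)
    assume "weights_at W (k # w) i \<noteq> weights_at W w i"
    then have "weights_at W w i < weights_at W (k # w) i" using step[of i] by simp
    then have "sum (weights_at W w) UNIV < sum (weights_at W (k # w)) UNIV"
      using step by (intro sum_strict_mono_ex1) auto
    then show False using eq Cons.prems(2) by simp
  qed
  then have "weights_at W (k # w) = weights_at W w" by (intro ext)
  then have "mutate_weights k W = W" using IH(1) by simp
  then show ?case using IH by simp
qed simp


section \<open>Matching seeds along words of mutations\<close>

lemma third_bij:
  assumes "bij \<sigma>" "i \<noteq> j"
  shows "third (\<sigma> i) (\<sigma> j) = \<sigma> (third i j)"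
proof -
  have "inj \<sigma>" using assms(1) by (rule bij_is_inj)
  then show ?thesis
    using assms(2) orient_props(3,4)[OF assms(2)] by (intro third_eq) (auto simp: inj_eq)
qed

lemma mutate_weights_bij:
  assumes "bij \<sigma>"
  shows "mutate_weights (\<sigma> k) W \<circ> \<sigma> = mutate_weights k (W \<circ> \<sigma>)"
proof -
  obtain i j where ij: "i \<noteq> j" "i \<noteq> k" "j \<noteq> k" by (rule obtain_other_two)
  then have "\<sigma> i \<noteq> \<sigma> j" "\<sigma> i \<noteq> \<sigma> k" "\<sigma> j \<noteq> \<sigma> k"
    using bij_is_inj[OF assms] by (auto simp: inj_eq)
  then show ?thesis
    by (auto simp: fun_eq_iff mutate_weights_eq[OF ij] mutate_weights_eq[of "\<sigma> i" "\<sigma> j" "\<sigma> k"]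
        bij_is_inj[OF assms, THEN inj_eq])
qed

lemma mutate_weights_involutive: "mutate_weights k (mutate_weights k W) = W"
proof -
  obtain i j where ij: "i \<noteq> j" "i \<noteq> k" "j \<noteq> k" by (rule obtain_other_two)
  show ?thesis using ij by (auto simp: mutate_weights_eq[OF ij])
qed

lemma weights_at_bij:
  assumes "bij \<sigma>" "W' \<circ> \<sigma> = W"
  shows "weights_at W' (map \<sigma> w) \<circ> \<sigma> = weights_at W w"
  using assms by (induction w) (simp_all add: mutate_weights_bij)

text \<open>Relative to a subring because it serves twice: on the whole field for a constructed
  automorphism, and on the cluster algebra for a given one.\<close>

definition hom_on :: "'a::comm_ring_1 set \<Rightarrow> ('a \<Rightarrow> 'a) \<Rightarrow> bool" where
  "hom_on R f \<longleftrightarrow> f 1 = 1 \<and> (\<forall>x\<in>R. \<forall>y\<in>R. f (x + y) = f x + f y \<and> f (x * y) = f x * f y)"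

lemma is_subring_closed:
  assumes "is_subring R"
  shows "1 \<in> R" "0 \<in> R" "x \<in> R \<Longrightarrow> y \<in> R \<Longrightarrow> x - y \<in> R" "x \<in> R \<Longrightarrow> y \<in> R \<Longrightarrow> x * y \<in> R"
    "x \<in> R \<Longrightarrow> y \<in> R \<Longrightarrow> x + y \<in> R" "x \<in> R \<Longrightarrow> x ^ n \<in> R"
proof -
  show 1: "1 \<in> R" and d: "x \<in> R \<Longrightarrow> y \<in> R \<Longrightarrow> x - y \<in> R"
    and m: "x \<in> R \<Longrightarrow> y \<in> R \<Longrightarrow> x * y \<in> R" for x y
    using assms by (auto simp: is_subring_def)
  show 0: "0 \<in> R" using d[OF 1 1] by simp
  show "x \<in> R \<Longrightarrow> y \<in> R \<Longrightarrow> x + y \<in> R" using d[OF _ d[OF 0]] by fastforce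
  show "x \<in> R \<Longrightarrow> x ^ n \<in> R" by (induction n) (auto intro: 1 m)
qed

lemma hom_on_power:
  assumes "is_subring R" "hom_on R f" "x \<in> R"
  shows "f (x ^ n) = f x ^ n"
  using assms is_subring_closed(6)[OF assms(1,3)] by (induction n) (auto simp: hom_on_def)

lemma hom_on_diff:
  assumes "is_subring R" "hom_on R f" "x \<in> R" "y \<in> R"
  shows "f (x - y) = f x - f y"
proof -
  have "f (x - y + y) = f (x - y) + f y"
    using assms is_subring_closed(3)[OF assms(1)] unfolding hom_on_def by blast
  then show ?thesis by simp
qed

lemma is_subring_hull: "is_subring (is_subring hull S)"
  by (rule hull_in) (auto simp: is_subring_def)

text \<open>The two off-diagonal entries of column \<open>k\<close> have opposite signs, so each
  monomial of the exchange binomial is a power of one variable. Only absolute values remain: the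
  orientation is invisible.\<close>

lemma mutate_cluster_cyclic:
  fixes x :: "('f::field) ^ 3"
  assumes d: "\<And>i. d $ i > 0" and M: "cyclic_matrix d e W M" and ij: "i \<noteq> j" "i \<noteq> k" "j \<noteq> k"
  shows "mutate_cluster k (x, M) $ k
    = inverse (x $ k) * (x $ i ^ nat \<bar>M $ i $ k\<bar> + x $ j ^ nat \<bar>M $ j $ k\<bar>)"
proof -
  have U: "(\<Prod>l\<in>UNIV. f l) = f i * f j * f k" for f :: "3 \<Rightarrow> 'f"
  proof -
    have "(\<Prod>l\<in>UNIV. f l) = f k * prod f (UNIV - {k})" by (rule prod.remove) auto
    then show ?thesis using ij UNIV_3_diff[OF ij] by (simp add: mult.commute)
  qed
  have "real_of_int (M $ k $ k) = 0" using M by (simp add: cyclic_matrix_def)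
  then have kk: "M $ k $ k = 0" by simp
  have "orient i k = - orient j k"
    using orient_path[of i j k] orient_props(2)[of k j] ij by simp
  then have "M $ i $ k > 0 \<longleftrightarrow> \<not> M $ j $ k > 0"
    using cyclic_matrix_sign[OF d M, of i k] cyclic_matrix_sign[OF d M, of j k] M
      orient_props(1)[of j k] ij by (auto simp: cyclic_matrix_def)
  moreover have "M $ i $ k \<noteq> 0" "M $ j $ k \<noteq> 0"
    using cyclic_matrix_nonzero[OF d M] ij by auto
  ultimately have "M $ i $ k > 0 \<and> M $ j $ k < 0 \<or> M $ i $ k < 0 \<and> M $ j $ k > 0" by linarith
  then show ?thesis
    by (auto simp: mutate_cluster_def U kk pos_part_def max_def algebra_simps)
qed

lemma mutate_cluster_other: "i \<noteq> k \<Longrightarrow> mutate_cluster k s $ i = fst s $ i"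
  by (simp add: mutate_cluster_def case_prod_beta)

lemma specializes_mutate_cluster:
  assumes "algebraically_independent x"
    and "\<And>i. specializes x y (u $ i) (v $ i)" "v $ k \<noteq> 0"
  shows "specializes x y (mutate_cluster k (u, M) $ i) (mutate_cluster k (v, M) $ i)"
  using assms unfolding mutate_cluster_def
  by (auto intro!: specializes_mult specializes_inverse specializes_add specializes_prod specializes_power)

abbreviation seed_at where "seed_at s w \<equiv> foldr mutate_seed w s"

lemma snd_mutate_seed: "snd (mutate_seed k s) = mutate_matrix k (snd s)"
  by (simp add: mutate_seed_def)

lemma snd_seed_at: "snd (seed_at (x, M) w) = foldr mutate_matrix w M"
  by (induction w) (simp_all add: mutate_seed_def)

lemma fst_seed_at_Cons:
  "fst (seed_at s (k # w)) = mutate_cluster k (fst (seed_at s w), snd (seed_at s w))"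
  by (simp add: mutate_seed_def)

text \<open>Seeds are indexed by arbitrary words rather than by tree vertices, so that paths can be
  concatenated without reducing them; \<open>involutive\<close> makes backtracking harmless.\<close>

locale cyclic_pattern =
  fixes x0 :: "('f::field_char_0) ^ 3" and B0 :: "int ^ 3 ^ 3" and d :: "int ^ 3" and W0 :: "3 \<Rightarrow> real"
  assumes d_pos: "\<And>i. d $ i > 0"
    and cyclic0: "cyclic_matrix d 1 W0 B0"
    and minimal: "minimal_weights W0"
    and free: "\<And>w. free_generating (fst (seed_at (x0, B0) w))"
    and involutive: "\<And>k w. seed_at (x0, B0) (k # k # w) = seed_at (x0, B0) w"
begin

abbreviation "S w \<equiv> seed_at (x0, B0) w"
abbreviation "X w \<equiv> fst (S w)"
abbreviation "BB w \<equiv> snd (S w)"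
abbreviation "Wt w \<equiv> weights_at W0 w"

lemma X_Cons: "X (k # w) = mutate_cluster k (X w, BB w)"
  by (rule fst_seed_at_Cons)

lemma independent: "algebraically_independent (X w)"
  using free by (simp add: free_generating_def)

lemma X_nonzero: "X w $ i \<noteq> 0"
proof
  assume "X w $ i = 0"
  then have "specializes (X w) ((\<chi> i. 1) :: real ^ 3) 0 1"
    using specializes_var[of "X w" "(\<chi> i. 1) :: real ^ 3" i] by simp
  then show False using specializes_unique[OF independent _ specializes_zero] by fastforce
qed

lemma X_inj: "X w $ i = X w $ j \<longleftrightarrow> i = j"
  using algebraically_independent_inj[OF independent] by blast

text \<open>The parity of the length is recorded because the sign of the orientation at
  \<open>w\<close> is \<open>(-1) ^ length w\<close>.\<close>

lemma reduced_word:
  obtains v where "distinct_adj v" "S v = S w" "Wt v = Wt w" "even (length v) = even (length w)"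
    "set v \<subseteq> set w"
proof (induction w arbitrary: thesis)
  case Nil
  then show ?case by (metis distinct_adj_Nil order_refl)
next
  case (Cons k w)
  obtain v where v: "distinct_adj v" "S v = S w" "Wt v = Wt w" "even (length v) = even (length w)"
    "set v \<subseteq> set w" using Cons.IH by blast
  show ?case
  proof (cases "v \<noteq> [] \<and> hd v = k")
    case True
    then obtain u where u: "v = k # u" by (cases v) auto
    have S: "S u = mutate_seed k (S v)" using involutive[of k u] u by simp
    show ?thesis
    proof (rule Cons.prems[of u])
      show "distinct_adj u" using v(1) u by (simp add: distinct_adj_ConsD)
      show "S u = S (k # w)" using S v(2) by simp
      show "Wt u = Wt (k # w)" using mutate_weights_involutive[of k "Wt u"] u v(3) by simp
      show "even (length u) = even (length (k # w))" using v(4) u by auto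
      show "set u \<subseteq> set (k # w)" using v(5) u by auto
    qed
  next
    case False
    show ?thesis
    proof (rule Cons.prems[of "k # v"])
      show "distinct_adj (k # v)" using v(1) False by (cases v) auto
    qed (use v in auto)
  qed
qed

text \<open>Positivity of the mutated weight, which keeps the matrix cyclic, comes from the growth
  estimate and so is available along reduced words; \<open>cyclic\<close> then passes to all
  words.\<close>

lemma cyclic_reduced:
  "distinct_adj w \<Longrightarrow> cyclic_matrix d ((-1) ^ length w) (Wt w) (BB w)"
proof (induction w)
  case Nil
  then show ?case using cyclic0 by simp
next
  case (Cons k w)
  then have "cyclic_matrix d ((-1) ^ length w) (Wt w) (BB w)" by (simp add: distinct_adj_ConsD)
  moreover have "mutate_weights k (Wt w) k > 0"
    using weights_at_ge_two[OF minimal Cons.prems, of k] by simp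
  ultimately show ?case using mutate_cyclic_matrix[OF d_pos] by (simp add: snd_mutate_seed)
qed

lemma cyclic: "cyclic_matrix d ((-1) ^ length w) (Wt w) (BB w)"
proof -
  obtain v where v: "distinct_adj v" "S v = S w" "Wt v = Wt w" "even (length v) = even (length w)"
    by (rule reduced_word)
  have "(-1 :: real) ^ length v = (-1) ^ length w" using v(4) by (simp add: minus_one_power_iff)
  then show ?thesis using cyclic_reduced[OF v(1)] v(2,3) by simp
qed

lemma Wt_pos: "Wt w i > 0"
  using cyclic[of w] by (simp add: cyclic_matrix_def)

lemma X_Cons_exchange:
  assumes "i \<noteq> j" "i \<noteq> k" "j \<noteq> k"
  shows "X (k # w) $ k
    = inverse (X w $ k) * (X w $ i ^ nat \<bar>BB w $ i $ k\<bar> + X w $ j ^ nat \<bar>BB w $ j $ k\<bar>)"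
  unfolding X_Cons by (rule mutate_cluster_cyclic[OF d_pos cyclic assms])

definition V :: "3 list \<Rightarrow> real ^ 3" where
  "V w = fst (seed_at (\<chi> i. 1, B0) w)"

lemma V_Cons: "V (k # w) = mutate_cluster k (V w, BB w)"
  unfolding V_def fst_seed_at_Cons by (simp add: snd_seed_at)

lemma V_pos: "V w $ i > 0"
proof (induction w arbitrary: i)
  case (Cons k w)
  have "(\<Prod>j\<in>UNIV. V w $ j ^ f j) > 0" for f :: "3 \<Rightarrow> nat" using Cons.IH by (intro prod_pos) auto
  then show ?case using Cons.IH unfolding V_Cons mutate_cluster_def
    by (auto intro!: mult_pos_pos add_pos_pos)
qed (simp add: V_def)

text \<open>Running the mutations over the reals agrees with specializing the cluster variables,
  since positivity keeps every divisor nonzero.\<close>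

lemma specializes_V: "specializes x0 (\<chi> i. 1) (X w $ i) (V w $ i)"
proof (induction w arbitrary: i)
  case Nil
  then show ?case using specializes_var[of x0 "\<chi> i. 1" i] by (simp add: V_def)
next
  case (Cons k w)
  then show ?case unfolding X_Cons V_Cons
    using independent[of "[]"] V_pos[of w k] by (intro specializes_mutate_cluster) auto
qed

text \<open>
  In the logarithmic coordinates \<open>L\<close>, mutation at \<open>k\<close> makes the \<open>k\<close>-th coordinate larger than
  \<open>2 L i - L k\<close>, so along a reduced word the last mutated coordinate is the strict maximum.
\<close>

definition L :: "3 list \<Rightarrow> 3 \<Rightarrow> real" where
  "L w i = ln (V w $ i) / sqrt (real_of_int (d $ i))"

lemma L_Cons_other: "i \<noteq> k \<Longrightarrow> L (k # w) i = L w i"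
  by (simp add: L_def V_Cons mutate_cluster_other)

text \<open>Dropping the positive monomial in \<open>j\<close> from the exchange relation leaves
  \<open>V i ^ p / V k\<close> as a strict lower bound, with \<open>p = |b_ik|\<close>. After taking
  logarithms and dividing by \<open>sqrt (d $ k)\<close>, the scaling in \<open>L\<close> turns the
  exponent \<open>p\<close> into a weight, which is at least 2.\<close>

lemma L_Cons_gt:
  assumes "distinct_adj w" "i \<noteq> k" "L w i \<ge> 0"
  shows "L (k # w) k > 2 * L w i - L w k"
proof -
  obtain j where j: "i \<noteq> j" "j \<noteq> k" using obtain_other_two[of k] by metis
  let ?r = "\<lambda>i. sqrt (real_of_int (d $ i))"
  have r: "?r i > 0" for i using d_pos by simp
  let ?p = "\<bar>BB w $ i $ k\<bar>"
  have "V w $ i ^ nat ?p / V w $ k < V (k # w) $ k"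
    unfolding V_Cons mutate_cluster_cyclic[OF d_pos cyclic j(1) assms(2) j(2)]
    using V_pos[of w k] V_pos[of w j] by (simp add: divide_inverse mult.commute)
  then have "ln (V w $ i ^ nat ?p / V w $ k) < ln (V (k # w) $ k)"
    using V_pos by (subst ln_less_cancel_iff) auto
  then have "real (nat ?p) * ln (V w $ i) - ln (V w $ k) < ln (V (k # w) $ k)"
    using V_pos[of w i] V_pos[of w k] by (simp only: ln_divide_pos zero_less_power ln_realpow)
  also have "real (nat ?p) = \<bar>real_of_int (BB w $ i $ k)\<bar>" by simp
  also have "\<dots> = Wt w (third i k) * ?r k / ?r i"
    using cyclic_matrix_abs[OF d_pos cyclic assms(2)] .
  also have "Wt w (third i k) * ?r k / ?r i * ln (V w $ i) = ?r k * (Wt w (third i k) * L w i)"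
    by (simp add: L_def)
  finally have "(?r k * (Wt w (third i k) * L w i) - ln (V w $ k)) / ?r k < L (k # w) k"
    unfolding L_def using r[of k] by (simp only: divide_strict_right_mono)
  then have "Wt w (third i k) * L w i - L w k < L (k # w) k"
    using r[of k] by (simp add: diff_divide_distrib L_def)
  moreover have "2 * L w i \<le> Wt w (third i k) * L w i"
    using weights_at_ge_two[OF minimal assms(1)] assms(3) by (intro mult_right_mono)
  ultimately show ?thesis by linarith
qed

lemma L_growth:
  assumes "distinct_adj (k # w)"
  shows "(\<forall>i. L (k # w) i \<ge> 0) \<and> (\<forall>i. i \<noteq> k \<longrightarrow> L (k # w) i < L (k # w) k)"
  using assms
proof (induction w arbitrary: k)
  case Nil
  have 0: "L [] i = 0" for i by (simp add: L_def V_def)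
  obtain i where i: "i \<noteq> k" using obtain_other_two[of k] by metis
  \<comment> \<open>All \<open>L\<close> vanish at the start, so the strictness of
    \<open>L_Cons_gt\<close> alone makes the first step positive.\<close>
  have "L [k] k > 0" using L_Cons_gt[of "[]" i k] i 0 by simp
  then show ?case using 0 L_Cons_other[of _ k "[]"] by (metis less_le order_refl)
next
  case (Cons l w)
  then have lw: "distinct_adj (l # w)" and kl: "k \<noteq> l" by auto
  have IH: "\<And>i. L (l # w) i \<ge> 0" "\<And>i. i \<noteq> l \<Longrightarrow> L (l # w) i < L (l # w) l"
    using Cons.IH[OF lw] by auto
  have "L (k # l # w) k > 2 * L (l # w) l - L (l # w) k"
    using L_Cons_gt[OF lw] kl IH(1) by auto
  then have k: "L (k # l # w) k > L (l # w) l" using IH(2)[OF kl] by linarith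
  have o: "L (k # l # w) i \<le> L (l # w) l" if "i \<noteq> k" for i
    using IH(2)[of i] L_Cons_other[OF that] by (cases "i = l") auto
  show ?case
    using k o IH(1) L_Cons_other by (smt (verit, best))
qed

text \<open>A permuted copy of the initial cluster takes only the value 1 at the all-ones point, so
  all \<open>L\<close> would vanish, whereas a nonempty reduced word has a strict maximum.\<close>

lemma reduced_word_moves_cluster:
  assumes "distinct_adj w" "\<And>i. X w $ \<sigma> i = x0 $ i" "bij \<sigma>"
  shows "w = []"
proof (rule ccontr)
  assume "w \<noteq> []"
  then obtain k v where w: "w = k # v" by (cases w) auto
  have V1: "V w $ i = 1" for i
  proof -
    obtain j where j: "i = \<sigma> j" using assms(3) by (metis bij_pointE)
    have "specializes x0 (\<chi> i. 1) (x0 $ j) (V w $ i)"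
      using specializes_V[of w i] assms(2)[of j] j by simp
    moreover have "specializes x0 ((\<chi> i. 1) :: real ^ 3) (x0 $ j) 1"
      using specializes_var[of x0 "(\<chi> i. 1) :: real ^ 3" j] by simp
    ultimately show ?thesis using specializes_unique independent[of "[]"] by fastforce
  qed
  obtain i where "i \<noteq> k" using obtain_other_two[of k] by metis
  then have "L w i < L w k" using L_growth assms(1) w by blast
  then show False by (simp add: L_def V1)
qed

end


section \<open>Automorphisms of a cyclic pattern\<close>

lemma hom_on_exchange:
  assumes R: "is_subring R" and f: "hom_on R f" and "a \<in> R" "b \<in> R" "u \<in> R" "v \<in> R"
    and eq: "a * b = u ^ p + v ^ q"
  shows "f a * f b = f u ^ p + f v ^ q"
proof -
  have "f a * f b = f (a * b)" using assms(2-4) unfolding hom_on_def by simp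
  also have "\<dots> = f (u ^ p) + f (v ^ q)"
    unfolding eq using f is_subring_closed(6)[OF R] assms(5,6) unfolding hom_on_def by simp
  also have "\<dots> = f u ^ p + f v ^ q" using hom_on_power[OF R f] assms(5,6) by simp
  finally show ?thesis .
qed

context cyclic_pattern
begin

text \<open>The sign of the orientation is deliberately left out: exchange relations do not see it,
  so a permutation that reverses the cycle also counts.\<close>

definition matches :: "(3 \<Rightarrow> 3) \<Rightarrow> 3 list \<Rightarrow> 3 list \<Rightarrow> bool" where
  "matches \<sigma> w w' \<longleftrightarrow> bij \<sigma> \<and> Wt w' \<circ> \<sigma> = Wt w \<and> (\<forall>i. d $ \<sigma> i = d $ i)"

definition carries :: "('f \<Rightarrow> 'f) \<Rightarrow> (3 \<Rightarrow> 3) \<Rightarrow> 3 list \<Rightarrow> 3 list \<Rightarrow> bool" where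
  "carries f \<sigma> w w' \<longleftrightarrow> (\<forall>i. f (X w $ i) = X w' $ \<sigma> i)"

definition A :: "'f set" where
  "A = is_subring hull (\<Union>w. range (\<lambda>i. X w $ i))"

lemma A_subring: "is_subring A"
  unfolding A_def by (rule is_subring_hull)

lemma X_in_A: "X w $ i \<in> A"
  unfolding A_def by (rule hull_inc) auto

lemma matches_append:
  assumes "matches \<sigma> w w'"
  shows "matches \<sigma> (u @ w) (map \<sigma> u @ w')"
  using assms weights_at_bij[of \<sigma> "Wt w'" "Wt w" u] by (auto simp: matches_def)

lemma matches_abs:
  assumes "matches \<sigma> w w'"
  shows "\<bar>BB w' $ \<sigma> i $ \<sigma> j\<bar> = \<bar>BB w $ i $ j\<bar>"
proof (cases "i = j")
  case True
  have "real_of_int (BB w $ i $ i) = 0" for w i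
    using cyclic[of w] unfolding cyclic_matrix_def by auto
  then show ?thesis using True by simp
next
  case False
  have \<sigma>: "bij \<sigma>" "Wt w' \<circ> \<sigma> = Wt w" "\<And>i. d $ \<sigma> i = d $ i"
    using assms by (auto simp: matches_def)
  then have "\<sigma> i \<noteq> \<sigma> j" using False by (simp add: bij_is_inj inj_eq)
  then have "real_of_int \<bar>BB w' $ \<sigma> i $ \<sigma> j\<bar> = real_of_int \<bar>BB w $ i $ j\<bar>"
    using cyclic_matrix_abs[OF d_pos cyclic, of "\<sigma> i" "\<sigma> j" w']
      cyclic_matrix_abs[OF d_pos cyclic False, of w] \<sigma>(2) third_bij[OF \<sigma>(1) False]
    by (simp add: \<sigma>(3) fun_eq_iff)
  then show ?thesis by linarith
qed

text \<open>The products \<open>|b_ij b_ji|\<close> are the squared weights. The quotients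
  \<open>|b_ij| / |b_ji|\<close> determine \<open>d\<close> only up to a common factor, and this
  factor is 1 because \<sigma> merely permutes the entries of \<open>d\<close>.\<close>

lemma abs_matches:
  assumes \<sigma>: "bij \<sigma>" and eq: "\<And>i j. i \<noteq> j \<Longrightarrow> \<bar>BB w' $ \<sigma> i $ \<sigma> j\<bar> = \<bar>BB w $ i $ j\<bar>"
  shows "matches \<sigma> w w'"
proof -
  have inj: "\<sigma> i \<noteq> \<sigma> j \<longleftrightarrow> i \<noteq> j" for i j using \<sigma> by (simp add: bij_is_inj inj_eq)
  have "Wt w' (\<sigma> k) = Wt w k" for k
  proof -
    obtain i j where ij: "i \<noteq> j" "i \<noteq> k" "j \<noteq> k" by (rule obtain_other_two)
    have t: "third i j = k" using ij by (rule third_eq)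
    have "(Wt w' (third (\<sigma> i) (\<sigma> j)))\<^sup>2 = (Wt w (third i j))\<^sup>2"
    proof -
      have ne: "\<sigma> i \<noteq> \<sigma> j" "j \<noteq> i" using ij(1) inj by auto
      have "\<bar>real_of_int (BB w' $ \<sigma> i $ \<sigma> j)\<bar> = \<bar>real_of_int (BB w $ i $ j)\<bar>"
        "\<bar>real_of_int (BB w' $ \<sigma> j $ \<sigma> i)\<bar> = \<bar>real_of_int (BB w $ j $ i)\<bar>"
        by (simp_all only: of_int_abs[symmetric] eq[OF ij(1)] eq[OF ne(2)])
      then show ?thesis
        using cyclic_matrix_abs_mult[OF d_pos cyclic ne(1), of w']
          cyclic_matrix_abs_mult[OF d_pos cyclic ij(1), of w] by (simp only:)
    qed
    then have "(Wt w' (\<sigma> k))\<^sup>2 = (Wt w k)\<^sup>2" unfolding third_bij[OF \<sigma> ij(1)] t .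
    then show ?thesis
      by (rule power2_eq_imp_eq) (rule less_imp_le[OF Wt_pos])+
  qed
  moreover have "d $ \<sigma> i = d $ i" for i
  proof -
    have cross: "d $ \<sigma> i * d $ j = d $ i * d $ \<sigma> j" for j
    proof (cases "i = j")
      case False
      let ?x = "\<bar>BB w $ i $ j\<bar>" and ?y = "\<bar>BB w $ j $ i\<bar>"
      have 1: "d $ i * ?x = d $ j * ?y"
        using cyclic_matrix_symmetrizer[OF d_pos cyclic False] .
      have 2: "d $ \<sigma> i * ?x = d $ \<sigma> j * ?y"
        using cyclic_matrix_symmetrizer[OF d_pos cyclic, of "\<sigma> i" "\<sigma> j" w'] inj False
          eq[OF False] eq[of j i] by metis
      have "?x * ?y * (d $ \<sigma> i * d $ j) = (d $ \<sigma> i * ?x) * (d $ j * ?y)" by (simp add: mult_ac)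
      also have "\<dots> = (d $ \<sigma> j * ?y) * (d $ i * ?x)" unfolding 1 2 ..
      also have "\<dots> = ?x * ?y * (d $ i * d $ \<sigma> j)" by (simp add: mult_ac)
      finally show ?thesis
        using cyclic_matrix_nonzero[OF d_pos cyclic, of _ _ w] False by simp
    qed simp
    let ?s = "\<Sum>j\<in>UNIV. d $ j"
    have "d $ \<sigma> i * ?s = d $ i * (\<Sum>j\<in>UNIV. d $ \<sigma> j)"
      using cross by (simp add: sum_distrib_left)
    also have "(\<Sum>j\<in>UNIV. d $ \<sigma> j) = ?s" by (rule sum.reindex_bij_betw[OF \<sigma>])
    finally show ?thesis using sum_pos[of UNIV "\<lambda>j. d $ j"] d_pos by auto
  qed
  ultimately show ?thesis using \<sigma> by (auto simp: matches_def)
qed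

text \<open>The subring \<open>R\<close> need not contain inverses, so \<open>f\<close> is applied
  to the exchange relation in multiplied form and the division takes place in the image.\<close>

lemma carries_Cons:
  assumes R: "is_subring R" "hom_on R f" "\<And>w i. X w $ i \<in> R"
    and m: "matches \<sigma> w w'" and c: "carries f \<sigma> w w'"
  shows "carries f \<sigma> (k # w) (\<sigma> k # w')"
  unfolding carries_def
proof
  fix l
  have inj: "\<sigma> i \<noteq> \<sigma> j \<longleftrightarrow> i \<noteq> j" for i j using m by (simp add: matches_def bij_is_inj inj_eq)
  show "f (X (k # w) $ l) = X (\<sigma> k # w') $ \<sigma> l"
  proof (cases "l = k")
    case False
    then show ?thesis unfolding X_Cons using c inj by (simp add: mutate_cluster_other carries_def)
  next
    case True
    obtain i j where ij: "i \<noteq> j" "i \<noteq> k" "j \<noteq> k" by (rule obtain_other_two)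
    let ?p = "nat \<bar>BB w $ i $ k\<bar>" and ?q = "nat \<bar>BB w $ j $ k\<bar>"
    have ex: "X w $ k * X (k # w) $ k = X w $ i ^ ?p + X w $ j ^ ?q"
      using X_nonzero[of w k] unfolding X_Cons_exchange[OF ij]
      by (simp add: mult.assoc[symmetric])
    have "f (X w $ k) * f (X (k # w) $ k) = f (X w $ i) ^ ?p + f (X w $ j) ^ ?q"
      by (rule hom_on_exchange[OF R(1,2) R(3) R(3) R(3) R(3) ex])
    then have "X w' $ \<sigma> k * f (X (k # w) $ k) = X w' $ \<sigma> i ^ ?p + X w' $ \<sigma> j ^ ?q"
      using c by (simp add: carries_def)
    then have "f (X (k # w) $ k) = inverse (X w' $ \<sigma> k) * (X w' $ \<sigma> i ^ ?p + X w' $ \<sigma> j ^ ?q)"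
      using X_nonzero[of w' "\<sigma> k"] by (simp add: field_simps)
    moreover have "\<sigma> i \<noteq> \<sigma> j" "\<sigma> i \<noteq> \<sigma> k" "\<sigma> j \<noteq> \<sigma> k" using ij inj by auto
    ultimately show ?thesis unfolding True
      by (simp only: X_Cons_exchange matches_abs[OF m] simp_thms)
  qed
qed

lemma carries_append:
  assumes R: "is_subring R" "hom_on R f" "\<And>w i. X w $ i \<in> R"
    and m: "matches \<sigma> w w'" and c: "carries f \<sigma> w w'"
  shows "carries f \<sigma> (u @ w) (map \<sigma> u @ w')"
proof (induction u)
  case (Cons k u)
  then show ?case using carries_Cons[OF R matches_append[OF m, of u]] by simp
qed (use c in simp)

lemma S_rev: "S (rev u @ u @ w) = S w"
proof (induction u)
  case (Cons k u)
  have "S (rev (k # u) @ (k # u) @ w) = seed_at (S (k # k # u @ w)) (rev u)" by simp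
  also have "\<dots> = S (rev u @ u @ w)" unfolding involutive by simp
  finally show ?case using Cons by simp
qed simp

lemma S_rev': "S (u @ rev u @ w) = S w"
  using S_rev[of "rev u" w] by simp

lemma Wt_rev: "Wt (rev u @ u @ w) = Wt w"
  by (induction u) (simp_all add: mutate_weights_involutive)

text \<open>Transport along words sends the variables at \<open>u\<close> to those at
  \<open>map \<sigma> u @ w\<close>, and every seed is reached in this way.\<close>

lemma carries_generators_image:
  assumes R: "is_subring R" "hom_on R f" "\<And>w i. X w $ i \<in> R"
    and m: "matches \<sigma> [] w" and c: "carries f \<sigma> [] w"
  shows "f ` (\<Union>w. range (\<lambda>i. X w $ i)) = (\<Union>w. range (\<lambda>i. X w $ i))"
proof -
  have \<sigma>: "bij \<sigma>" using m by (simp add: matches_def)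
  have c: "f (X u $ i) = X (map \<sigma> u @ w) $ \<sigma> i" for u i
    using carries_append[OF R m c, of u] by (simp add: carries_def)
  have "X v $ i \<in> f ` (\<Union>w. range (\<lambda>i. X w $ i))" for v i
  proof -
    \<comment> \<open>Relabeled by \<sigma>, this word leads from \<open>w\<close> back to the root
      and then out along \<open>v\<close>.\<close>
    let ?u = "map (inv_into UNIV \<sigma>) (v @ rev w)"
    have "map \<sigma> ?u = v @ rev w" using \<sigma> by (simp add: bij_is_surj surj_f_inv_f comp_def)
    then have "S (map \<sigma> ?u @ w) = S v" using S_rev[of w "[]"] by simp
    then have "f (X ?u $ inv_into UNIV \<sigma> i) = X v $ i"
      unfolding c using \<sigma> by (simp add: bij_is_surj surj_f_inv_f)
    then have "X v $ i = f (X ?u $ inv_into UNIV \<sigma> i)" by (rule sym)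
    then show ?thesis by (rule image_eqI) blast
  qed
  moreover have "f (X u $ i) \<in> (\<Union>w. range (\<lambda>i. X w $ i))" for u i
    unfolding c by blast
  ultimately show ?thesis by blast
qed

lemma bij_hom_image_hull:
  fixes \<phi> :: "'f \<Rightarrow> 'f"
  assumes "bij \<phi>" "hom_on UNIV \<phi>" "\<phi> ` G = G"
  shows "\<phi> ` (is_subring hull G) = is_subring hull G"
proof
  have U: "is_subring (UNIV :: 'f set)" by (simp add: is_subring_def)
  have hom: "\<phi> 1 = 1" "\<And>x y. \<phi> (x * y) = \<phi> x * \<phi> y" "\<And>x y. \<phi> (x - y) = \<phi> x - \<phi> y"
    using assms(2) hom_on_diff[OF U assms(2)] by (auto simp: hom_on_def)
  let ?H = "is_subring hull G"
  have H: "is_subring ?H" by (rule is_subring_hull)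
  have "is_subring (\<phi> -` ?H)"
    using H by (auto simp: is_subring_def hom)
  moreover have "G \<subseteq> \<phi> -` ?H" using assms(3) hull_subset[of G is_subring] by auto
  ultimately have "?H \<subseteq> \<phi> -` ?H" by (rule hull_minimal[rotated])
  then show "\<phi> ` ?H \<subseteq> ?H" by auto
  have "is_subring (\<phi> ` ?H)" unfolding is_subring_def[of "\<phi> ` ?H"]
  proof (intro conjI ballI)
    show "1 \<in> \<phi> ` ?H" using hom(1) is_subring_closed(1)[OF H] by (metis imageI)
    fix x y assume "x \<in> \<phi> ` ?H" "y \<in> \<phi> ` ?H"
    then obtain u v where uv: "u \<in> ?H" "v \<in> ?H" "x = \<phi> u" "y = \<phi> v" by blast
    show "x - y \<in> \<phi> ` ?H" unfolding uv(3,4) hom(3)[symmetric]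
      by (intro imageI is_subring_closed(3)[OF H] uv)
    show "x * y \<in> \<phi> ` ?H" unfolding uv(3,4) hom(2)[symmetric]
      by (intro imageI is_subring_closed(4)[OF H] uv)
  qed
  moreover have "G \<subseteq> \<phi> ` ?H" using assms(3) hull_subset[of G is_subring] by (metis image_mono)
  ultimately show "?H \<subseteq> \<phi> ` ?H" by (rule hull_minimal[rotated])
qed

text \<open>Normal form of a cluster automorphism: the source is the initial seed, and the condition
  on mutated clusters is replaced by \<open>matches\<close>.\<close>

definition aut :: "('f \<Rightarrow> 'f) \<Rightarrow> bool" where
  "aut f \<longleftrightarrow> subring_automorphism A f \<and> (\<exists>w \<sigma>. matches \<sigma> [] w \<and> carries f \<sigma> [] w)"

lemma subring_automorphism_hom_on: "subring_automorphism A f \<Longrightarrow> hom_on A f"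
  by (auto simp: subring_automorphism_def hom_on_def)

text \<open>Two free generating tuples yield an automorphism of the whole field. It maps the set of
  cluster variables onto itself, so it restricts to \<open>A\<close>; \<open>restrict\<close> makes
  the result extensional, as \<open>Bij\<close> demands.\<close>

lemma aut_exists:
  assumes m: "matches \<sigma> [] w"
  obtains f where "aut f" "carries f \<sigma> [] w"
proof -
  have \<sigma>: "bij \<sigma>" using m by (simp add: matches_def)
  obtain \<phi> :: "'f \<Rightarrow> 'f" where \<phi>: "bij \<phi>" "\<phi> 1 = 1" "\<And>u v. \<phi> (u + v) = \<phi> u + \<phi> v"
    "\<And>u v. \<phi> (u * v) = \<phi> u * \<phi> v" "\<And>i. \<phi> (X [] $ i) = (\<chi> i. X w $ \<sigma> i) $ i"
    using free_generating_automorphism[OF free[of "[]"] free_generating_permute[OF free[of w] \<sigma>]] by blast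
  have hom: "hom_on UNIV \<phi>" using \<phi> by (simp add: hom_on_def)
  have U: "is_subring (UNIV :: 'f set)" by (simp add: is_subring_def)
  have c: "carries \<phi> \<sigma> [] w" using \<phi>(5) by (simp add: carries_def)
  have img: "\<phi> ` A = A" unfolding A_def
    using bij_hom_image_hull[OF \<phi>(1) hom carries_generators_image[OF U hom _ m c]] by simp
  define f where "f = restrict \<phi> A"
  have "f ` A = A" using img by (auto simp: f_def)
  moreover have "inj_on f A" using \<phi>(1) unfolding f_def
    by (metis bij_is_inj inj_on_restrict_eq inj_on_subset subset_UNIV)
  ultimately have "f \<in> Bij A" by (simp add: Bij_def bij_betw_def f_def)
  then have "subring_automorphism A f"
    unfolding subring_automorphism_def using is_subring_closed[OF A_subring]
    by (auto simp: f_def \<phi>)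
  moreover have "carries f \<sigma> [] w" using c X_in_A[of "[]"] by (simp add: carries_def f_def)
  ultimately show ?thesis using that m by (auto simp: aut_def)
qed

text \<open>The elements on which \<open>f\<close> and \<open>g\<close> agree form a subring, which
  by transport along words contains every cluster variable.\<close>

lemma aut_unique:
  assumes f: "subring_automorphism A f" and g: "subring_automorphism A g"
    and m: "matches \<sigma> [] w" and c: "carries f \<sigma> [] w" "carries g \<sigma> [] w"
  shows "f = g"
proof (rule extensionalityI[of _ A])
  show "f \<in> extensional A" "g \<in> extensional A"
    using f g by (auto simp: subring_automorphism_def Bij_def)
  note hf = subring_automorphism_hom_on[OF f] and hg = subring_automorphism_hom_on[OF g]
  let ?E = "{x \<in> A. f x = g x}"
  have "X u $ i \<in> ?E" for u i
    using carries_append[OF A_subring hf X_in_A m c(1), of u]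
      carries_append[OF A_subring hg X_in_A m c(2), of u] X_in_A by (simp add: carries_def)
  then have "(\<Union>w. range (\<lambda>i. X w $ i)) \<subseteq> ?E" by blast
  moreover have "is_subring ?E"
    unfolding is_subring_def
    using is_subring_closed[OF A_subring] hom_on_diff[OF A_subring hf] hom_on_diff[OF A_subring hg] hf hg
    unfolding hom_on_def by auto
  ultimately have "A \<subseteq> ?E" unfolding A_def by (rule hull_minimal)
  then show "f x = g x" if "x \<in> A" for x using that by blast
qed

text \<open>The element \<open>f x_k * f x_k'\<close> is the exchange binomial at \<open>w'\<close>
  and also the image of the one at \<open>w\<close>. Two binomials in independent variables that are
  equal as elements can be compared by specializing.\<close>

lemma carries_exchange_abs:
  assumes h: "hom_on A f" and \<sigma>: "bij \<sigma>" and c: "carries f \<sigma> w w'"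
    and c': "f (X (k # w) $ k) = X (\<sigma> k # w') $ \<sigma> k" and "i \<noteq> k"
  shows "\<bar>BB w' $ \<sigma> i $ \<sigma> k\<bar> = \<bar>BB w $ i $ k\<bar>"
proof -
  obtain j where j: "i \<noteq> j" "j \<noteq> k" using obtain_other_two[of k] by metis
  have \<sigma>j: "\<sigma> i \<noteq> \<sigma> j" "\<sigma> i \<noteq> \<sigma> k" "\<sigma> j \<noteq> \<sigma> k"
    using \<sigma> j \<open>i \<noteq> k\<close> by (auto simp: bij_is_inj inj_eq)
  let ?p = "\<lambda>i k w. nat \<bar>BB w $ i $ k\<bar>"
  have ex: "X w $ k * X (k # w) $ k = X w $ i ^ ?p i k w + X w $ j ^ ?p j k w"
    if "i \<noteq> j" "i \<noteq> k" "j \<noteq> k" for w i j k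
    using X_nonzero[of w k] unfolding X_Cons_exchange[OF that]
    by (simp add: mult.assoc[symmetric])
  have "f (X w $ k) * f (X (k # w) $ k) = f (X w $ i) ^ ?p i k w + f (X w $ j) ^ ?p j k w"
    by (rule hom_on_exchange[OF A_subring h X_in_A X_in_A X_in_A X_in_A ex[OF j(1) \<open>i \<noteq> k\<close> j(2)]])
  then have eq: "X w' $ \<sigma> i ^ ?p (\<sigma> i) (\<sigma> k) w' + X w' $ \<sigma> j ^ ?p (\<sigma> j) (\<sigma> k) w'
     = X w' $ \<sigma> i ^ ?p i k w + X w' $ \<sigma> j ^ ?p j k w"
    using c c' ex[OF \<sigma>j, of w'] by (simp add: carries_def)
  \<comment> \<open>With the variable at \<open>\<sigma> i\<close> set to 2 and the others to 1, the
    binomial with exponents \<open>a\<close> and \<open>b\<close> becomes \<open>2 ^ a + 1\<close>,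
    which determines \<open>a\<close>.\<close>
  define y :: "real ^ 3" where "y = (\<chi> l. if l = \<sigma> i then 2 else 1)"
  have sp: "specializes (X w') y (X w' $ \<sigma> i ^ a + X w' $ \<sigma> j ^ b) (2 ^ a + 1)" for a b
    using specializes_add[OF specializes_power[OF specializes_var[of "X w'" y "\<sigma> i"], of a]
        specializes_power[OF specializes_var[of "X w'" y "\<sigma> j"], of b]] \<sigma>j
    by (simp add: y_def)
  have "(2 :: real) ^ ?p (\<sigma> i) (\<sigma> k) w' + 1 = 2 ^ ?p i k w + 1"
    using specializes_unique[OF independent sp] sp eq by metis
  then have "?p (\<sigma> i) (\<sigma> k) w' = ?p i k w" by simp
  then show ?thesis by (simp add: nat_eq_iff)
qed

lemma cluster_automorphism_iff_aut:
  assumes seeds: "pattern_seeds \<Sigma> = range (\<lambda>w. S w)"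
  shows "cluster_algebra \<Sigma> = A" "cluster_automorphism \<Sigma> f \<longleftrightarrow> aut f"
proof -
  show A: "cluster_algebra \<Sigma> = A"
    unfolding cluster_algebra_def A_def seeds by simp
  have perm: "permute_tuple \<sigma> (\<chi> i. f (x $ i)) = y \<longleftrightarrow> (\<forall>i. f (x $ i) = y $ \<sigma> i)"
    if \<sigma>: "bij \<sigma>" for \<sigma> and x y :: "'f ^ 3"
  proof -
    have "permute_tuple \<sigma> (\<chi> i. f (x $ i)) = y \<longleftrightarrow> (\<forall>i. f (x $ inv_into UNIV \<sigma> i) = y $ i)"
      by (simp add: permute_tuple_def vec_eq_iff)
    also have "\<dots> \<longleftrightarrow> (\<forall>i. f (x $ i) = y $ \<sigma> i)"
      using \<sigma> by (metis bij_inv_eq_iff)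
    finally show ?thesis .
  qed
  have mc: "mutate_cluster k (S w) = X (k # w)" for k w
    unfolding X_Cons by simp
  have ca: "cluster_automorphism \<Sigma> f \<longleftrightarrow> subring_automorphism A f \<and>
     (\<exists>u v \<sigma>. bij \<sigma> \<and> carries f \<sigma> u v \<and> (\<forall>k. carries f \<sigma> (k # u) (\<sigma> k # v)))"
  proof -
    have eq: "bij \<sigma> \<and> permute_tuple \<sigma> (\<chi> i. f (X u $ i)) = X v \<and>
        (\<forall>k. permute_tuple \<sigma> (\<chi> i. f (mutate_cluster k (S u) $ i)) = mutate_cluster (\<sigma> k) (S v))
      \<longleftrightarrow> bij \<sigma> \<and> carries f \<sigma> u v \<and> (\<forall>k. carries f \<sigma> (k # u) (\<sigma> k # v))" for u v \<sigma>
      unfolding carries_def mc using perm[of \<sigma>] by blast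
    show ?thesis
      unfolding cluster_automorphism_def A seeds bex_simps eq ..
  qed
  show "cluster_automorphism \<Sigma> f \<longleftrightarrow> aut f"
  proof
    assume "cluster_automorphism \<Sigma> f"
    then obtain u v \<sigma> where f: "subring_automorphism A f" and \<sigma>: "bij \<sigma>"
      and c: "carries f \<sigma> u v" and c': "\<And>k. carries f \<sigma> (k # u) (\<sigma> k # v)"
      unfolding ca by blast
    have h: "hom_on A f" using f by (rule subring_automorphism_hom_on)
    have m: "matches \<sigma> u v"
      by (rule abs_matches[OF \<sigma>], rule carries_exchange_abs[OF h \<sigma> c])
        (use c' in \<open>auto simp: carries_def\<close>)
    \<comment> \<open>Walking back along \<open>rev u\<close> moves the source seed to the root; the
      target seed follows the relabeled path.\<close>
    have "matches \<sigma> [] (map \<sigma> (rev u) @ v)"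
      using matches_append[OF m, of "rev u"] Wt_rev[of u "[]"] by (simp add: matches_def)
    moreover have "carries f \<sigma> [] (map \<sigma> (rev u) @ v)"
      using carries_append[OF A_subring h X_in_A m c, of "rev u"] S_rev[of u "[]"]
      by (simp add: carries_def)
    ultimately show "aut f" using f by (auto simp: aut_def)
  next
    assume "aut f"
    then obtain w \<sigma> where f: "subring_automorphism A f" and m: "matches \<sigma> [] w"
      and c: "carries f \<sigma> [] w" by (auto simp: aut_def)
    have "carries f \<sigma> [k] (\<sigma> k # w)" for k
      using carries_Cons[OF A_subring subring_automorphism_hom_on[OF f] X_in_A m c] .
    then show "cluster_automorphism \<Sigma> f"
      unfolding ca using f m c by (auto simp: matches_def)
  qed
qed

end


section \<open>Groups generated by involutions\<close>

abbreviation involution_relators :: "'a set \<Rightarrow> 'a group_word set" where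
  "involution_relators X \<equiv> {[(True, x), (True, x)] | x. x \<in> X}"

abbreviation involution_cong :: "'a set \<Rightarrow> ('a group_word \<times> 'a group_word) set" where
  "involution_cong X \<equiv> word_congruence X (involution_relators X)"

definition involution_class :: "'a set \<Rightarrow> 'a group_word \<Rightarrow> 'a group_word set" where
  "involution_class X u = involution_cong X `` {u}"

section \<open>Word congruence and normal forms\<close>

lemma group_words_simps [simp]:
  "[] \<in> group_words X" "p # u \<in> group_words X \<longleftrightarrow> snd p \<in> X \<and> u \<in> group_words X"
  "u @ v \<in> group_words X \<longleftrightarrow> u \<in> group_words X \<and> v \<in> group_words X"
  by (auto simp: group_words_def mem_Times_iff)

lemma involution_cong_words:
  assumes "(u, v) \<in> involution_cong X"
  shows "u \<in> group_words X" "v \<in> group_words X"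
proof -
  have "u \<in> group_words X \<and> v \<in> group_words X"
    using assms by (induction rule: word_congruence.induct) auto
  then show "u \<in> group_words X" "v \<in> group_words X" by auto
qed

lemma involution_cong_append:
  assumes "(u, v) \<in> involution_cong X" "a \<in> group_words X" "b \<in> group_words X"
  shows "(a @ u @ b, a @ v @ b) \<in> involution_cong X"
  using assms
proof (induction rule: word_congruence.induct)
  case (wc_refl w)
  then show ?case by (intro word_congruence.wc_refl) auto
next
  case (wc_sym v w)
  then show ?case by (blast intro: word_congruence.wc_sym)
next
  case (wc_trans u v w)
  then show ?case by (blast intro: word_congruence.wc_trans)
next
  case (wc_cancel u v x e)
  then show ?case
    using word_congruence.wc_cancel[of "a @ u" X "v @ b" x e] by simp
next
  case (wc_relator u v r)
  then show ?case
    using word_congruence.wc_relator[of "a @ u" X "v @ b" r "involution_relators X"] by simp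
qed

lemma involution_cong_append2:
  assumes "(u, u') \<in> involution_cong X" "(v, v') \<in> involution_cong X"
  shows "(u @ v, u' @ v') \<in> involution_cong X"
proof -
  have "(u @ v, u' @ v) \<in> involution_cong X"
    using involution_cong_append[OF assms(1), of "[]" v] involution_cong_words[OF assms(2)] by simp
  moreover have "(u' @ v, u' @ v') \<in> involution_cong X"
    using involution_cong_append[OF assms(2), of u' "[]"] involution_cong_words[OF assms(1)] by simp
  ultimately show ?thesis by (rule wc_trans)
qed

lemma involution_class_eq_iff:
  assumes "u \<in> group_words X"
  shows "involution_class X u = involution_class X v \<longleftrightarrow> (u, v) \<in> involution_cong X"
  using assms unfolding involution_class_def
  by (auto intro: wc_refl wc_sym wc_trans)

lemma carrier_involution_group:
  "carrier (involution_group X) = involution_class X ` group_words X"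
  by (auto simp: involution_group_def presented_group_def quotient_def involution_class_def)

lemma mult_involution_group:
  assumes "u \<in> group_words X" "v \<in> group_words X"
  shows "involution_class X u \<otimes>\<^bsub>involution_group X\<^esub> involution_class X v = involution_class X (u @ v)"
proof -
  have "involution_class X (u' @ v') = involution_class X (u @ v)"
    if "u' \<in> involution_class X u" "v' \<in> involution_class X v" for u' v'
  proof -
    have "(u, u') \<in> involution_cong X" "(v, v') \<in> involution_cong X"
      using that by (auto simp: involution_class_def)
    then have "(u @ v, u' @ v') \<in> involution_cong X" by (rule involution_cong_append2)
    then show ?thesis using assms involution_class_eq_iff[of "u @ v" X "u' @ v'"] by simp
  qed
  moreover have "u \<in> involution_class X u" "v \<in> involution_class X v"
    using assms by (auto simp: involution_class_def intro: wc_refl)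
  ultimately have "(\<Union>u'\<in>involution_class X u. \<Union>v'\<in>involution_class X v. involution_class X (u' @ v'))
     = involution_class X (u @ v)" by blast
  then show ?thesis
    by (simp add: involution_group_def presented_group_def involution_class_def)
qed

text \<open>Inserting the relator behind the inverse letter and cancelling once turns the inverse
  letter into the generator.\<close>

lemma involution_cong_letter:
  assumes "x \<in> X" "v \<in> group_words X"
  shows "((e, x) # v, (True, x) # v) \<in> involution_cong X"
proof (cases e)
  case True
  then show ?thesis using assms by (auto intro: wc_refl)
next
  case False
  have "([(False, x)] @ [(True, x), (True, x)] @ v, [(False, x)] @ v) \<in> involution_cong X"
    using assms by (intro wc_relator) auto
  moreover have "([] @ [(False, x), (\<not> False, x)] @ ((True, x) # v), [] @ (True, x) # v) \<in> involution_cong X"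
    using assms by (intro wc_cancel) auto
  ultimately show ?thesis using False by (auto intro: wc_trans wc_sym)
qed

lemma involution_cong_reduced:
  assumes "w \<in> group_words X"
  obtains r where "distinct_adj r" "set r \<subseteq> X" "(w, map (Pair True) r) \<in> involution_cong X"
  using assms
proof (induction w arbitrary: thesis)
  case Nil
  show ?case by (rule Nil(1)[of "[]"]) (auto intro: wc_refl)
next
  case (Cons p w)
  obtain e x where p: "p = (e, x)" by force
  have x: "x \<in> X" and w: "w \<in> group_words X" using Cons.prems p by auto
  obtain r where r: "distinct_adj r" "set r \<subseteq> X" "(w, map (Pair True) r) \<in> involution_cong X"
    using Cons.IH w by blast
  have rw: "map (Pair True) r \<in> group_words X" using involution_cong_words[OF r(3)] by simp
  have "(p # w, (True, x) # map (Pair True) r) \<in> involution_cong X"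
    using involution_cong_letter[OF x w, of e] involution_cong_append[OF r(3), of "[(True, x)]" "[]"] x
    unfolding p by (auto intro: wc_trans)
  then have step: "(p # w, map (Pair True) (x # r)) \<in> involution_cong X" by simp
  show ?case
  proof (cases "r \<noteq> [] \<and> hd r = x")
    case True
    then obtain r' where r': "r = x # r'" by (cases r) auto
    have "([] @ [(True, x), (True, x)] @ map (Pair True) r', [] @ map (Pair True) r') \<in> involution_cong X"
      using x rw r' by (intro wc_relator) auto
    then have "(p # w, map (Pair True) r') \<in> involution_cong X"
      using step r' by (auto intro: wc_trans)
    then show ?thesis using Cons.prems(1)[of r'] r r' by (auto dest: distinct_adj_ConsD)
  next
    case False
    then have "distinct_adj (x # r)" using r(1) by (cases r) auto
    then show ?thesis using Cons.prems(1)[of "x # r"] r(2) x step by auto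
  qed
qed

lemma involution_cong_map:
  assumes "(u, v) \<in> involution_cong X" "\<pi> ` X \<subseteq> X"
  shows "(map (map_prod id \<pi>) u, map (map_prod id \<pi>) v) \<in> involution_cong X"
proof -
  have gw: "map (map_prod id \<pi>) w \<in> group_words X" if "w \<in> group_words X" for w
    using that assms(2) by (induction w) auto
  show ?thesis using assms(1)
  proof (induction rule: word_congruence.induct)
    case (wc_refl w)
    then show ?case by (intro word_congruence.wc_refl gw)
  next
    case (wc_sym v w)
    then show ?case by (blast intro: word_congruence.wc_sym)
  next
    case (wc_trans u v w)
    then show ?case by (blast intro: word_congruence.wc_trans)
  next
    case (wc_cancel u v x e)
    then have "\<pi> x \<in> X" using assms(2) by blast
    then show ?case
      using word_congruence.wc_cancel[OF gw gw, of u v "\<pi> x" e "involution_relators X"] wc_cancel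
      unfolding id_def by (simp only: map_append list.map map_prod_simp simp_thms)
  next
    case (wc_relator u v r)
    then obtain x where x: "r = [(True, x), (True, x)]" "x \<in> X" by auto
    then have "map (map_prod id \<pi>) r \<in> involution_relators X" using assms(2) by auto
    then show ?case
      using word_congruence.wc_relator[OF gw gw, of u v "map (map_prod id \<pi>) r" "involution_relators X"]
        wc_relator.hyps unfolding id_def by (simp only: map_append simp_thms)
  qed
qed

text \<open>One inclusion is \<open>involution_cong_map\<close> for \<pi>; the other applies it to
  the inverse permutation, so that the image fills the whole class.\<close>

lemma relabel_involution_class:
  assumes "bij_betw \<pi> X X" "u \<in> group_words X"
  shows "relabel_generators \<pi> (involution_class X u) = involution_class X (map (map_prod id \<pi>) u)"
proof
  have \<pi>: "\<pi> ` X \<subseteq> X" using assms(1) by (simp add: bij_betw_def)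
  show "relabel_generators \<pi> (involution_class X u) \<subseteq> involution_class X (map (map_prod id \<pi>) u)"
    using involution_cong_map[OF _ \<pi>] by (auto simp: relabel_generators_def involution_class_def)
  let ?\<rho> = "inv_into X \<pi>"
  have \<rho>: "?\<rho> ` X \<subseteq> X" using bij_betw_inv_into[OF assms(1)] by (simp add: bij_betw_def)
  have inv1: "map (map_prod id \<pi>) (map (map_prod id ?\<rho>) w) = w" if "w \<in> group_words X" for w
    using that bij_betw_inv_into_right[OF assms(1)] by (induction w) auto
  have inv2: "map (map_prod id ?\<rho>) (map (map_prod id \<pi>) w) = w" if "w \<in> group_words X" for w
    using that bij_betw_inv_into_left[OF assms(1)] by (induction w) auto
  show "involution_class X (map (map_prod id \<pi>) u) \<subseteq> relabel_generators \<pi> (involution_class X u)"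
  proof
    fix w assume "w \<in> involution_class X (map (map_prod id \<pi>) u)"
    then have uw: "(map (map_prod id \<pi>) u, w) \<in> involution_cong X" by (simp add: involution_class_def)
    then have "(u, map (map_prod id ?\<rho>) w) \<in> involution_cong X"
      using involution_cong_map[OF uw \<rho>] inv2[OF assms(2)] by simp
    then show "w \<in> relabel_generators \<pi> (involution_class X u)"
      unfolding relabel_generators_def involution_class_def
      using inv1[OF involution_cong_words(2)[OF uw], symmetric] by blast
  qed
qed

text \<open>Inverting a bijective homomorphism only takes closure of its domain; this spares a
  separate proof that presented groups and semidirect products are groups.\<close>

lemma iso_from_closed:
  assumes f: "f \<in> hom N G" "bij_betw f (carrier N) (carrier G)"
    and closed: "\<And>x y. x \<in> carrier N \<Longrightarrow> y \<in> carrier N \<Longrightarrow> x \<otimes>\<^bsub>N\<^esub> y \<in> carrier N"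
  shows "G \<cong> N"
proof -
  let ?g = "inv_into (carrier N) f"
  have g: "bij_betw ?g (carrier G) (carrier N)" using f(2) by (rule bij_betw_inv_into)
  have fg: "f (?g x) = x" if "x \<in> carrier G" for x
    using bij_betw_inv_into_right[OF f(2) that] .
  have gc: "?g x \<in> carrier N" if "x \<in> carrier G" for x using g that by (auto simp: bij_betw_def)
  have "?g (x \<otimes>\<^bsub>G\<^esub> y) = ?g x \<otimes>\<^bsub>N\<^esub> ?g y" if "x \<in> carrier G" "y \<in> carrier G" for x y
  proof -
    have "f (?g x \<otimes>\<^bsub>N\<^esub> ?g y) = x \<otimes>\<^bsub>G\<^esub> y"
      using f(1) gc fg that by (simp add: hom_def)
    then show ?thesis
      using bij_betw_inv_into_left[OF f(2) closed[OF gc gc]] that by metis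
  qed
  then have "?g \<in> iso G N" using g gc by (auto simp: iso_def hom_def)
  then show ?thesis by (auto simp: is_iso_def)
qed

section \<open>Recognizing free products of groups of order 2\<close>

locale involution_family = group G for G (structure) +
  fixes X :: "'b set" and g :: "'b \<Rightarrow> 'a"
  assumes g_closed: "x \<in> X \<Longrightarrow> g x \<in> carrier G"
    and g_square: "x \<in> X \<Longrightarrow> g x \<otimes> g x = \<one>"
begin

definition word_prod :: "'b list \<Rightarrow> 'a" where
  "word_prod r = foldr (\<lambda>x y. g x \<otimes> y) r \<one>"

lemma word_prod_simps [simp]: "word_prod [] = \<one>" "word_prod (x # r) = g x \<otimes> word_prod r"
  by (simp_all add: word_prod_def)

lemma word_prod_closed [simp]: "set r \<subseteq> X \<Longrightarrow> word_prod r \<in> carrier G"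
  by (induction r) (auto simp: g_closed)

lemma word_prod_append:
  "set r \<subseteq> X \<Longrightarrow> set r' \<subseteq> X \<Longrightarrow> word_prod (r @ r') = word_prod r \<otimes> word_prod r'"
  by (induction r) (auto simp: g_closed m_assoc)

lemma g_cancel:
  assumes "x \<in> X" "y \<in> carrier G"
  shows "g x \<otimes> (g x \<otimes> y) = y"
  using assms g_square[of x] by (simp add: g_closed m_assoc[symmetric])

lemma word_prod_rev: "set r \<subseteq> X \<Longrightarrow> word_prod (rev r) \<otimes> word_prod r = \<one>"
proof (induction r)
  case (Cons x r)
  then have x: "x \<in> X" "g x \<in> carrier G" and r: "set r \<subseteq> X" by (auto simp: g_closed)
  have "word_prod (rev (x # r)) \<otimes> word_prod (x # r)
      = word_prod (rev r) \<otimes> (g x \<otimes> (g x \<otimes> word_prod r))"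
    using x r by (simp add: word_prod_append m_assoc)
  then show ?case using Cons.IH[OF r] g_cancel[OF x(1), of "word_prod r"] r by simp
qed simp

text \<open>Forgetting the exponents by \<open>map snd\<close> is legitimate because
  \<open>g x\<close> is its own inverse.\<close>

lemma word_prod_cong:
  assumes "(u, v) \<in> involution_cong X"
  shows "word_prod (map snd u) = word_prod (map snd v)"
  using assms
proof (induction rule: word_congruence.induct)
  case (wc_cancel u v x e)
  then have "set (map snd u) \<subseteq> X" "set (map snd v) \<subseteq> X" by (auto simp: group_words_def)
  then show ?case using wc_cancel(3) by (simp add: word_prod_append g_cancel)
next
  case (wc_relator u v r)
  then have "set (map snd u) \<subseteq> X" "set (map snd v) \<subseteq> X" by (auto simp: group_words_def)
  then show ?case using wc_relator(3) by (auto simp: word_prod_append g_cancel)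
qed auto

definition class_prod :: "'b group_word set \<Rightarrow> 'a" where
  "class_prod U = word_prod (map snd (SOME u. u \<in> U))"

lemma class_prod_class:
  assumes "u \<in> group_words X"
  shows "class_prod (involution_class X u) = word_prod (map snd u)"
proof -
  have "u \<in> involution_class X u" using assms by (simp add: involution_class_def wc_refl)
  then have "(SOME u'. u' \<in> involution_class X u) \<in> involution_class X u" by (rule someI)
  then have "(u, SOME u'. u' \<in> involution_class X u) \<in> involution_cong X"
    by (simp add: involution_class_def)
  then show ?thesis unfolding class_prod_def by (rule word_prod_cong[symmetric])
qed

text \<open>Equal first letters are cancelled. If the first letters differ,
  \<open>rev r' @ r\<close> is still reduced and has trivial product, which \<open>faithful\<close>
  excludes.\<close>

lemma word_prod_unique:
  assumes faithful: "\<And>r. distinct_adj r \<Longrightarrow> set r \<subseteq> X \<Longrightarrow> word_prod r = \<one> \<Longrightarrow> r = []"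
    and "distinct_adj r" "set r \<subseteq> X" "distinct_adj r'" "set r' \<subseteq> X" "word_prod r = word_prod r'"
  shows "r = r'"
  using assms(2-)
proof (induction r arbitrary: r')
  case Nil
  then show ?case using faithful[of r'] by simp
next
  case (Cons x r)
  show ?case
  proof (cases r')
    case Nil
    then show ?thesis using Cons.prems faithful[of "x # r"] by simp
  next
    case (Cons y s)
    show ?thesis
    proof (cases "x = y")
      case True
      have "word_prod r = word_prod s"
        using Cons.prems Cons True by (metis g_cancel list.set_intros(1) set_subset_Cons subset_code(1)
            subset_trans word_prod_closed word_prod_simps(2))
      then show ?thesis using Cons.IH[of s] Cons.prems Cons True by (auto dest: distinct_adj_ConsD)
    next
      case False
      have "last (rev r') \<noteq> x" using Cons False by simp
      then have "distinct_adj (rev r' @ x # r)"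
        using Cons.prems(1,3) by (subst distinct_adj_append_iff) simp
      moreover have "word_prod (rev r' @ x # r) = \<one>"
        using Cons.prems word_prod_rev[of r'] word_prod_append[of "rev r'" "x # r"] by simp
      ultimately show ?thesis using faithful[of "rev r' @ x # r"] Cons.prems by simp
    qed
  qed
qed

lemma word_prod_reduced:
  assumes "set r \<subseteq> X"
  obtains r' where "distinct_adj r'" "set r' \<subseteq> X" "word_prod r' = word_prod r"
proof -
  have "map (Pair True) r \<in> group_words X" using assms by (auto simp: group_words_def)
  then obtain r' where "distinct_adj r'" "set r' \<subseteq> X"
    "(map (Pair True) r, map (Pair True) r') \<in> involution_cong X"
    by (rule involution_cong_reduced)
  then show ?thesis using that[of r'] word_prod_cong[of "map (Pair True) r" "map (Pair True) r'"]
    by (simp add: comp_def)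
qed

text \<open>\<open>G\<close> is recognized as an internal semidirect product: \<open>conj\<close>
  makes the products of a word and an \<open>h s\<close> multiply as pairs do, \<open>gen\<close>
  gives surjectivity, and \<open>faithful\<close> covers both the absence of relations between the
  involutions and the trivial intersection of the two factors.\<close>

lemma semidirect_iso:
  assumes H: "group H" and h: "h \<in> hom H G"
    and act: "\<And>s. s \<in> carrier H \<Longrightarrow> bij_betw (act s) X X"
    and conj: "\<And>s x. s \<in> carrier H \<Longrightarrow> x \<in> X \<Longrightarrow> h s \<otimes> g x = g (act s x) \<otimes> h s"
    and faithful: "\<And>r s. distinct_adj r \<Longrightarrow> set r \<subseteq> X \<Longrightarrow> s \<in> carrier H \<Longrightarrow>
      word_prod r \<otimes> h s = \<one> \<Longrightarrow> r = [] \<and> s = \<one>\<^bsub>H\<^esub>"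
    and gen: "\<And>y. y \<in> carrier G \<Longrightarrow> \<exists>r s. set r \<subseteq> X \<and> s \<in> carrier H \<and> y = word_prod r \<otimes> h s"
  shows "G \<cong> semidirect_product (involution_group X) H (\<lambda>s. relabel_generators (act s))"
proof -
  interpret H: group H by (rule H)
  interpret h: group_hom H G h
    using H h group_axioms by (simp add: group_hom_def group_hom_axioms_def)
  let ?N = "semidirect_product (involution_group X) H (\<lambda>s. relabel_generators (act s))"
  let ?f = "\<lambda>(U, s). class_prod U \<otimes> h s"
  let ?m = "\<lambda>s. map (map_prod id (act s))"
  have car: "carrier ?N = involution_class X ` group_words X \<times> carrier H"
    by (simp add: semidirect_product_def carrier_involution_group)
  have set: "set (map snd u) \<subseteq> X" if "u \<in> group_words X" for u
    using that by (auto simp: group_words_def)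
  have wc: "word_prod (map snd u) \<in> carrier G" if "u \<in> group_words X" for u
    using set[OF that] by (rule word_prod_closed)
  note map_map [simp del]
  have mw: "?m s u \<in> group_words X" if "s \<in> carrier H" "u \<in> group_words X" for s u
    using that(2) act[OF that(1)] by (induction u) (auto simp: bij_betw_def)
  have mult: "(involution_class X u, s) \<otimes>\<^bsub>?N\<^esub> (involution_class X v, t)
      = (involution_class X (u @ ?m s v), s \<otimes>\<^bsub>H\<^esub> t)"
    if "u \<in> group_words X" "v \<in> group_words X" "s \<in> carrier H" for u v s t
    using that mw relabel_involution_class[OF act, of s v] mult_involution_group[of u X "?m s v"]
    by (simp add: semidirect_product_def)
  \<comment> \<open>\<open>h s\<close> moves past a word by acting on each of its letters.\<close>
  have hw: "h s \<otimes> word_prod (map snd u) = word_prod (map snd (?m s u)) \<otimes> h s"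
    if s: "s \<in> carrier H" and "u \<in> group_words X" for s u
    using that(2)
  proof (induction u)
    case (Cons p u)
    then have p: "snd p \<in> X" and u: "u \<in> group_words X" by auto
    have a: "act s (snd p) \<in> X" using act[OF s] p by (auto simp: bij_betw_def)
    have "h s \<otimes> word_prod (map snd (p # u)) = (h s \<otimes> g (snd p)) \<otimes> word_prod (map snd u)"
      using p s wc[OF u] by (simp add: g_closed m_assoc)
    also have "\<dots> = g (act s (snd p)) \<otimes> (h s \<otimes> word_prod (map snd u))"
      using p s a wc[OF u] by (simp add: conj g_closed m_assoc)
    also have "\<dots> = g (act s (snd p)) \<otimes> (word_prod (map snd (?m s u)) \<otimes> h s)"
      by (simp only: Cons.IH[OF u])
    also have "\<dots> = g (act s (snd p)) \<otimes> word_prod (map snd (?m s u)) \<otimes> h s"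
      by (rule m_assoc[OF g_closed[OF a] wc[OF mw[OF s u]] h.hom_closed[OF s], symmetric])
    also have "\<dots> = word_prod (map snd (?m s (p # u))) \<otimes> h s" by (cases p) simp
    finally show ?case .
  qed (use s in simp)
  have hom: "?f \<in> hom ?N G"
  proof (rule homI)
    fix x assume "x \<in> carrier ?N"
    then show "?f x \<in> carrier G" unfolding car by (auto simp: class_prod_class wc)
  next
    fix x y assume "x \<in> carrier ?N" "y \<in> carrier ?N"
    then obtain u s v t where x: "x = (involution_class X u, s)" "u \<in> group_words X" "s \<in> carrier H"
      and y: "y = (involution_class X v, t)" "v \<in> group_words X" "t \<in> carrier H"
      unfolding car by auto
    have "?f (x \<otimes>\<^bsub>?N\<^esub> y) = word_prod (map snd u @ map snd (?m s v)) \<otimes> (h s \<otimes> h t)"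
      using x y mw by (simp add: mult class_prod_class)
    also have "\<dots> = word_prod (map snd u) \<otimes> (word_prod (map snd (?m s v)) \<otimes> h s) \<otimes> h t"
      using word_prod_append[OF set[OF x(2)] set[OF mw[OF x(3) y(2)]]] x y wc mw
      by (simp add: m_assoc)
    also have "\<dots> = word_prod (map snd u) \<otimes> (h s \<otimes> word_prod (map snd v)) \<otimes> h t"
      using hw[OF x(3) y(2)] by simp
    also have "\<dots> = ?f x \<otimes> ?f y" using x y wc by (simp add: class_prod_class m_assoc)
    finally show "?f (x \<otimes>\<^bsub>?N\<^esub> y) = ?f x \<otimes> ?f y" .
  qed
  have "inj_on ?f (carrier ?N)"
  proof (rule inj_onI)
    fix x y assume xy: "x \<in> carrier ?N" "y \<in> carrier ?N" and eq: "?f x = ?f y"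
    then obtain u s v t where x: "x = (involution_class X u, s)" "u \<in> group_words X" "s \<in> carrier H"
      and y: "y = (involution_class X v, t)" "v \<in> group_words X" "t \<in> carrier H"
      unfolding car by auto
    obtain r where r: "distinct_adj r" "set r \<subseteq> X" "(u, map (Pair True) r) \<in> involution_cong X"
      using involution_cong_reduced[OF x(2)] .
    obtain q where q: "distinct_adj q" "set q \<subseteq> X" "(v, map (Pair True) q) \<in> involution_cong X"
      using involution_cong_reduced[OF y(2)] .
    have "?f x = word_prod r \<otimes> h s" "?f y = word_prod q \<otimes> h t"
      using x y word_prod_cong[OF r(3)] word_prod_cong[OF q(3)]
      by (simp_all add: class_prod_class map_map comp_def)
    then have rq: "word_prod r \<otimes> h s = word_prod q \<otimes> h t" using eq by simp
    have cl: "word_prod r \<in> carrier G" "word_prod q \<in> carrier G" "word_prod (rev q) \<in> carrier G"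
      using r q by auto
    \<comment> \<open>\<open>faithful\<close> speaks of reduced words, so the quotient of the two
      sides is written with a reduced form of \<open>rev q @ r\<close>.\<close>
    obtain p where p: "distinct_adj p" "set p \<subseteq> X" "word_prod p = word_prod (rev q @ r)"
      using word_prod_reduced[of "rev q @ r"] r q by auto
    have "word_prod p \<otimes> h (s \<otimes>\<^bsub>H\<^esub> inv\<^bsub>H\<^esub> t) = word_prod (rev q) \<otimes> (word_prod r \<otimes> h s) \<otimes> inv (h t)"
      using p r q x y cl word_prod_append[of "rev q" r] by (simp add: m_assoc)
    also have "\<dots> = (word_prod (rev q) \<otimes> word_prod q) \<otimes> (h t \<otimes> inv (h t))"
      unfolding rq using y cl by (simp add: m_assoc)
    also have "\<dots> = \<one>" using word_prod_rev[OF q(2)] y by simp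
    finally have "s \<otimes>\<^bsub>H\<^esub> inv\<^bsub>H\<^esub> t = \<one>\<^bsub>H\<^esub>" using faithful[OF p(1,2)] x y by simp
    then have st: "s = t" using x y by (metis H.inv_closed H.inv_equality H.inv_inv)
    then have "word_prod r = word_prod q" using rq cl x by simp
    moreover have "r = []" if "distinct_adj r" "set r \<subseteq> X" "word_prod r = \<one>" for r
      using faithful[OF that(1,2), of "\<one>\<^bsub>H\<^esub>"] that(3) by simp
    ultimately have "r = q" using word_prod_unique[OF _ r(1,2) q(1,2)] by blast
    then have "(u, v) \<in> involution_cong X" using r(3) q(3) by (blast intro: wc_trans wc_sym)
    then show "x = y" using involution_class_eq_iff[OF x(2)] st x y by simp
  qed
  moreover have "?f ` carrier ?N = carrier G"
  proof
    show "?f ` carrier ?N \<subseteq> carrier G" by (rule image_subsetI) (rule hom_in_carrier[OF hom])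
    show "carrier G \<subseteq> ?f ` carrier ?N"
    proof
      fix y assume "y \<in> carrier G"
      then obtain r s where r: "set r \<subseteq> X" "s \<in> carrier H" "y = word_prod r \<otimes> h s" using gen by blast
      have w: "map (Pair True) r \<in> group_words X" using r(1) by (auto simp: group_words_def)
      then have "y = ?f (involution_class X (map (Pair True) r), s)"
        using r by (simp add: class_prod_class map_map comp_def)
      then show "y \<in> ?f ` carrier ?N" using w r(2) unfolding car by blast
    qed
  qed
  ultimately have bij: "bij_betw ?f (carrier ?N) (carrier G)" by (simp add: bij_betw_def)
  show ?thesis
  proof (rule iso_from_closed[OF hom bij])
    fix x y assume "x \<in> carrier ?N" "y \<in> carrier ?N"
    then obtain u s v t where x: "x = (involution_class X u, s)" "u \<in> group_words X" "s \<in> carrier H"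
      and y: "y = (involution_class X v, t)" "v \<in> group_words X" "t \<in> carrier H"
      unfolding car by auto
    then show "x \<otimes>\<^bsub>?N\<^esub> y \<in> carrier ?N" using mult mw unfolding car by auto
  qed
qed

text \<open>The same criterion without a second factor, so that the result is the presented group
  itself rather than a product with a trivial group.\<close>

lemma involution_group_iso:
  assumes faithful: "\<And>r. distinct_adj r \<Longrightarrow> set r \<subseteq> X \<Longrightarrow> word_prod r = \<one> \<Longrightarrow> r = []"
    and gen: "\<And>y. y \<in> carrier G \<Longrightarrow> \<exists>r. set r \<subseteq> X \<and> y = word_prod r"
  shows "G \<cong> involution_group X"
proof -
  have hom: "class_prod \<in> hom (involution_group X) G"
  proof (rule homI)
    fix U V assume "U \<in> carrier (involution_group X)" "V \<in> carrier (involution_group X)"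
    then obtain u v where U: "U = involution_class X u" "u \<in> group_words X"
      and V: "V = involution_class X v" "v \<in> group_words X"
      unfolding carrier_involution_group by auto
    have s: "set (map snd u) \<subseteq> X" "set (map snd v) \<subseteq> X" using U V by (auto simp: group_words_def)
    show "class_prod (U \<otimes>\<^bsub>involution_group X\<^esub> V) = class_prod U \<otimes> class_prod V"
      using U V by (simp add: mult_involution_group class_prod_class word_prod_append[OF s])
  next
    fix U assume "U \<in> carrier (involution_group X)"
    then obtain u where U: "U = involution_class X u" "u \<in> group_words X"
      unfolding carrier_involution_group by auto
    then have s: "set (map snd u) \<subseteq> X" by (auto simp: group_words_def)
    then show "class_prod U \<in> carrier G" using U word_prod_closed[OF s] by (simp add: class_prod_class)
  qed
  have "inj_on class_prod (carrier (involution_group X))"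
  proof (rule inj_onI)
    fix U V assume UV: "U \<in> carrier (involution_group X)" "V \<in> carrier (involution_group X)"
      and eq: "class_prod U = class_prod V"
    then obtain u v where U: "U = involution_class X u" "u \<in> group_words X"
      and V: "V = involution_class X v" "v \<in> group_words X"
      unfolding carrier_involution_group by auto
    obtain r where r: "distinct_adj r" "set r \<subseteq> X" "(u, map (Pair True) r) \<in> involution_cong X"
      using involution_cong_reduced[OF U(2)] .
    obtain q where q: "distinct_adj q" "set q \<subseteq> X" "(v, map (Pair True) q) \<in> involution_cong X"
      using involution_cong_reduced[OF V(2)] .
    have "word_prod r = word_prod q"
      using eq U V word_prod_cong[OF r(3)] word_prod_cong[OF q(3)]
      by (simp add: class_prod_class comp_def)
    then have "r = q" using word_prod_unique[OF faithful r(1,2) q(1,2)] by blast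
    then have "(u, v) \<in> involution_cong X" using r(3) q(3) by (blast intro: wc_trans wc_sym)
    then show "U = V" using involution_class_eq_iff[OF U(2)] U V by simp
  qed
  moreover have "class_prod ` carrier (involution_group X) = carrier G"
  proof
    show "class_prod ` carrier (involution_group X) \<subseteq> carrier G" using hom by (auto simp: hom_def)
    show "carrier G \<subseteq> class_prod ` carrier (involution_group X)"
    proof
      fix y assume "y \<in> carrier G"
      then obtain r where r: "set r \<subseteq> X" "y = word_prod r" using gen by blast
      have w: "map (Pair True) r \<in> group_words X" using r(1) by (auto simp: group_words_def)
      then have "y = class_prod (involution_class X (map (Pair True) r))"
        using r by (simp add: class_prod_class comp_def)
      then show "y \<in> class_prod ` carrier (involution_group X)"
        using w unfolding carrier_involution_group by blast
    qed
  qed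
  ultimately have bij: "bij_betw class_prod (carrier (involution_group X)) (carrier G)"
    by (simp add: bij_betw_def)
  show ?thesis
  proof (rule iso_from_closed[OF hom bij])
    fix U V assume "U \<in> carrier (involution_group X)" "V \<in> carrier (involution_group X)"
    then show "U \<otimes>\<^bsub>involution_group X\<^esub> V \<in> carrier (involution_group X)"
      unfolding carrier_involution_group by (auto simp: mult_involution_group)
  qed
qed

end


section \<open>The automorphism group of a cyclic pattern\<close>

context cyclic_pattern
begin

definition Aut :: "('f \<Rightarrow> 'f) monoid" where
  "Aut = BijGroup A \<lparr>carrier := {f. aut f}\<rparr>"

definition stable :: "3 set" where
  "stable = {k. mutate_weights k W0 = W0}"

text \<open>A transposition reverses the 3-cycle; it still counts as soon as it preserves the
  weights and \<open>d\<close>.\<close>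

definition symmetries :: "(3 \<Rightarrow> 3) set" where
  "symmetries = {\<sigma>. matches \<sigma> [] []}"

definition seed_aut :: "3 list \<Rightarrow> (3 \<Rightarrow> 3) \<Rightarrow> 'f \<Rightarrow> 'f" where
  "seed_aut w \<sigma> = (THE f. aut f \<and> carries f \<sigma> [] w)"

lemma aut_subring: "aut f \<Longrightarrow> subring_automorphism A f"
  by (simp add: aut_def)

lemma seed_aut:
  assumes "matches \<sigma> [] w"
  shows "aut (seed_aut w \<sigma>)" "carries (seed_aut w \<sigma>) \<sigma> [] w"
proof -
  have "\<exists>!f. aut f \<and> carries f \<sigma> [] w"
    using aut_exists[OF assms] aut_unique[OF aut_subring aut_subring assms] by metis
  from theI'[OF this] show "aut (seed_aut w \<sigma>)" "carries (seed_aut w \<sigma>) \<sigma> [] w"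
    by (auto simp: seed_aut_def)
qed

lemma seed_aut_eqI:
  assumes "subring_automorphism A f" "matches \<sigma> [] w" "carries f \<sigma> [] w"
  shows "f = seed_aut w \<sigma>"
  using aut_unique[OF assms(1) aut_subring[OF seed_aut(1)] assms(2,3) seed_aut(2)] assms(2) by blast

lemma seed_aut_cong:
  assumes "matches \<sigma> [] w" "S w = S v" "Wt w = Wt v"
  shows "seed_aut w \<sigma> = seed_aut v \<sigma>"
proof (rule seed_aut_eqI)
  show "subring_automorphism A (seed_aut w \<sigma>)" using seed_aut(1)[OF assms(1)] by (rule aut_subring)
  show "matches \<sigma> [] v" using assms by (simp add: matches_def)
  show "carries (seed_aut w \<sigma>) \<sigma> [] v" using seed_aut(2)[OF assms(1)] assms(2) by (simp add: carries_def)
qed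

lemma aut_cases:
  assumes "aut f"
  obtains w \<sigma> where "distinct_adj w" "matches \<sigma> [] w" "f = seed_aut w \<sigma>"
proof -
  obtain w \<sigma> where w: "matches \<sigma> [] w" "carries f \<sigma> [] w" using assms by (auto simp: aut_def)
  obtain v where v: "distinct_adj v" "S v = S w" "Wt v = Wt w" by (rule reduced_word)
  have "matches \<sigma> [] v" "carries f \<sigma> [] v" using w v by (simp_all add: matches_def carries_def)
  then show ?thesis using that[OF v(1)] seed_aut_eqI[OF aut_subring[OF assms]] by blast
qed

lemma matches_comp:
  assumes "matches \<sigma> [] w" "matches \<tau> [] v"
  shows "matches (\<sigma> \<circ> \<tau>) [] (map \<sigma> v @ w)"
proof -
  have "matches \<sigma> v (map \<sigma> v @ w)" using matches_append[OF assms(1), of v] by simp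
  then show ?thesis using assms(2) unfolding matches_def
    by (auto simp: bij_comp comp_assoc[symmetric])
qed

text \<open>First \<open>seed_aut v \<tau>\<close> moves the root to \<open>v\<close>; then
  \<open>seed_aut w \<sigma>\<close> translates that path, so the root ends at
  \<open>map \<sigma> v @ w\<close>. The twist by \<sigma> is the origin of the semidirect
  products.\<close>

lemma compose_seed_aut:
  assumes "matches \<sigma> [] w" "matches \<tau> [] v"
  shows "compose A (seed_aut w \<sigma>) (seed_aut v \<tau>) = seed_aut (map \<sigma> v @ w) (\<sigma> \<circ> \<tau>)"
proof (rule seed_aut_eqI[OF _ matches_comp[OF assms]])
  let ?f = "seed_aut w \<sigma>" and ?g = "seed_aut v \<tau>"
  have f: "subring_automorphism A ?f" and g: "subring_automorphism A ?g"
    using seed_aut(1) assms by (auto intro: aut_subring)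
  then have B: "?f \<in> Bij A" "?g \<in> Bij A" by (auto simp: subring_automorphism_def)
  have gA: "?g x \<in> A" if "x \<in> A" for x using B(2) that Bij_imp_funcset by (auto simp: Pi_def)
  have "compose A ?f ?g \<in> Bij A" using B by (rule compose_Bij)
  then show "subring_automorphism A (compose A ?f ?g)"
    using f g gA is_subring_closed[OF A_subring]
    unfolding subring_automorphism_def by (auto simp: compose_def)
  have "carries ?f \<sigma> v (map \<sigma> v @ w)"
    using carries_append[OF A_subring subring_automorphism_hom_on[OF f] X_in_A assms(1) seed_aut(2)[OF assms(1)], of v]
    by simp
  then show "carries (compose A ?f ?g) (\<sigma> \<circ> \<tau>) [] (map \<sigma> v @ w)"
    using seed_aut(2)[OF assms(2)] X_in_A[of "[]"] by (simp add: carries_def compose_def)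
qed

lemma matches_id [simp]: "matches id [] []" "matches (\<lambda>i. i) [] []"
  by (simp_all add: matches_def comp_def bij_id[unfolded id_def])

lemma seed_aut_one: "seed_aut [] id = (\<lambda>x\<in>A. x)"
proof (rule seed_aut_eqI[symmetric])
  show "subring_automorphism A (\<lambda>x\<in>A. x)"
    using id_Bij[of A] is_subring_closed[OF A_subring] by (auto simp: subring_automorphism_def)
  show "carries (\<lambda>x\<in>A. x) id [] []" using X_in_A[of "[]"] by (simp add: carries_def)
qed simp

lemma carrier_Aut: "f \<in> carrier Aut \<longleftrightarrow> aut f"
  by (simp add: Aut_def)

lemma one_Aut: "\<one>\<^bsub>Aut\<^esub> = seed_aut [] id"
  by (simp add: Aut_def BijGroup_def seed_aut_one)

lemma mult_Aut:
  assumes "matches \<sigma> [] w" "matches \<tau> [] v"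
  shows "seed_aut w \<sigma> \<otimes>\<^bsub>Aut\<^esub> seed_aut v \<tau> = seed_aut (map \<sigma> v @ w) (\<sigma> \<circ> \<tau>)"
proof -
  have "seed_aut w \<sigma> \<in> Bij A" "seed_aut v \<tau> \<in> Bij A"
    using aut_subring[OF seed_aut(1)] assms by (auto simp: subring_automorphism_def)
  then show ?thesis using compose_seed_aut[OF assms] by (simp add: Aut_def BijGroup_def)
qed

lemma group_Aut: "group Aut"
proof (rule groupI)
  show "\<one>\<^bsub>Aut\<^esub> \<in> carrier Aut" using seed_aut(1)[of id "[]"] by (simp add: carrier_Aut one_Aut)
next
  fix f g assume "f \<in> carrier Aut" "g \<in> carrier Aut"
  then obtain w \<sigma> v \<tau> where f: "matches \<sigma> [] w" "f = seed_aut w \<sigma>"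
    and g: "matches \<tau> [] v" "g = seed_aut v \<tau>" by (metis carrier_Aut aut_cases)
  show fg: "f \<otimes>\<^bsub>Aut\<^esub> g \<in> carrier Aut"
    unfolding f(2) g(2) mult_Aut[OF f(1) g(1)] carrier_Aut
    by (rule seed_aut(1)[OF matches_comp[OF f(1) g(1)]])
  fix h assume "h \<in> carrier Aut"
  then obtain u \<rho> where h: "matches \<rho> [] u" "h = seed_aut u \<rho>" by (metis carrier_Aut aut_cases)
  show "f \<otimes>\<^bsub>Aut\<^esub> g \<otimes>\<^bsub>Aut\<^esub> h = f \<otimes>\<^bsub>Aut\<^esub> (g \<otimes>\<^bsub>Aut\<^esub> h)"
    unfolding f(2) g(2) h(2) mult_Aut[OF f(1) g(1)] mult_Aut[OF g(1) h(1)]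
      mult_Aut[OF matches_comp[OF f(1) g(1)] h(1)] mult_Aut[OF f(1) matches_comp[OF g(1) h(1)]]
    by (simp add: comp_assoc)
next
  fix f assume "f \<in> carrier Aut"
  then obtain w \<sigma> where f: "matches \<sigma> [] w" "f = seed_aut w \<sigma>" by (metis carrier_Aut aut_cases)
  show "\<one>\<^bsub>Aut\<^esub> \<otimes>\<^bsub>Aut\<^esub> f = f"
    unfolding one_Aut f(2) mult_Aut[OF matches_id(1) f(1)] by simp
  let ?\<tau> = "inv_into UNIV \<sigma>"
  \<comment> \<open>The inverse follows the way from \<open>w\<close> back to the root, read in the
    labels of the source.\<close>
  let ?v = "map ?\<tau> (rev w)"
  have \<sigma>: "bij \<sigma>" "Wt w \<circ> \<sigma> = W0" "\<And>i. d $ \<sigma> i = d $ i" using f(1) by (auto simp: matches_def)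
  have \<tau>: "bij ?\<tau>" "?\<tau> \<circ> \<sigma> = id" "\<And>i. \<sigma> (?\<tau> i) = i"
    using \<sigma>(1) by (auto simp: bij_imp_bij_inv bij_is_inj bij_is_surj surj_f_inv_f)
  have mv: "matches ?\<tau> [] ?v"
    unfolding matches_def
  proof (intro conjI allI)
    show "d $ ?\<tau> i = d $ i" for i using \<sigma>(3)[of "?\<tau> i"] \<tau>(3) by simp
    have "W0 (?\<tau> i) = Wt w i" for i using fun_cong[OF \<sigma>(2), of "?\<tau> i"] by (simp add: \<tau>(3))
    then have "W0 \<circ> ?\<tau> = Wt w" by auto
    then have "Wt ?v \<circ> ?\<tau> = weights_at (Wt w) (rev w)" using weights_at_bij[OF \<tau>(1)] by metis
    then show "Wt ?v \<circ> ?\<tau> = Wt []" using Wt_rev[of w "[]"] by simp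
  qed (rule \<tau>(1))
  have id: "matches id [] (map ?\<tau> w @ ?v)" using matches_comp[OF mv f(1)] \<tau>(2) by simp
  have S: "S (map ?\<tau> w @ ?v) = S []"
    using S_rev'[of "map ?\<tau> w" "[]"] by (simp add: rev_map)
  have W: "Wt (map ?\<tau> w @ ?v) = Wt []"
    using Wt_rev[of "rev (map ?\<tau> w)" "[]"] by (simp add: rev_map)
  have "seed_aut ?v ?\<tau> \<otimes>\<^bsub>Aut\<^esub> f = \<one>\<^bsub>Aut\<^esub>"
    unfolding f(2) mult_Aut[OF mv f(1)] \<tau>(2) one_Aut by (rule seed_aut_cong[OF id S W])
  then show "\<exists>y\<in>carrier Aut. y \<otimes>\<^bsub>Aut\<^esub> f = \<one>\<^bsub>Aut\<^esub>"
    using seed_aut(1)[OF mv] by (auto simp: carrier_Aut)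
qed

section \<open>Stable words and symmetries\<close>

lemma Wt_stable: "set w \<subseteq> stable \<Longrightarrow> Wt w = W0"
  by (induction w) (auto simp: stable_def)

lemma matches_stable:
  assumes "set w \<subseteq> stable" "\<sigma> \<in> symmetries"
  shows "matches \<sigma> [] w"
  using assms Wt_stable by (simp add: symmetries_def matches_def)

text \<open>Summing \<open>Wt w \<circ> \<sigma> = W0\<close> over the labels removes \<sigma> and
  leaves equal totals, which is the case settled by \<open>weights_at_sum_eq\<close>.\<close>

lemma matches_reduced:
  assumes "matches \<sigma> [] w" "distinct_adj w"
  shows "set w \<subseteq> stable" "\<sigma> \<in> symmetries"
proof -
  have \<sigma>: "bij \<sigma>" "Wt w \<circ> \<sigma> = W0" using assms by (auto simp: matches_def)
  have "sum (Wt w) UNIV = sum W0 UNIV"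
    using sum.reindex_bij_betw[OF \<sigma>(1), of "Wt w"] fun_cong[OF \<sigma>(2)] by simp
  then have *: "Wt w = W0 \<and> (\<forall>k\<in>set w. mutate_weights k W0 = W0)"
    by (rule weights_at_sum_eq[OF minimal assms(2)])
  show "set w \<subseteq> stable" using * by (auto simp: stable_def)
  show "\<sigma> \<in> symmetries" using assms(1) * by (simp add: symmetries_def matches_def)
qed

lemma symmetries_stable: "\<sigma> \<in> symmetries \<Longrightarrow> k \<in> stable \<Longrightarrow> \<sigma> k \<in> stable"
proof -
  assume "\<sigma> \<in> symmetries" and k: "k \<in> stable"
  then have \<sigma>: "bij \<sigma>" "W0 \<circ> \<sigma> = W0" by (auto simp: symmetries_def matches_def)
  have "mutate_weights (\<sigma> k) W0 \<circ> \<sigma> = W0 \<circ> \<sigma>"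
    using mutate_weights_bij[OF \<sigma>(1), of k W0] k \<sigma>(2) by (simp add: stable_def)
  then have "mutate_weights (\<sigma> k) W0 = W0"
    using bij_is_surj[OF \<sigma>(1)] by (metis comp_assoc comp_id surj_iff)
  then show ?thesis by (simp add: stable_def)
qed

lemma Aut_cases:
  assumes "f \<in> carrier Aut"
  obtains w \<sigma> where "distinct_adj w" "set w \<subseteq> stable" "\<sigma> \<in> symmetries" "f = seed_aut w \<sigma>"
  using assms unfolding carrier_Aut by (metis aut_cases matches_reduced)

lemma seed_aut_carrier:
  "set w \<subseteq> stable \<Longrightarrow> \<sigma> \<in> symmetries \<Longrightarrow> seed_aut w \<sigma> \<in> carrier Aut"
  using seed_aut(1)[OF matches_stable] by (simp add: carrier_Aut)

text \<open>The identity fixes the initial cluster, so \<open>reduced_word_moves_cluster\<close>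
  empties the word; since the variables are distinct, only the identity permutation is left.\<close>

lemma seed_aut_faithful:
  assumes "distinct_adj w" "set w \<subseteq> stable" "\<sigma> \<in> symmetries" "seed_aut w \<sigma> = \<one>\<^bsub>Aut\<^esub>"
  shows "w = []" "\<sigma> = id"
proof -
  have "carries (seed_aut w \<sigma>) \<sigma> [] w" using seed_aut(2)[OF matches_stable[OF assms(2,3)]] .
  then have X: "X w $ \<sigma> i = x0 $ i" for i
    using X_in_A[of "[]" i] unfolding assms(4) one_Aut seed_aut_one carries_def
    by (metis foldr.simps(1) fst_conv id_apply restrict_apply')
  have "bij \<sigma>" using assms(3) by (simp add: symmetries_def matches_def)
  then show w: "w = []" using reduced_word_moves_cluster[OF assms(1) X] by blast
  have "\<sigma> i = i" for i using X[of i] X_inj[of "[]" "\<sigma> i" i] unfolding w by simp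
  then show "\<sigma> = id" by auto
qed

lemma id_symmetries [simp]: "id \<in> symmetries"
  by (simp add: symmetries_def)

lemma mult_stable:
  assumes "set w \<subseteq> stable" "\<sigma> \<in> symmetries" "set v \<subseteq> stable" "\<tau> \<in> symmetries"
  shows "seed_aut w \<sigma> \<otimes>\<^bsub>Aut\<^esub> seed_aut v \<tau> = seed_aut (map \<sigma> v @ w) (\<sigma> \<circ> \<tau>)"
  by (rule mult_Aut[OF matches_stable[OF assms(1,2)] matches_stable[OF assms(3,4)]])

lemma seed_aut_square:
  assumes "k \<in> stable"
  shows "seed_aut [k, k] id = seed_aut [] id"
proof (rule seed_aut_cong)
  show "matches id [] [k, k]" using assms by (intro matches_stable) auto
  show "S [k, k] = S []" by (rule involutive)
  show "Wt [k, k] = Wt []" using mutate_weights_involutive by simp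
qed

lemma mutation_family:
  assumes e: "e ` Y \<subseteq> stable"
  shows "involution_family Aut Y (\<lambda>x. seed_aut [e x] id)"
proof -
  interpret group Aut by (rule group_Aut)
  show ?thesis
  proof
    fix x assume "x \<in> Y"
    then have x: "set [e x] \<subseteq> stable" using e by auto
    then show "seed_aut [e x] id \<in> carrier Aut" by (intro seed_aut_carrier) auto
    show "seed_aut [e x] id \<otimes>\<^bsub>Aut\<^esub> seed_aut [e x] id = \<one>\<^bsub>Aut\<^esub>"
      using x mult_stable[of "[e x]" id "[e x]" id] seed_aut_square by (simp add: one_Aut)
  qed
qed

text \<open>By \<open>mult_stable\<close> the word of the right factor is put in front, hence the
  reversal.\<close>

lemma mutation_word_prod:
  assumes e: "e ` Y \<subseteq> stable" and "set r \<subseteq> Y"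
  shows "involution_family.word_prod Aut (\<lambda>x. seed_aut [e x] id) r = seed_aut (rev (map e r)) id"
proof -
  interpret involution_family Aut Y "\<lambda>x. seed_aut [e x] id" by (rule mutation_family[OF e])
  show ?thesis using assms(2)
  proof (induction r)
    case (Cons x r)
    then have "set (rev (map e r)) \<subseteq> stable" "set [e x] \<subseteq> stable" using e by auto
    then have m: "seed_aut [e x] id \<otimes>\<^bsub>Aut\<^esub> seed_aut (rev (map e r)) id = seed_aut (rev (map e (x # r))) id"
      using mult_stable[of "[e x]" id "rev (map e r)" id] by simp
    have "word_prod r = seed_aut (rev (map e r)) id" using Cons by (meson set_subset_Cons subset_trans)
    then show ?case using m by (simp only: word_prod_simps)
  qed (simp only: one_Aut word_prod_simps list.map rev.simps)
qed

text \<open>\<open>e\<close> names the stable labels by generators and \<open>p\<close> names the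
  symmetries by elements of \<open>H\<close>; the second part of \<open>act\<close> says that these
  names respect the action of symmetries on labels.\<close>

lemma Aut_iso_semidirect:
  assumes e: "bij_betw e Y stable" and H: "group H"
    and p: "bij_betw p (carrier H) symmetries"
      "\<And>s t. s \<in> carrier H \<Longrightarrow> t \<in> carrier H \<Longrightarrow> p (s \<otimes>\<^bsub>H\<^esub> t) = p s \<circ> p t"
    and act: "\<And>s. s \<in> carrier H \<Longrightarrow> bij_betw (act s) Y Y"
      "\<And>s x. s \<in> carrier H \<Longrightarrow> x \<in> Y \<Longrightarrow> e (act s x) = p s (e x)"
  shows "Aut \<cong> semidirect_product (involution_group Y) H (\<lambda>s. relabel_generators (act s))"
proof -
  have eY: "e ` Y \<subseteq> stable" and inj: "inj_on e Y" using e by (auto simp: bij_betw_def)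
  interpret involution_family Aut Y "\<lambda>x. seed_aut [e x] id" by (rule mutation_family[OF eY])
  interpret H: group H by (rule H)
  have p_sym: "p s \<in> symmetries" if "s \<in> carrier H" for s using p(1) that by (auto simp: bij_betw_def)
  \<comment> \<open>An injective idempotent map is the identity.\<close>
  have p1: "p \<one>\<^bsub>H\<^esub> = id"
  proof -
    have "bij (p \<one>\<^bsub>H\<^esub>)" using p_sym[of "\<one>\<^bsub>H\<^esub>"] by (auto simp: symmetries_def matches_def)
    moreover have "p \<one>\<^bsub>H\<^esub> \<circ> p \<one>\<^bsub>H\<^esub> = p \<one>\<^bsub>H\<^esub>" using p(2)[of "\<one>\<^bsub>H\<^esub>" "\<one>\<^bsub>H\<^esub>"] by simp
    ultimately show ?thesis by (metis bij_is_inj inj_iff comp_assoc id_comp)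
  qed
  have st: "set (rev (map e r)) \<subseteq> stable" if "set r \<subseteq> Y" for r using that eY by auto
  have prod: "word_prod r \<otimes>\<^bsub>Aut\<^esub> seed_aut [] (p s) = seed_aut (rev (map e r)) (p s)"
    if "set r \<subseteq> Y" "s \<in> carrier H" for r s
    using mult_stable[OF st[OF that(1)] id_symmetries, of "[]" "p s"] p_sym[OF that(2)]
      mutation_word_prod[OF eY that(1)] by simp
  show ?thesis
  proof (rule semidirect_iso[where h = "\<lambda>s. seed_aut [] (p s)"])
    show "(\<lambda>s. seed_aut [] (p s)) \<in> hom H Aut"
      by (rule homI) (simp_all add: seed_aut_carrier p_sym p(2) mult_stable)
    show "seed_aut [] (p s) \<otimes>\<^bsub>Aut\<^esub> seed_aut [e x] id = seed_aut [e (act s x)] id \<otimes>\<^bsub>Aut\<^esub> seed_aut [] (p s)"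
      if "s \<in> carrier H" "x \<in> Y" for s x
    proof -
      have "{e x} \<subseteq> stable" "{p s (e x)} \<subseteq> stable"
        using eY that symmetries_stable[OF p_sym[OF that(1)]] by auto
      then show ?thesis using that p_sym[OF that(1)] act(2)[OF that] by (simp add: mult_stable)
    qed
    show "r = [] \<and> s = \<one>\<^bsub>H\<^esub>"
      if r: "distinct_adj r" "set r \<subseteq> Y" and s: "s \<in> carrier H"
        and eq: "word_prod r \<otimes>\<^bsub>Aut\<^esub> seed_aut [] (p s) = \<one>\<^bsub>Aut\<^esub>" for r s
    proof -
      have "distinct_adj (map e r)" using r inj by (intro distinct_adj_mapI) (auto intro: inj_on_subset)
      then have d: "distinct_adj (rev (map e r))" by simp
      have "rev (map e r) = []" "p s = id"
        using seed_aut_faithful[OF d st[OF r(2)] p_sym[OF s]] eq prod[OF r(2) s] by auto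
      then show ?thesis using p(1) p1 s by (auto simp: bij_betw_def inj_on_def)
    qed
    show "\<exists>r s. set r \<subseteq> Y \<and> s \<in> carrier H \<and> f = word_prod r \<otimes>\<^bsub>Aut\<^esub> seed_aut [] (p s)"
      if f: "f \<in> carrier Aut" for f
    proof -
      obtain w \<sigma> where w: "set w \<subseteq> stable" "\<sigma> \<in> symmetries" "f = seed_aut w \<sigma>"
        using Aut_cases[OF f] by metis
      obtain s where s: "s \<in> carrier H" "\<sigma> = p s" using p(1) w(2) by (auto simp: bij_betw_def)
      let ?r = "rev (map (inv_into Y e) w)"
      have r: "set ?r \<subseteq> Y" using w(1) bij_betw_inv_into[OF e] by (auto simp: bij_betw_def)
      have "map e (map (inv_into Y e) w) = w"
        using w(1) bij_betw_inv_into_right[OF e] by (auto intro!: map_idI)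
      then have "rev (map e ?r) = w" by (simp add: rev_map)
      then show ?thesis using prod[OF r s(1)] r s w(3) by metis
    qed
  qed (use H act(1) in auto)
qed

lemma Aut_iso_involution_group:
  assumes e: "bij_betw e Y stable" and "symmetries = {id}"
  shows "Aut \<cong> involution_group Y"
proof -
  have eY: "e ` Y \<subseteq> stable" and inj: "inj_on e Y" using e by (auto simp: bij_betw_def)
  interpret involution_family Aut Y "\<lambda>x. seed_aut [e x] id" by (rule mutation_family[OF eY])
  show ?thesis
  proof (rule involution_group_iso)
    fix r assume r: "distinct_adj r" "set r \<subseteq> Y" "word_prod r = \<one>\<^bsub>Aut\<^esub>"
    have "distinct_adj (map e r)" using r inj by (intro distinct_adj_mapI) (auto intro: inj_on_subset)
    then have "rev (map e r) = []"
      using r(2) eY r(3) mutation_word_prod[OF eY r(2)] by (intro seed_aut_faithful(1)[of _ id]) auto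
    then show "r = []" by simp
  next
    fix f assume "f \<in> carrier Aut"
    then obtain w where w: "set w \<subseteq> stable" "f = seed_aut w id"
      using Aut_cases assms(2) by (metis singletonD)
    let ?r = "rev (map (inv_into Y e) w)"
    have r: "set ?r \<subseteq> Y" using w(1) bij_betw_inv_into[OF e] by (auto simp: bij_betw_def)
    have "map e (map (inv_into Y e) w) = w"
      using w(1) bij_betw_inv_into_right[OF e] by (auto intro!: map_idI)
    then have "rev (map e ?r) = w" by (simp add: rev_map)
    then show "\<exists>r. set r \<subseteq> Y \<and> f = word_prod r" using mutation_word_prod[OF eY r] r w(2) by metis
  qed
qed

section \<open>At most one stable label\<close>

lemma seed_aut_inj:
  assumes "set w \<subseteq> stable" "\<sigma> \<in> symmetries" "\<tau> \<in> symmetries" "seed_aut w \<sigma> = seed_aut w \<tau>"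
  shows "\<sigma> = \<tau>"
proof
  fix i
  have "carries (seed_aut w \<sigma>) \<sigma> [] w" and "carries (seed_aut w \<tau>) \<tau> [] w"
    using seed_aut(2)[OF matches_stable] assms(1-3) by auto
  then have "X w $ \<sigma> i = X w $ \<tau> i" unfolding carries_def assms(4) by metis
  then show "\<sigma> i = \<tau> i" by (simp only: X_inj)
qed

lemma Aut_iso_symmetries:
  assumes "stable = {}"
    and p: "bij_betw p (carrier H) symmetries"
      "\<And>s t. s \<in> carrier H \<Longrightarrow> t \<in> carrier H \<Longrightarrow> s \<otimes>\<^bsub>H\<^esub> t \<in> carrier H \<and> p (s \<otimes>\<^bsub>H\<^esub> t) = p s \<circ> p t"
  shows "Aut \<cong> H"
proof (rule iso_from_closed[of "\<lambda>s. seed_aut [] (p s)"])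
  have p_sym: "p s \<in> symmetries" if "s \<in> carrier H" for s using p(1) that by (auto simp: bij_betw_def)
  then show "(\<lambda>s. seed_aut [] (p s)) \<in> hom H Aut"
    by (intro homI) (simp_all add: seed_aut_carrier p(2) mult_stable)
  have inj: "\<sigma> = \<tau>" if "\<sigma> \<in> symmetries" "\<tau> \<in> symmetries" "seed_aut [] \<sigma> = seed_aut [] \<tau>" for \<sigma> \<tau>
    by (rule seed_aut_inj[of "[]"]) (use that in auto)
  show "bij_betw (\<lambda>s. seed_aut [] (p s)) (carrier H) (carrier Aut)"
  proof (rule bij_betw_imageI)
    show "inj_on (\<lambda>s. seed_aut [] (p s)) (carrier H)"
      using inj p_sym p(1) unfolding bij_betw_def inj_on_def by blast
    have "f \<in> (\<lambda>s. seed_aut [] (p s)) ` carrier H" if f: "f \<in> carrier Aut" for f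
    proof -
      obtain w \<sigma> where w: "set w \<subseteq> stable" "\<sigma> \<in> symmetries" "f = seed_aut w \<sigma>"
        using Aut_cases[OF f] by metis
      then obtain s where "s \<in> carrier H" "\<sigma> = p s" using p(1) by (auto simp: bij_betw_def)
      then show ?thesis using w assms(1) by auto
    qed
    then show "(\<lambda>s. seed_aut [] (p s)) ` carrier H = carrier Aut"
      using seed_aut_carrier p_sym by auto
  qed
qed (use p(2) in blast)

lemma Aut_trivial:
  assumes "stable = {}" "symmetries = {id}"
  shows "trivial_group Aut"
proof -
  have "f = \<one>\<^bsub>Aut\<^esub>" if f: "f \<in> carrier Aut" for f
  proof -
    obtain w \<sigma> where "set w \<subseteq> stable" "\<sigma> \<in> symmetries" "f = seed_aut w \<sigma>"
      using Aut_cases[OF f] by metis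
    then show ?thesis using assms by (simp add: one_Aut)
  qed
  then show ?thesis
    using group.is_monoid[OF group_Aut] by (auto simp: trivial_group_def group_Aut monoid.one_closed)
qed

lemma Aut_single_stable:
  assumes "stable = {k}" "f \<in> carrier Aut"
  shows "\<exists>\<sigma>\<in>symmetries. f = seed_aut [] \<sigma> \<or> f = seed_aut [k] \<sigma>"
proof -
  obtain w \<sigma> where w: "distinct_adj w" "set w \<subseteq> stable" "\<sigma> \<in> symmetries" "f = seed_aut w \<sigma>"
    using Aut_cases[OF assms(2)] .
  \<comment> \<open>The case rule of \<open>remdups_adj\<close> separates lengths 0, 1 and at least
    2; a longer word would repeat \<open>k\<close>.\<close>
  then have "w = [] \<or> w = [k]" using assms(1) by (cases w rule: remdups_adj.cases) auto
  then show ?thesis using w by auto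
qed

text \<open>Otherwise the clusters at \<open>[k]\<close> and at the root would agree up to a
  permutation, which \<open>reduced_word_moves_cluster\<close> excludes.\<close>

lemma seed_aut_single_ne:
  assumes "k \<in> stable" "\<sigma> \<in> symmetries" "\<tau> \<in> symmetries"
  shows "seed_aut [k] \<sigma> \<noteq> seed_aut [] \<tau>"
proof
  assume eq: "seed_aut [k] \<sigma> = seed_aut [] \<tau>"
  have \<sigma>: "bij \<sigma>" and \<tau>: "bij \<tau>" using assms(2,3) by (auto simp: symmetries_def matches_def)
  have "carries (seed_aut [k] \<sigma>) \<sigma> [] [k]" and "carries (seed_aut [] \<tau>) \<tau> [] []"
    using seed_aut(2)[OF matches_stable[of "[k]" \<sigma>]] seed_aut(2)[OF matches_stable[of "[]" \<tau>]] assms by auto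
  then have X: "X [k] $ \<sigma> i = X [] $ \<tau> i" for i unfolding carries_def eq by metis
  have "[k] = []"
  proof (rule reduced_word_moves_cluster)
    show "X [k] $ (\<sigma> \<circ> inv_into UNIV \<tau>) i = x0 $ i" for i
      using X[of "inv_into UNIV \<tau> i"] \<tau> by (simp add: bij_is_surj surj_f_inv_f)
    show "bij (\<sigma> \<circ> inv_into UNIV \<tau>)" using \<sigma> \<tau> by (intro bij_comp bij_imp_bij_inv)
  qed simp
  then show False by simp
qed

lemma Z2_simps:
  "carrier (integer_mod_group 2) = {0, 1}"
  "\<lbrakk>x \<in> {0, 1}; y \<in> {0, 1}\<rbrakk> \<Longrightarrow> x \<otimes>\<^bsub>integer_mod_group 2\<^esub> y = (if x = y then 0 else 1)"
  by (auto simp: carrier_integer_mod_group mult_integer_mod_group)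

lemma Aut_iso_Z2:
  assumes st: "stable = {k}" and sy: "symmetries = {id}"
  shows "Aut \<cong> integer_mod_group 2"
proof (rule iso_from_closed)
  let ?f = "\<lambda>z :: int. seed_aut (if z = 0 then [] else [k]) id"
  have k: "k \<in> stable" using st by simp
  have sq: "seed_aut [k] id \<otimes>\<^bsub>Aut\<^esub> seed_aut [k] id = seed_aut [] id"
    using mult_stable[of "[k]" id "[k]" id] st seed_aut_square[OF k] by simp
  show "?f \<in> hom (integer_mod_group 2) Aut"
    by (rule homI) (use st sq in \<open>auto simp: Z2_simps seed_aut_carrier mult_stable\<close>)
  have "?f ` {0, 1} = carrier Aut"
    using Aut_single_stable[OF st] seed_aut_carrier st sy by (fastforce simp: image_iff)
  then show "bij_betw ?f (carrier (integer_mod_group 2)) (carrier Aut)"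
    using seed_aut_single_ne[OF k, of id id] by (auto simp: Z2_simps bij_betw_def inj_on_def)
qed (auto simp: Z2_simps)

lemma Aut_iso_Z2_Z2:
  assumes st: "stable = {k}" and sy: "symmetries = {id, \<tau>}" and \<tau>: "\<tau> \<noteq> id" "\<tau> \<circ> \<tau> = id"
  shows "Aut \<cong> integer_mod_group 2 \<times>\<times> integer_mod_group 2"
proof (rule iso_from_closed)
  let ?w = "\<lambda>y :: int. if y = 0 then [] else [k]" and ?p = "\<lambda>z :: int. if z = 0 then id else \<tau>"
  let ?f = "\<lambda>(y, z). seed_aut (?w y) (?p z)"
  have k: "k \<in> stable" and \<tau>s: "\<tau> \<in> symmetries" using st sy by auto
  \<comment> \<open>A symmetry permutes the stable labels. As there is only one, \<tau> commutes
    with the mutation at \<open>k\<close>, and the product is direct.\<close>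
  have \<tau>k: "\<tau> k = k" using symmetries_stable[OF \<tau>s k] st by simp
  have sq: "seed_aut [k, k] \<sigma> = seed_aut [] \<sigma>" if "\<sigma> \<in> symmetries" for \<sigma>
  proof (rule seed_aut_cong)
    show "matches \<sigma> [] [k, k]" using that st by (intro matches_stable) auto
    show "S [k, k] = S []" by (rule involutive)
    show "Wt [k, k] = Wt []" using mutate_weights_involutive by simp
  qed
  have car: "carrier (integer_mod_group 2 \<times>\<times> integer_mod_group 2) = {0, 1} \<times> {0, 1}"
    by (simp add: DirProd_def Z2_simps)
  have sts: "{k} \<subseteq> stable" using st by simp
  show "?f \<in> hom (integer_mod_group 2 \<times>\<times> integer_mod_group 2) Aut"
    by (rule homI, unfold car)
      (use sts \<tau>s \<tau>k sq \<tau>(2) in \<open>auto simp: Z2_simps seed_aut_carrier mult_stable\<close>)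
  have "inj_on ?f ({0, 1} \<times> {0, 1})"
  proof (rule inj_onI)
    fix x y assume xy: "x \<in> {0 :: int, 1} \<times> {0 :: int, 1}" "y \<in> {0 :: int, 1} \<times> {0 :: int, 1}" and eq: "?f x = ?f y"
    obtain x1 x2 y1 y2 where [simp]: "x = (x1, x2)" "y = (y1, y2)" by force
    have ps: "?p z \<in> symmetries" for z using \<tau>s by simp
    have "x1 = y1"
    proof (rule ccontr)
      assume "x1 \<noteq> y1"
      then have "x1 = 0 \<and> y1 = 1 \<or> x1 = 1 \<and> y1 = 0" using xy by auto
      then show False
      proof
        assume "x1 = 0 \<and> y1 = 1"
        then have "seed_aut [k] (?p y2) = seed_aut [] (?p x2)" using eq by simp
        then show False using seed_aut_single_ne[OF k ps ps] by blast
      next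
        assume "x1 = 1 \<and> y1 = 0"
        then have "seed_aut [k] (?p x2) = seed_aut [] (?p y2)" using eq by simp
        then show False using seed_aut_single_ne[OF k ps ps] by blast
      qed
    qed
    then have "seed_aut (?w x1) (?p x2) = seed_aut (?w x1) (?p y2)" using eq by simp
    moreover have "set (?w x1) \<subseteq> stable" using k by simp
    ultimately have "?p x2 = ?p y2" using seed_aut_inj[OF _ ps ps] by blast
    then have "x2 = y2" using \<tau>(1) xy by (auto split: if_splits)
    then show "x = y" using \<open>x1 = y1\<close> by simp
  qed
  moreover have "?f ` ({0, 1} \<times> {0, 1}) = carrier Aut"
  proof
    show "?f ` ({0, 1} \<times> {0, 1}) \<subseteq> carrier Aut" using sts \<tau>s by (auto intro!: seed_aut_carrier)
    show "carrier Aut \<subseteq> ?f ` ({0, 1} \<times> {0, 1})"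
    proof
      fix f assume "f \<in> carrier Aut"
      then obtain \<sigma> where "\<sigma> = id \<or> \<sigma> = \<tau>" "f = seed_aut [] \<sigma> \<or> f = seed_aut [k] \<sigma>"
        using Aut_single_stable[OF st] sy by blast
      then have "f = ?f (0, 0) \<or> f = ?f (0, 1) \<or> f = ?f (1, 0) \<or> f = ?f (1, 1)" by auto
      then show "f \<in> ?f ` ({0, 1} \<times> {0, 1})" by blast
    qed
  qed
  ultimately show "bij_betw ?f (carrier (integer_mod_group 2 \<times>\<times> integer_mod_group 2)) (carrier Aut)"
    unfolding car bij_betw_def by blast
  fix x y assume "x \<in> carrier (integer_mod_group 2 \<times>\<times> integer_mod_group 2)"
    "y \<in> carrier (integer_mod_group 2 \<times>\<times> integer_mod_group 2)"
  then show "x \<otimes>\<^bsub>integer_mod_group 2 \<times>\<times> integer_mod_group 2\<^esub> y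
      \<in> carrier (integer_mod_group 2 \<times>\<times> integer_mod_group 2)"
    unfolding car by (auto simp: Z2_simps)
qed

text \<open>
  If a symmetry exchanges the two stable labels \<open>k\<close> and \<open>l\<close>, the group is generated by the
  mutation at \<open>k\<close> and that symmetry, and these two involutions again satisfy no further relation.
\<close>

lemma Aut_iso_D_infinity_swap:
  assumes st: "stable = {k, l}" and kl: "k \<noteq> l" and sy: "symmetries = {id, \<tau>}"
    and \<tau>: "\<tau> k = l" "\<tau> l = k" "\<tau> \<circ> \<tau> = id"
  shows "Aut \<cong> involution_group {1, 2 :: nat}"
proof -
  define g where "g x = (if x = 1 then seed_aut [k] id else seed_aut [] \<tau>)" for x :: nat
  have k: "k \<in> stable" and \<tau>s: "\<tau> \<in> symmetries" using st sy by auto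
  have ks: "{k} \<subseteq> stable" using k by simp
  have "\<tau> \<noteq> id" using \<tau>(1) kl by auto
  interpret group Aut by (rule group_Aut)
  interpret involution_family Aut "{1, 2}" g
  proof
    fix x :: nat assume "x \<in> {1, 2}"
    then have x: "x = 1 \<or> x = 2" by auto
    then show "g x \<in> carrier Aut" using ks \<tau>s by (auto simp: g_def intro!: seed_aut_carrier)
    show "g x \<otimes>\<^bsub>Aut\<^esub> g x = \<one>\<^bsub>Aut\<^esub>"
      using x
    proof
      assume "x = 1"
      then show ?thesis using mult_stable[of "[k]" id "[k]" id] ks seed_aut_square[OF k]
        by (simp add: g_def one_Aut)
    next
      assume "x = 2"
      then show ?thesis using mult_stable[of "[]" \<tau> "[]" \<tau>] \<tau>s \<tau>(3) by (simp add: g_def one_Aut)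
    qed
  qed
  have \<tau>inj: "inj \<tau>" using \<tau>s by (auto simp: symmetries_def matches_def bij_is_inj)
  \<comment> \<open>The clauses on the head of \<open>r\<close> are the invariant. Multiplying by
    generator 1 appends \<open>k\<close> to \<open>w\<close>; multiplying by generator 2 exchanges
    \<open>k\<close> and \<open>l\<close> throughout \<open>w\<close>. As the letters of
    \<open>r\<close> alternate, \<open>k\<close> is only appended to an empty word or behind an
    \<open>l\<close>, so \<open>w\<close> stays reduced.\<close>
  have normal: "\<exists>w \<sigma>. word_prod r = seed_aut w \<sigma> \<and> distinct_adj w \<and> set w \<subseteq> stable \<and> \<sigma> \<in> symmetries \<and>
      (r \<noteq> [] \<and> hd r = 1 \<longrightarrow> w \<noteq> [] \<and> last w = k) \<and>
      (r \<noteq> [] \<and> hd r = 2 \<longrightarrow> w = [] \<and> \<sigma> = \<tau> \<or> w \<noteq> [] \<and> last w = l) \<and>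
      (r = [] \<longrightarrow> w = [] \<and> \<sigma> = id)"
    if "distinct_adj r" "set r \<subseteq> {1, 2}" for r
    using that
  proof (induction r)
    case Nil
    show ?case unfolding word_prod_simps one_Aut
      by (rule exI[of _ "[]"], rule exI[of _ id], intro conjI) (simp_all only: distinct_adj_Nil list.set empty_subsetI id_symmetries simp_thms)
  next
    case (Cons x r)
    have r: "distinct_adj r" "set r \<subseteq> {1, 2}" using Cons.prems by (auto dest: distinct_adj_ConsD)
    obtain w \<sigma> where IH: "word_prod r = seed_aut w \<sigma>" "distinct_adj w" "set w \<subseteq> stable" "\<sigma> \<in> symmetries"
      "r \<noteq> [] \<and> hd r = 1 \<longrightarrow> w \<noteq> [] \<and> last w = k"
      "r \<noteq> [] \<and> hd r = 2 \<longrightarrow> w = [] \<and> \<sigma> = \<tau> \<or> w \<noteq> [] \<and> last w = l"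
      "r = [] \<longrightarrow> w = [] \<and> \<sigma> = id"
      using Cons.IH[OF r] by blast
    have hd: "r = [] \<or> hd r \<in> {1, 2} \<and> hd r \<noteq> x" using Cons.prems by (cases r) auto
    have "x = 1 \<or> x = 2" using Cons.prems by auto
    then show ?case
    proof
      assume x: "x = 1"
      have "w = [] \<or> last w = l" using hd IH x by auto
      then have d: "distinct_adj (w @ [k])" using IH(2) kl by (auto simp: distinct_adj_append_iff)
      have p: "word_prod (x # r) = seed_aut (w @ [k]) \<sigma>"
        using mult_stable[of "[k]" id w \<sigma>] IH(1,3,4) ks x by (simp add: g_def)
      show ?thesis
      proof (rule exI[of _ "w @ [k]"], rule exI[of _ \<sigma>], intro conjI)
        show "word_prod (x # r) = seed_aut (w @ [k]) \<sigma>" by (rule p)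
        show "distinct_adj (w @ [k])" by (rule d)
        show "set (w @ [k]) \<subseteq> stable" using IH(3) k by auto
        show "\<sigma> \<in> symmetries" by (rule IH(4))
        show "x # r \<noteq> [] \<and> hd (x # r) = 1 \<longrightarrow> w @ [k] \<noteq> [] \<and> last (w @ [k]) = k" by simp
        show "x # r \<noteq> [] \<and> hd (x # r) = 2 \<longrightarrow> w @ [k] = [] \<and> \<sigma> = \<tau> \<or> w @ [k] \<noteq> [] \<and> last (w @ [k]) = l"
          unfolding x by simp
        show "x # r = [] \<longrightarrow> w @ [k] = [] \<and> \<sigma> = id" by simp
      qed
    next
      assume x: "x = 2"
      have w: "w = [] \<and> \<sigma> = id \<or> w \<noteq> [] \<and> last w = k" using hd IH x by auto
      have d: "distinct_adj (map \<tau> w)" using IH(2) \<tau>inj by (intro distinct_adj_mapI) (auto intro: inj_on_subset)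
      have p: "word_prod (x # r) = seed_aut (map \<tau> w) (\<tau> \<circ> \<sigma>)"
        using mult_stable[of "[]" \<tau> w \<sigma>] IH(1,3,4) \<tau>s x by (simp add: g_def)
      have l: "map \<tau> w = [] \<and> \<tau> \<circ> \<sigma> = \<tau> \<or> map \<tau> w \<noteq> [] \<and> last (map \<tau> w) = l"
        using w \<tau>(1) by (auto simp: last_map)
      show ?thesis
      proof (rule exI[of _ "map \<tau> w"], rule exI[of _ "\<tau> \<circ> \<sigma>"], intro conjI)
        show "set (map \<tau> w) \<subseteq> stable" using IH(3) symmetries_stable[OF \<tau>s] by auto
        have "\<sigma> = id \<or> \<sigma> = \<tau>" using IH(4) unfolding sy by blast
        then have "\<tau> \<circ> \<sigma> = \<tau> \<or> \<tau> \<circ> \<sigma> = id" using \<tau>(3) by (elim disjE) (simp_all only: comp_id simp_thms)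
        then show "\<tau> \<circ> \<sigma> \<in> symmetries" unfolding sy by blast
        show "word_prod (x # r) = seed_aut (map \<tau> w) (\<tau> \<circ> \<sigma>)" by (rule p)
        show "distinct_adj (map \<tau> w)" by (rule d)
        show "x # r \<noteq> [] \<and> hd (x # r) = 1 \<longrightarrow> map \<tau> w \<noteq> [] \<and> last (map \<tau> w) = k" unfolding x by simp
        show "x # r \<noteq> [] \<and> hd (x # r) = 2 \<longrightarrow>
          map \<tau> w = [] \<and> \<tau> \<circ> \<sigma> = \<tau> \<or> map \<tau> w \<noteq> [] \<and> last (map \<tau> w) = l" using l by (intro impI)
        show "x # r = [] \<longrightarrow> map \<tau> w = [] \<and> \<tau> \<circ> \<sigma> = id" by simp
      qed
    qed
  qed
  show ?thesis
  proof (rule involution_group_iso)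
    fix r :: "nat list" assume r: "distinct_adj r" "set r \<subseteq> {1, 2}" "word_prod r = \<one>\<^bsub>Aut\<^esub>"
    obtain w \<sigma> where w: "word_prod r = seed_aut w \<sigma>" "distinct_adj w" "set w \<subseteq> stable" "\<sigma> \<in> symmetries"
      "r \<noteq> [] \<and> hd r = 1 \<longrightarrow> w \<noteq> [] \<and> last w = k"
      "r \<noteq> [] \<and> hd r = 2 \<longrightarrow> w = [] \<and> \<sigma> = \<tau> \<or> w \<noteq> [] \<and> last w = l"
      using normal[OF r(1,2)] by blast
    have "w = []" "\<sigma> = id" using seed_aut_faithful[OF w(2-4)] w(1) r(3) by auto
    then have "r = [] \<or> hd r \<noteq> 1 \<and> hd r \<noteq> 2" using w(5,6) \<open>\<tau> \<noteq> id\<close> by auto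
    then show "r = []" using r(2) by (cases r) auto
  next
    fix f assume f: "f \<in> carrier Aut"
    obtain w \<sigma> where w: "set w \<subseteq> stable" "\<sigma> \<in> symmetries" "f = seed_aut w \<sigma>"
      using Aut_cases[OF f] by metis
    define P where "P = {f. \<exists>r. set r \<subseteq> {1, 2 :: nat} \<and> f = word_prod r}"
    have mult: "x \<otimes>\<^bsub>Aut\<^esub> y \<in> P" if "x \<in> P" "y \<in> P" for x y
    proof -
      obtain r r' where "set r \<subseteq> {1, 2}" "x = word_prod r" "set r' \<subseteq> {1, 2}" "y = word_prod r'"
        using \<open>x \<in> P\<close> \<open>y \<in> P\<close> by (auto simp: P_def)
      then show ?thesis unfolding P_def using word_prod_append[of r r'] by (intro CollectI exI[of _ "r @ r'"]) auto
    qed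
    have gP: "g x \<in> P" if "x \<in> {1, 2}" for x
      unfolding P_def using that g_closed[OF that] by (intro CollectI exI[of _ "[x]"]) auto
    have kP: "seed_aut [k] id \<in> P" and \<tau>P: "seed_aut [] \<tau> \<in> P"
      using gP[of 1] gP[of 2] by (simp_all add: g_def)
    have idP: "seed_aut [] id \<in> P" unfolding P_def by (intro CollectI exI[of _ "[]"]) (simp add: one_Aut)
    \<comment> \<open>Conjugating the mutation at \<open>k\<close> by the symmetry gives the
      mutation at \<open>l\<close>.\<close>
    have "seed_aut [] \<tau> \<otimes>\<^bsub>Aut\<^esub> (seed_aut [k] id \<otimes>\<^bsub>Aut\<^esub> seed_aut [] \<tau>) = seed_aut [l] id"
      using \<tau> \<tau>s k st by (simp add: mult_stable)
    then have lP: "seed_aut [l] id \<in> P" using mult[OF \<tau>P mult[OF kP \<tau>P]] by simp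
    have "seed_aut w \<sigma> \<in> P" using w(1)
    \<comment> \<open>Left multiplication by a mutation appends a letter at the end, so the
      induction peels off the last one.\<close>
    proof (induction w rule: rev_induct)
      case Nil
      then show ?case using w(2) sy \<tau>P idP by auto
    next
      case (snoc x w)
      then have "seed_aut [x] id \<otimes>\<^bsub>Aut\<^esub> seed_aut w \<sigma> = seed_aut (w @ [x]) \<sigma>"
        using mult_stable[of "[x]" id w \<sigma>] w(2) by simp
      moreover have "seed_aut [x] id \<in> P" using snoc.prems st kP lP by auto
      ultimately show ?case using mult[of "seed_aut [x] id" "seed_aut w \<sigma>"] snoc by auto
    qed
    then show "\<exists>r. set r \<subseteq> {1, 2} \<and> f = word_prod r" unfolding w(3) P_def by blast
  qed
qed

end


section \<open>The groups for the possible weights\<close>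

lemma bij_betw_enum_3:
  fixes i j k :: 3
  assumes "i \<noteq> j" "i \<noteq> k" "j \<noteq> k"
  shows "bij_betw (\<lambda>n :: nat. if n = 1 then i else if n = 2 then j else k) {1, 2, 3} UNIV"
proof -
  have "UNIV = {i, j, k}" using UNIV_3_diff[OF assms] by auto
  then show ?thesis using assms by (auto simp: bij_betw_def inj_on_def)
qed

lemma permutes_UNIV_iff_bij: "p permutes UNIV \<longleftrightarrow> bij p"
  by (auto simp: permutes_univ bij_iff)

lemma carrier_sym_group_3: "carrier (sym_group 3) = {p. p permutes {1, 2, 3}}"
proof -
  have "{1..3} = {1, 2, 3 :: nat}" by auto
  then show ?thesis by (simp add: sym_group_def)
qed

text \<open>\<open>sym_group 3\<close> permutes natural numbers whereas the labels have type
  \<open>3\<close>; conjugation by the enumeration \<open>e\<close> translates between them.\<close>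

lemma bij_betw_sym_group_3:
  fixes e :: "nat \<Rightarrow> 3"
  assumes e: "bij_betw e {1, 2, 3} UNIV"
  shows "bij_betw (\<lambda>s i. e (s (inv_into {1, 2, 3} e i))) (carrier (sym_group 3)) {\<sigma>. bij \<sigma>}"
    and "\<lbrakk>s \<in> carrier (sym_group 3); t \<in> carrier (sym_group 3)\<rbrakk> \<Longrightarrow>
      (\<lambda>i. e ((s \<circ> t) (inv_into {1, 2, 3} e i)))
      = (\<lambda>i. e (s (inv_into {1, 2, 3} e i))) \<circ> (\<lambda>i. e (t (inv_into {1, 2, 3} e i)))"
proof -
  show "bij_betw (\<lambda>s i. e (s (inv_into {1, 2, 3} e i))) (carrier (sym_group 3)) {\<sigma>. bij \<sigma>}"
    using bij_betw_permutations[OF e] by (simp add: carrier_sym_group_3 permutes_UNIV_iff_bij)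
  assume "s \<in> carrier (sym_group 3)" and t: "t \<in> carrier (sym_group 3)"
  have "inv_into {1, 2, 3} e (e (t (inv_into {1, 2, 3} e i))) = t (inv_into {1, 2, 3} e i)" for i
  proof (rule bij_betw_inv_into_left[OF e])
    have "inv_into {1, 2, 3} e i \<in> {1, 2, 3}"
      using bij_betw_inv_into[OF e] by (metis UNIV_I bij_betwE)
    moreover have "t permutes {1, 2, 3}" using t carrier_sym_group_3 by blast
    ultimately show "t (inv_into {1, 2, 3} e i) \<in> {1, 2, 3}" by (subst permutes_in_image)
  qed
  then show "(\<lambda>i. e ((s \<circ> t) (inv_into {1, 2, 3} e i)))
      = (\<lambda>i. e (s (inv_into {1, 2, 3} e i))) \<circ> (\<lambda>i. e (t (inv_into {1, 2, 3} e i)))"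
    by (simp add: fun_eq_iff)
qed

context cyclic_pattern
begin

lemma symmetries_iff: "\<sigma> \<in> symmetries \<longleftrightarrow> bij \<sigma> \<and> (\<forall>i. W0 (\<sigma> i) = W0 i \<and> d $ \<sigma> i = d $ i)"
  by (auto simp: symmetries_def matches_def fun_eq_iff)

lemma stable_iff:
  assumes "i \<noteq> j" "i \<noteq> k" "j \<noteq> k"
  shows "k \<in> stable \<longleftrightarrow> W0 i * W0 j = 2 * W0 k"
  using assms by (auto simp: stable_def mutate_weights_eq[OF assms] fun_eq_iff)

lemma symmetries_trivial:
  assumes "\<And>i j. i \<noteq> j \<Longrightarrow> W0 i \<noteq> W0 j \<or> d $ i \<noteq> d $ j"
  shows "symmetries = {id}"
proof -
  have "\<sigma> = id" if "\<sigma> \<in> symmetries" for \<sigma>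
    using that assms unfolding symmetries_iff by (metis ext id_apply)
  then show ?thesis using id_symmetries by blast
qed

lemma symmetries_all:
  assumes "\<And>i j. W0 i = W0 j" "\<And>i j. d $ i = d $ j"
  shows "symmetries = {\<sigma>. bij \<sigma>}"
  using assms by (auto simp: symmetries_iff)

lemma symmetries_swap:
  assumes ijk: "i \<noteq> j" "i \<noteq> k" "j \<noteq> k" and eq: "W0 i = W0 j" "d $ i = d $ j"
    and ne: "W0 k \<noteq> W0 i \<or> d $ k \<noteq> d $ i"
  shows "symmetries = {id, Transposition.transpose i j}"
proof (intro equalityI subsetI)
  have l: "l = i \<or> l = j \<or> l = k" for l using UNIV_3_diff[OF ijk] by blast
  fix \<sigma> assume "\<sigma> \<in> symmetries"
  then have \<sigma>: "bij \<sigma>" "\<And>l. W0 (\<sigma> l) = W0 l" "\<And>l. d $ \<sigma> l = d $ l" by (auto simp: symmetries_iff)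
  have inj: "\<sigma> a = \<sigma> b \<longleftrightarrow> a = b" for a b using bij_is_inj[OF \<sigma>(1)] by (simp add: inj_eq)
  have "\<sigma> k \<noteq> i" "\<sigma> k \<noteq> j" using \<sigma>(2)[of k] \<sigma>(3)[of k] ne eq by auto
  then have k: "\<sigma> k = k" using l[of "\<sigma> k"] by simp
  have i: "\<sigma> i \<noteq> k" "\<sigma> j \<noteq> k" "\<sigma> i \<noteq> \<sigma> j" using inj k ijk by metis+
  show "\<sigma> \<in> {id, Transposition.transpose i j}"
  proof (cases "\<sigma> i = i")
    case True
    then have "\<sigma> j = j" using l[of "\<sigma> j"] i by auto
    then have "\<sigma> x = id x" for x using l[of x] True k by auto
    then show ?thesis by auto
  next
    case False
    then have "\<sigma> i = j" using l[of "\<sigma> i"] i by auto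
    moreover from this have "\<sigma> j = i" using l[of "\<sigma> j"] i by auto
    ultimately have "\<sigma> x = Transposition.transpose i j x" for x
      using l[of x] k ijk by (auto simp: Transposition.transpose_def)
    then show ?thesis by auto
  qed
next
  fix \<sigma> assume "\<sigma> \<in> {id, Transposition.transpose i j}"
  then show "\<sigma> \<in> symmetries"
    using eq by (auto simp: symmetries_iff Transposition.transpose_def)
qed

lemma Aut_iso_N_phi_S3:
  assumes st: "stable = UNIV" and sy: "symmetries = {\<sigma>. bij \<sigma>}"
  shows "Aut \<cong> N_phi_S3"
proof -
  define e where "e = (\<lambda>n :: nat. if n = 1 then 1 else if n = 2 then 2 else 3 :: 3)"
  have e: "bij_betw e {1, 2, 3} UNIV" unfolding e_def by (rule bij_betw_enum_3) auto
  have "Aut \<cong> semidirect_product (involution_group {1, 2, 3}) (sym_group 3) (\<lambda>s. relabel_generators s)"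
  proof (rule Aut_iso_semidirect[where e = e and p = "\<lambda>s i. e (s (inv_into {1, 2, 3} e i))"])
    show "bij_betw e {1, 2, 3} stable" using e st by simp
    show "group (sym_group 3)" by (rule sym_group_is_group)
    show "bij_betw (\<lambda>s i. e (s (inv_into {1, 2, 3} e i))) (carrier (sym_group 3)) symmetries"
      using bij_betw_sym_group_3(1)[OF e] sy by simp
    show "(\<lambda>i. e ((s \<otimes>\<^bsub>sym_group 3\<^esub> t) (inv_into {1, 2, 3} e i)))
      = (\<lambda>i. e (s (inv_into {1, 2, 3} e i))) \<circ> (\<lambda>i. e (t (inv_into {1, 2, 3} e i)))"
      if "s \<in> carrier (sym_group 3)" "t \<in> carrier (sym_group 3)" for s t
      using bij_betw_sym_group_3(2)[OF e that] by (simp add: sym_group_mult)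
    show "bij_betw s {1, 2, 3} {1, 2, 3}" if "s \<in> carrier (sym_group 3)" for s
      using that unfolding carrier_sym_group_3 by (simp add: permutes_imp_bij)
    show "e (s x) = e (s (inv_into {1, 2, 3} e (e x)))" if "x \<in> {1, 2, 3}" for s x
      using bij_betw_inv_into_left[OF e that] by simp
  qed
  then show ?thesis by (simp add: N_phi_S3_def N_group_def)
qed

lemma Aut_iso_N_tau_Z2:
  assumes st: "stable = UNIV" and ijk: "i \<noteq> j" "i \<noteq> k" "j \<noteq> k"
    and sy: "symmetries = {id, Transposition.transpose i j}"
  shows "Aut \<cong> N_tau_Z2"
proof -
  \<comment> \<open>The label fixed by the transposition becomes generator 1, because the action in
    \<open>N_tau_Z2\<close> exchanges generators 2 and 3.\<close>
  define e where "e = (\<lambda>n :: nat. if n = 1 then k else if n = 2 then i else j)"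
  have e: "bij_betw e {1, 2, 3} UNIV" unfolding e_def by (rule bij_betw_enum_3) (use ijk in auto)
  define p where "p z = (if z = 0 then id else Transposition.transpose i j)" for z :: int
  let ?a = "\<lambda>z :: int. if z = 0 then id else Transposition.transpose 2 (3 :: nat)"
  have ne: "Transposition.transpose i j \<noteq> id" using ijk(1) by (metis id_apply transpose_apply_first)
  have "Aut \<cong> semidirect_product (involution_group {1, 2, 3}) (integer_mod_group 2) (\<lambda>z. relabel_generators (?a z))"
  proof (rule Aut_iso_semidirect[where e = e and p = p])
    show "bij_betw e {1, 2, 3} stable" using e st by simp
    show "group (integer_mod_group 2)" by (rule group_integer_mod_group)
    show "bij_betw p (carrier (integer_mod_group 2)) symmetries"
      using ne ne[symmetric] by (auto simp: Z2_simps sy bij_betw_def inj_on_def p_def)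
    show "p (s \<otimes>\<^bsub>integer_mod_group 2\<^esub> t) = p s \<circ> p t"
      if "s \<in> carrier (integer_mod_group 2)" "t \<in> carrier (integer_mod_group 2)" for s t
      using that by (auto simp: Z2_simps p_def)
    show "bij_betw (?a s) {1, 2, 3} {1, 2, 3}" for s
      by (auto simp: bij_betw_def inj_on_def Transposition.transpose_def)
    show "e (?a s x) = p s (e x)" if "x \<in> {1, 2, 3}" for s x
      using that ijk by (auto simp: e_def p_def Transposition.transpose_def)
  qed
  then show ?thesis by (simp add: N_tau_Z2_def N_group_def)
qed

lemma Aut_iso_sym_group_3:
  assumes "stable = {}" and sy: "symmetries = {\<sigma>. bij \<sigma>}"
  shows "Aut \<cong> sym_group 3"
proof -
  define e where "e = (\<lambda>n :: nat. if n = 1 then 1 else if n = 2 then 2 else 3 :: 3)"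
  have e: "bij_betw e {1, 2, 3} UNIV" unfolding e_def by (rule bij_betw_enum_3) auto
  show ?thesis
  proof (rule Aut_iso_symmetries[OF assms(1)])
    show "bij_betw (\<lambda>s i. e (s (inv_into {1, 2, 3} e i))) (carrier (sym_group 3)) symmetries"
      using bij_betw_sym_group_3(1)[OF e] sy by simp
    fix s t assume st: "s \<in> carrier (sym_group 3)" "t \<in> carrier (sym_group 3)"
    show "s \<otimes>\<^bsub>sym_group 3\<^esub> t \<in> carrier (sym_group 3) \<and>
      (\<lambda>i. e ((s \<otimes>\<^bsub>sym_group 3\<^esub> t) (inv_into {1, 2, 3} e i)))
      = (\<lambda>i. e (s (inv_into {1, 2, 3} e i))) \<circ> (\<lambda>i. e (t (inv_into {1, 2, 3} e i)))"
      using bij_betw_sym_group_3(2)[OF e st] group.is_monoid[OF sym_group_is_group, of 3] st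
      by (simp add: sym_group_mult monoid.m_closed[of "sym_group 3", unfolded sym_group_mult])
  qed
qed

lemma Aut_iso_Z2_swap:
  assumes "stable = {}" and ij: "i \<noteq> j" and sy: "symmetries = {id, Transposition.transpose i j}"
  shows "Aut \<cong> integer_mod_group 2"
proof (rule Aut_iso_symmetries[OF assms(1)])
  define p where "p z = (if z = 0 then id else Transposition.transpose i j)" for z :: int
  have ne: "Transposition.transpose i j \<noteq> id" using ij by (metis id_apply transpose_apply_first)
  show "bij_betw p (carrier (integer_mod_group 2)) symmetries"
    using ne ne[symmetric] by (auto simp: Z2_simps sy bij_betw_def inj_on_def p_def)
  show "s \<otimes>\<^bsub>integer_mod_group 2\<^esub> t \<in> carrier (integer_mod_group 2) \<and>
      p (s \<otimes>\<^bsub>integer_mod_group 2\<^esub> t) = p s \<circ> p t"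
    if "s \<in> carrier (integer_mod_group 2)" "t \<in> carrier (integer_mod_group 2)" for s t
    using that by (auto simp: Z2_simps p_def)
qed

end

section \<open>Rooting a cluster pattern at an arbitrary vertex\<close>

text \<open>One step in the tree; the word gets shorter when the step backtracks. Tree words are
  based at \<open>[]\<close> while the initial seed may sit at any vertex, and walking by
  \<open>neighbor\<close> allows any base point.\<close>

definition neighbor :: "'n \<Rightarrow> 'n list \<Rightarrow> 'n list" where
  "neighbor k t = (if t \<noteq> [] \<and> hd t = k then tl t else k # t)"

lemma neighbor_edge:
  assumes "t \<in> tree_vertices"
  shows "neighbor k t \<in> tree_vertices" "tree_edge k t (neighbor k t)"
    "neighbor k (neighbor k t) = t"
  using assms by (cases t; auto simp: neighbor_def tree_vertices_def tree_edge_def distinct_adj_Cons)+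

lemma pattern_walk:
  assumes "cluster_pattern \<Sigma>" "t \<in> tree_vertices"
  shows "foldr neighbor w t \<in> tree_vertices" "\<Sigma> (foldr neighbor w t) = seed_at (\<Sigma> t) w"
proof -
  have "foldr neighbor w t \<in> tree_vertices \<and> \<Sigma> (foldr neighbor w t) = seed_at (\<Sigma> t) w"
  proof (induction w)
    case (Cons k w)
    then show ?case using neighbor_edge[of "foldr neighbor w t" k] assms(1)
      unfolding cluster_pattern_def by (metis comp_apply foldr_Cons)
  qed (use assms(2) in simp)
  then show "foldr neighbor w t \<in> tree_vertices" "\<Sigma> (foldr neighbor w t) = seed_at (\<Sigma> t) w" by auto
qed

lemma neighbor_to_root: "t \<in> tree_vertices \<Longrightarrow> foldr neighbor (rev t) t = []"
proof (induction t)
  case (Cons k t)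
  then have "t \<in> tree_vertices" by (auto simp: tree_vertices_def dest: distinct_adj_ConsD)
  then show ?case using Cons.IH by (simp add: neighbor_def)
qed simp

lemma neighbor_from_root: "t \<in> tree_vertices \<Longrightarrow> foldr neighbor t [] = t"
proof (induction t)
  case (Cons k t)
  then have "t \<in> tree_vertices" by (auto simp: tree_vertices_def dest: distinct_adj_ConsD)
  then show ?case using Cons by (cases t) (auto simp: neighbor_def tree_vertices_def)
qed simp

text \<open>Every vertex \<open>t\<close> is reached from \<open>t0\<close> by going to the root
  along \<open>rev t0\<close> and then out along \<open>t\<close>.\<close>

lemma pattern_seeds_walk:
  assumes "cluster_pattern \<Sigma>" "t0 \<in> tree_vertices"
  shows "pattern_seeds \<Sigma> = range (\<lambda>w. seed_at (\<Sigma> t0) w)"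
proof -
  have "\<Sigma> t = seed_at (\<Sigma> t0) (t @ rev t0)" if "t \<in> tree_vertices" for t
  proof -
    have "foldr neighbor (t @ rev t0) t0 = t"
      using neighbor_to_root[OF assms(2)] neighbor_from_root[OF that] by simp
    then show ?thesis using pattern_walk(2)[OF assms, of "t @ rev t0"] by simp
  qed
  then have "\<Sigma> ` tree_vertices \<subseteq> range (\<lambda>w. seed_at (\<Sigma> t0) w)" by blast
  moreover have "seed_at (\<Sigma> t0) w \<in> \<Sigma> ` tree_vertices" for w
    using pattern_walk[OF assms, of w] by (metis imageI)
  ultimately show ?thesis unfolding pattern_seeds_def by blast
qed

theorem theorem4p1:
  fixes a b c :: real
    and B :: "int ^ 3 ^ 3"
    and d :: "int ^ 3"
    and \<Sigma> :: "3 list \<Rightarrow> ('f::field_char_0, 3) seed"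
    and t0 :: "3 list"
  assumes "2 \<le> a" and "a \<le> b" and "b \<le> c" and "a * b \<ge> 2 * c"
    and "skew_symmetrizer d B"
    and "diagram B = {(2, 1, b), (1, 3, c), (3, 2, a)}"
    and "cluster_pattern \<Sigma>" and "t0 \<in> tree_vertices" and "snd (\<Sigma> t0) = B"
  shows "mutation_cyclic B \<and> group (cluster_Aut \<Sigma>) \<and>
    (a = 2 \<longrightarrow>
      (a = b \<and> b = c \<and> d $ 1 = d $ 2 \<and> d $ 2 = d $ 3 \<longrightarrow> cluster_Aut \<Sigma> \<cong> N_phi_S3) \<and>
      (a = b \<and> b = c \<and> card {d $ 1, d $ 2, d $ 3} = 2 \<longrightarrow> cluster_Aut \<Sigma> \<cong> N_tau_Z2) \<and>
      (a = b \<and> b = c \<and> d $ 1 \<noteq> d $ 2 \<and> d $ 1 \<noteq> d $ 3 \<and> d $ 2 \<noteq> d $ 3 \<longrightarrow> cluster_Aut \<Sigma> \<cong> N_group) \<and>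
      (a < b \<and> b = c \<longrightarrow> cluster_Aut \<Sigma> \<cong> D_infinity)) \<and>
    (a > 2 \<and> a * b = 2 * c \<longrightarrow>
      (a = b \<and> b < c \<and> d $ 1 = d $ 3 \<longrightarrow>
         cluster_Aut \<Sigma> \<cong> integer_mod_group 2 \<times>\<times> integer_mod_group 2) \<and>
      (a = b \<and> b < c \<and> d $ 1 \<noteq> d $ 3 \<longrightarrow> cluster_Aut \<Sigma> \<cong> integer_mod_group 2) \<and>
      (a < b \<and> b < c \<longrightarrow> cluster_Aut \<Sigma> \<cong> integer_mod_group 2)) \<and>
    (a > 2 \<and> a * b > 2 * c \<longrightarrow>
      (a = b \<and> b = c \<and> d $ 1 = d $ 2 \<and> d $ 2 = d $ 3 \<longrightarrow> cluster_Aut \<Sigma> \<cong> sym_group 3) \<and>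
      (a = b \<and> b = c \<and> card {d $ 1, d $ 2, d $ 3} = 2 \<longrightarrow> cluster_Aut \<Sigma> \<cong> integer_mod_group 2) \<and>
      (a = b \<and> b = c \<and> d $ 1 \<noteq> d $ 2 \<and> d $ 1 \<noteq> d $ 3 \<and> d $ 2 \<noteq> d $ 3 \<longrightarrow>
         trivial_group (cluster_Aut \<Sigma>)) \<and>
      (a < b \<and> b = c \<and> d $ 2 = d $ 3 \<longrightarrow> cluster_Aut \<Sigma> \<cong> integer_mod_group 2) \<and>
      (a < b \<and> b = c \<and> d $ 2 \<noteq> d $ 3 \<longrightarrow> trivial_group (cluster_Aut \<Sigma>)) \<and>
      (a = b \<and> b < c \<and> d $ 1 = d $ 3 \<longrightarrow> cluster_Aut \<Sigma> \<cong> integer_mod_group 2) \<and>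
      (a = b \<and> b < c \<and> d $ 1 \<noteq> d $ 3 \<longrightarrow> trivial_group (cluster_Aut \<Sigma>)) \<and>
      (a < b \<and> b < c \<longrightarrow> trivial_group (cluster_Aut \<Sigma>)))"
proof -
  note ab = assms(1,2,3,4)
  \<comment> \<open>By opposite vertex: the edge between 2 and 3 has weight \<open>a\<close>,
    between 1 and 3 weight \<open>c\<close>, between 1 and 2 weight \<open>b\<close>.\<close>
  let ?W = "\<lambda>k :: 3. if k = 1 then a else if k = 2 then c else b"
  have W: "?W 1 = a" "?W 2 = c" "?W 3 = b" by simp_all
  have d_pos: "d $ i > 0" for i using assms(5) unfolding skew_symmetrizer_def by blast
  have s0: "(fst (\<Sigma> t0), B) = \<Sigma> t0" using assms(9) by auto
  \<comment> \<open>Minimality at the labels 1, 3 and 2. The last inequality is an assumption; the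
    others hold because \<open>a\<close> and \<open>b\<close> are at least 2 and \<open>c\<close> is
    the largest weight.\<close>
  have le: "2 * a \<le> c * b" "2 * b \<le> a * c" "2 * c \<le> a * b"
  proof -
    have "2 * c \<le> a * c" using ab by (intro mult_right_mono) auto
    moreover have "c * 2 \<le> c * b" using ab by (intro mult_left_mono) auto
    ultimately show "2 * a \<le> c * b" "2 * b \<le> a * c" "2 * c \<le> a * b" using ab by linarith+
  qed
  have prod: "(\<Prod>i\<in>UNIV - {1}. ?W i) = c * b" "(\<Prod>i\<in>UNIV - {2}. ?W i) = a * b"
    "(\<Prod>i\<in>UNIV - {3}. ?W i) = a * c"
    by (simp_all add: UNIV_3_diff[of 2 3 1] UNIV_3_diff[of 1 3 2] UNIV_3_diff[of 1 2 3])
  have minimal: "minimal_weights ?W"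
    unfolding minimal_weights_def forall_3 prod W using le ab by simp
  interpret cyclic_pattern "fst (\<Sigma> t0)" B d ?W
  proof
    show "d $ i > 0" for i by (rule d_pos)
    show "cyclic_matrix d 1 ?W B" using cyclic_matrix_of_diagram[OF assms(5,6)] .
    show "minimal_weights ?W" by (rule minimal)
    show "free_generating (fst (seed_at (fst (\<Sigma> t0), B) w))" for w
      using pattern_walk[OF assms(7,8), of w] assms(7)
      unfolding s0 cluster_pattern_def labeled_seed_def by metis
    show "seed_at (fst (\<Sigma> t0), B) (k # k # w) = seed_at (fst (\<Sigma> t0), B) w" for k w
      unfolding s0 pattern_walk(2)[OF assms(7,8), symmetric]
      using neighbor_edge(3)[OF pattern_walk(1)[OF assms(7,8)]] by simp
  qed
  have "pattern_seeds \<Sigma> = range (\<lambda>w. S w)"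
    using pattern_seeds_walk[OF assms(7,8)] unfolding s0 .
  note aut = cluster_automorphism_iff_aut[OF this]
  have Aut: "cluster_Aut \<Sigma> = Aut"
    unfolding cluster_Aut_def Aut_def aut ..
  have cyc: "mutation_cyclic B"
    unfolding mutation_cyclic_def
  proof
    fix ks
    show "\<not> acyclic_diagram (diagram (foldr mutate_matrix ks B))"
      using cyclic_matrix_not_acyclic[OF d_pos cyclic[of ks]] by (simp add: snd_seed_at)
  qed
  have st: "1 \<in> stable \<longleftrightarrow> c * b = 2 * a" "2 \<in> stable \<longleftrightarrow> a * b = 2 * c" "3 \<in> stable \<longleftrightarrow> a * c = 2 * b"
    using stable_iff[of 2 3 1] stable_iff[of 1 3 2] stable_iff[of 1 2 3] by simp_all
  have all: "stable = UNIV" if "a = 2" "a = b" "b = c"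
    using that st by (simp add: set_eq_iff forall_3)
  have two_three: "stable = {2, 3}" if "a = 2" "a < b" "b = c"
  proof -
    \<comment> \<open>Here \<open>c = b > 2\<close>, so \<open>c * b > 2 * b > 2 * a\<close> and
      label 1 is not stable; the other two equations hold since \<open>a = 2\<close> and
      \<open>b = c\<close>.\<close>
    have "2 * b < c * b" using that by (intro mult_strict_right_mono) auto
    then have "c * b \<noteq> 2 * a" using that by linarith
    then have "1 \<notin> stable" "2 \<in> stable" "3 \<in> stable" using that st by auto
    then show ?thesis by (simp add: set_eq_iff forall_3)
  qed
  \<comment> \<open>For \<open>a > 2\<close> the labels 1 and 3 are never stable, so label 2 is the
    only candidate.\<close>
  have strict: "2 * a < c * b" "2 * b < a * c" if "a > 2"
  proof -
    have "2 * c < a * c" using that ab by (intro mult_strict_right_mono) auto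
    moreover have "c * 2 < c * b" using that ab by (intro mult_strict_left_mono) auto
    ultimately show "2 * a < c * b" "2 * b < a * c" using ab by linarith+
  qed
  have two: "stable = {2}" if "a > 2" "a * b = 2 * c"
  proof -
    have "c * b \<noteq> 2 * a" "a * c \<noteq> 2 * b" using strict[OF that(1)] by linarith+
    then have "1 \<notin> stable" "2 \<in> stable" "3 \<notin> stable" unfolding st using that(2) by auto
    then show ?thesis by (simp add: set_eq_iff forall_3)
  qed
  have none: "stable = {}" if "a > 2" "a * b > 2 * c"
  proof -
    have "c * b \<noteq> 2 * a" "a * b \<noteq> 2 * c" "a * c \<noteq> 2 * b" using strict[OF that(1)] that(2) by linarith+
    then have "1 \<notin> stable" "2 \<notin> stable" "3 \<notin> stable" unfolding st .
    then have "k \<notin> stable" for k using exhaust_3[of k] by metis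
    then show ?thesis by blast
  qed
  have sy_all: "symmetries = {\<sigma>. bij \<sigma>}" if "a = b" "b = c" "d $ 1 = d $ 2" "d $ 2 = d $ 3"
  proof (rule symmetries_all)
    have d3: "d $ i = d $ 3" for i using that exhaust_3[of i] by auto
    show "d $ i = d $ j" for i j unfolding d3[of i] d3[of j] ..
  qed (use that in simp)
  have sy_two: "\<exists>i j k. i \<noteq> j \<and> i \<noteq> k \<and> j \<noteq> k \<and> symmetries = {id, Transposition.transpose i j}"
    if "a = b" "b = c" "card {d $ 1, d $ 2, d $ 3} = 2"
  proof -
    have sw: "symmetries = {id, Transposition.transpose i j}"
      if "i \<noteq> j" "i \<noteq> k" "j \<noteq> k" "d $ i = d $ j" "d $ k \<noteq> d $ i" for i j k
      by (rule symmetries_swap[OF that(1-3)]) (use that \<open>a = b\<close> \<open>b = c\<close> in auto)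
    consider "d $ 1 = d $ 2" "d $ 3 \<noteq> d $ 1" | "d $ 1 = d $ 3" "d $ 2 \<noteq> d $ 1" | "d $ 2 = d $ 3" "d $ 1 \<noteq> d $ 2"
      using \<open>card {d $ 1, d $ 2, d $ 3} = 2\<close> by (auto simp: card_insert_if split: if_splits)
    then show ?thesis
    proof cases
      case 1
      then show ?thesis using sw[of 1 2 3] by (intro exI[of _ 1] exI[of _ 2] exI[of _ 3]) auto
    next
      case 2
      then show ?thesis using sw[of 1 3 2] by (intro exI[of _ 1] exI[of _ 3] exI[of _ 2]) auto
    next
      case 3
      then show ?thesis using sw[of 2 3 1] by (intro exI[of _ 2] exI[of _ 3] exI[of _ 1]) auto
    qed
  qed
  have sy_d: "symmetries = {id}" if "d $ 1 \<noteq> d $ 2" "d $ 1 \<noteq> d $ 3" "d $ 2 \<noteq> d $ 3"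
    by (rule symmetries_trivial) (use that exhaust_3 in metis)
  have sy_23: "symmetries = {id, Transposition.transpose 2 3}" if "a < b" "b = c" "d $ 2 = d $ 3"
    by (rule symmetries_swap[of _ _ 1]) (use that in auto)
  have sy_23': "symmetries = {id}" if "a < b" "b = c" "d $ 2 \<noteq> d $ 3"
  proof (rule symmetries_trivial)
    fix i j :: 3 assume "i \<noteq> j"
    then show "?W i \<noteq> ?W j \<or> d $ i \<noteq> d $ j"
      using that exhaust_3[of i] exhaust_3[of j] by auto
  qed
  have sy_13: "symmetries = {id, Transposition.transpose 1 3}" if "a = b" "b < c" "d $ 1 = d $ 3"
    by (rule symmetries_swap[of _ _ 2]) (use that in auto)
  have sy_13': "symmetries = {id}" if "a = b" "b < c" "d $ 1 \<noteq> d $ 3"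
  proof (rule symmetries_trivial)
    fix i j :: 3 assume "i \<noteq> j"
    then show "?W i \<noteq> ?W j \<or> d $ i \<noteq> d $ j"
      using that exhaust_3[of i] exhaust_3[of j] by auto
  qed
  have sy_W: "symmetries = {id}" if "a < b" "b < c"
  proof (rule symmetries_trivial)
    fix i j :: 3 assume "i \<noteq> j"
    then show "?W i \<noteq> ?W j \<or> d $ i \<noteq> d $ j"
      using that exhaust_3[of i] exhaust_3[of j] by auto
  qed
  have tau: "Transposition.transpose i j \<noteq> id" if "i \<noteq> j" for i j :: 3
    using that by (metis id_apply transpose_apply_first)
  have N: "Aut \<cong> N_group" if "stable = UNIV" "symmetries = {id}"
    unfolding N_group_def
  proof (rule Aut_iso_involution_group[OF _ that(2)])
    show "bij_betw (\<lambda>n :: nat. if n = 1 then 1 else if n = 2 then 2 else 3 :: 3) {1, 2, 3} stable"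
      unfolding that(1) by (rule bij_betw_enum_3) auto
  qed
  \<comment> \<open>The generating involutions differ: if \<open>d $ 2 = d $ 3\<close>, they are one
    mutation and the swap of 2 and 3; otherwise they are the mutations at 2 and 3.\<close>
  have D: "Aut \<cong> D_infinity" if "a = 2" "a < b" "b = c"
  proof (cases "d $ 2 = d $ 3")
    case True
    show ?thesis unfolding D_infinity_def
      by (rule Aut_iso_D_infinity_swap[OF two_three[OF that] _ sy_23[OF that(2,3) True]]) auto
  next
    case False
    have "bij_betw (\<lambda>n :: nat. if n = 1 then 2 else 3 :: 3) {1, 2} stable"
      unfolding two_three[OF that] by (auto simp: bij_betw_def inj_on_def)
    then show ?thesis unfolding D_infinity_def
      by (rule Aut_iso_involution_group[OF _ sy_23'[OF that(2,3) False]])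
  qed
  have c1: "Aut \<cong> N_phi_S3" if "a = 2" "a = b" "b = c" "d $ 1 = d $ 2" "d $ 2 = d $ 3"
    by (rule Aut_iso_N_phi_S3[OF all[OF that(1-3)] sy_all[OF that(2-5)]])
  have c2: "Aut \<cong> N_tau_Z2" if "a = 2" "a = b" "b = c" "card {d $ 1, d $ 2, d $ 3} = 2"
    using sy_two[OF that(2-4)] Aut_iso_N_tau_Z2[OF all[OF that(1-3)]] by blast
  have c3: "Aut \<cong> N_group"
    if "a = 2" "a = b" "b = c" "d $ 1 \<noteq> d $ 2" "d $ 1 \<noteq> d $ 3" "d $ 2 \<noteq> d $ 3"
    by (rule N[OF all[OF that(1-3)] sy_d[OF that(4-6)]])
  have c4: "Aut \<cong> integer_mod_group 2 \<times>\<times> integer_mod_group 2"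
    if "a > 2" "a * b = 2 * c" "a = b" "b < c" "d $ 1 = d $ 3"
    by (rule Aut_iso_Z2_Z2[OF two[OF that(1,2)] sy_13[OF that(3-5)] tau]) auto
  have c5: "Aut \<cong> integer_mod_group 2" if "a > 2" "a * b = 2 * c" "symmetries = {id}"
    by (rule Aut_iso_Z2[OF two[OF that(1,2)] that(3)])
  have c6: "Aut \<cong> sym_group 3"
    if "a > 2" "a * b > 2 * c" "a = b" "b = c" "d $ 1 = d $ 2" "d $ 2 = d $ 3"
    by (rule Aut_iso_sym_group_3[OF none[OF that(1,2)] sy_all[OF that(3-6)]])
  have c7: "Aut \<cong> integer_mod_group 2"
    if "a > 2" "a * b > 2 * c" "a = b" "b = c" "card {d $ 1, d $ 2, d $ 3} = 2"
    using sy_two[OF that(3-5)] Aut_iso_Z2_swap[OF none[OF that(1,2)]] by blast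
  have c8: "Aut \<cong> integer_mod_group 2"
    if "a > 2" "a * b > 2 * c" "i \<noteq> j" "symmetries = {id, Transposition.transpose i j}" for i j
    by (rule Aut_iso_Z2_swap[OF none[OF that(1,2)] that(3,4)])
  have c9: "trivial_group Aut" if "a > 2" "a * b > 2 * c" "symmetries = {id}"
    by (rule Aut_trivial[OF none[OF that(1,2)] that(3)])
  have ne: "(2 :: 3) \<noteq> 3" "(1 :: 3) \<noteq> 3" by simp_all
  show ?thesis
    unfolding Aut
  proof (intro conjI impI; (elim conjE)?)
    show "mutation_cyclic B" by (rule cyc)
    show "group Aut" by (rule group_Aut)
  qed (assumption | rule c1 c2 c3 D c4 c6 c7 c8[OF _ _ ne(1) sy_23] c8[OF _ _ ne(2) sy_13]
    c5[OF _ _ sy_13'] c5[OF _ _ sy_W] c9[OF _ _ sy_d] c9[OF _ _ sy_23'] c9[OF _ _ sy_13'] c9[OF _ _ sy_W])+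
qed

end
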